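(* Let $u\in H(\mathbb{D})$ and $\varphi,\psi\in S(\mathbb{D})$. Then $C_{u,\varphi}-C_{\psi}$ is compact on $H^2(\mathbb{D})$ if and only if both $C_{u',\varphi}:H^2(\mathbb{D})\to A_1^2(\mathbb{D})$ and $C_{u\varphi',\varphi}-C_{\psi',\psi}:A_1^2(\mathbb{D})\to A_1^2(\mathbb{D})$ are compact.
   Context: $\mathbb{D}$ is the open unit disc, $H(\mathbb{D})$ the analytic functions on $\mathbb{D}$, $S(\mathbb{D})$ the analytic self-maps of $\mathbb{D}$. $H^2(\mathbb{D})$ is the Hardy space. $dA=\frac1\pi dx\,dy$, $dA_1(z)=2(1-|z|^2)dA(z)$, and $A_1^2(\mathbb{D})$ is the space of $f\in H(\mathbb{D})$ with $\int_{\mathbb{D}}|f|^2dA_1<\infty$. For $w\in H(\mathbb{D})$ and $\varphi\in S(\mathbb{D})$, $C_{w,\varphi}f=w\cdot(f\circ\varphi)$ and $C_\psi f=f\circ\psi$. *)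

theory Defs
  imports "HOL-Analysis.Analysis"
begin

abbreviation unit_disc :: "complex set" where
  "unit_disc \<equiv> ball 0 1"

definition self_map :: "(complex \<Rightarrow> complex) \<Rightarrow> bool" where
  "self_map \<phi> \<longleftrightarrow> \<phi> holomorphic_on unit_disc \<and> \<phi> ` unit_disc \<subseteq> unit_disc"

definition H2_normsq :: "(complex \<Rightarrow> complex) \<Rightarrow> ennreal" where
  "H2_normsq f = (SUP r\<in>{0..<1::real}.
     ennreal (1 / (2 * pi)) *
     (\<integral>\<^sup>+ t. ennreal ((cmod (f (complex_of_real r * cis t)))\<^sup>2)
        * indicator {0..2 * pi} t \<partial>lborel))"

definition in_H2 :: "(complex \<Rightarrow> complex) \<Rightarrow> bool" where
  "in_H2 f \<longleftrightarrow> f holomorphic_on unit_disc \<and> H2_normsq f < \<infinity>"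

definition H2_norm :: "(complex \<Rightarrow> complex) \<Rightarrow> real" where
  "H2_norm f = sqrt (enn2real (H2_normsq f))"

text \<open>Squared norm of the weighted Bergman space A_1^2:
  \<integral>_D |f|^2 dA_1 with dA_1(z) = 2(1-|z|^2) dA(z), dA = dx dy / pi.\<close>
definition A12_normsq :: "(complex \<Rightarrow> complex) \<Rightarrow> ennreal" where
  "A12_normsq f = (\<integral>\<^sup>+ z. ennreal ((cmod (f z))\<^sup>2 * (2 * (1 - (cmod z)\<^sup>2)) / pi)
        * indicator unit_disc z \<partial>lborel)"

definition in_A12 :: "(complex \<Rightarrow> complex) \<Rightarrow> bool" where
  "in_A12 f \<longleftrightarrow> f holomorphic_on unit_disc \<and> A12_normsq f < \<infinity>"

definition A12_norm :: "(complex \<Rightarrow> complex) \<Rightarrow> real" where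
  "A12_norm f = sqrt (enn2real (A12_normsq f))"

definition wcomp :: "(complex \<Rightarrow> complex) \<Rightarrow> (complex \<Rightarrow> complex) \<Rightarrow>
    (complex \<Rightarrow> complex) \<Rightarrow> (complex \<Rightarrow> complex)" where
  "wcomp w \<phi> f = (\<lambda>z. w z * f (\<phi> z))"

definition comp_op :: "(complex \<Rightarrow> complex) \<Rightarrow> (complex \<Rightarrow> complex) \<Rightarrow> (complex \<Rightarrow> complex)" where
  "comp_op \<psi> f = (\<lambda>z. f (\<psi> z))"

definition compact_op ::
  "((complex \<Rightarrow> complex) \<Rightarrow> bool) \<Rightarrow> ((complex \<Rightarrow> complex) \<Rightarrow> real) \<Rightarrow>
   ((complex \<Rightarrow> complex) \<Rightarrow> bool) \<Rightarrow> ((complex \<Rightarrow> complex) \<Rightarrow> real) \<Rightarrow>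
   ((complex \<Rightarrow> complex) \<Rightarrow> (complex \<Rightarrow> complex)) \<Rightarrow> bool" where
  "compact_op inX nX inY nY T \<longleftrightarrow>
     (\<forall>f. inX f \<longrightarrow> inY (T f)) \<and>
     (\<forall>fs :: nat \<Rightarrow> complex \<Rightarrow> complex. (\<forall>n. inX (fs n)) \<and> (\<exists>B. \<forall>n. nX (fs n) \<le> B) \<longrightarrow>
        (\<exists>r g. strict_mono r \<and> inY g \<and> (\<lambda>n. nY (T (fs (r n)) - g)) \<longlonglongrightarrow> 0))"

end

theory Submission
  imports Defs "HOL-Complex_Analysis.Complex_Analysis"
begin

text \<open>
  Let \<open>T = C\<^bsub>u,\<phi>\<^esub> - C\<^sub>\<psi>\<close>, \<open>R = C\<^bsub>u',\<phi>\<^esub>\<close> and \<open>S = C\<^bsub>u\<phi>',\<phi>\<^esub> - C\<^bsub>\<psi>',\<psi>\<^esub>\<close>, so that \<open>(T f)' = R f + S f'\<close>. By Parseval,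
  \<open>f \<mapsto> f'\<close> identifies \<open>H^2\<close> modulo constants with \<open>A_1^2\<close>, which gives the implication from \<open>R\<close> and \<open>S\<close> to \<open>T\<close>,
  and reduces the converse to the compactness of \<open>S\<close>.

  So let \<open>T\<close> be compact. Let \<open>k\<^sub>a\<close> be the normalised Szego kernel, \<open>\<sigma>\<^sub>a\<close> the disc automorphism vanishing at
  \<open>a\<close>, and \<open>s = \<sigma>\<^sub>a \<circ> \<phi>\<close>, \<open>t = \<sigma>\<^sub>a \<circ> \<psi>\<close>. The images \<open>w\<^sub>j = T (\<sigma>\<^sub>a\<^sup>j k\<^sub>a)\<close>, \<open>j \<le> 2\<close>, tend to zero as \<open>|a| \<rightarrow> 1\<close>. Multiplying by
  the bounded functions \<open>s\<close> and \<open>t\<close> one eliminates one of the two composition operators, e.g.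
  \<open>s w\<^sub>0 - w\<^sub>1 = (t - s) k\<^sub>a \<circ> \<psi>\<close>, and comparing derivatives for consecutive \<open>j\<close> removes the derivative of the weight.
  In this way \<open>S\<close> is small on normalised \<open>A_1^2\<close>-kernels at \<open>a\<close>, and so are its two summands after multiplication with
  \<open>s - t\<close>. A local sub-mean-value estimate bounds \<open>|S h|\<^sup>2\<close> pointwise by an average of \<open>|h a|\<^sup>2\<close> against exactly these
  quantities, and Tonelli's theorem yields the compactness of \<open>S\<close>.
\<close>

section \<open>Integrals over discs and circles\<close>

text \<open>The two summands of S need not be compact separately (take \<open>u = 1\<close> and let
  both \<open>\<phi>\<close> and \<open>\<psi>\<close> be the identity), so no Carleson-type
  criterion applies to them one at a time: every estimate has to keep their cancellation.

  Write p and q for k_a composed with \<open>\<phi>\<close> and \<open>\<psi>\<close>. Comparing the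
  derivatives of w_0 and w_1 already produces u \<phi>' p^3 - \<psi>' q^3, but with an error (s - t)
  q'. Since q' equals cnj a * q^2 \<psi>' / sqrt(1 - |a|^2), this error is not dominated by (s - t)
  \<psi>' q^3, the only quantity of its kind that is under control. Passing to w_j + cnj a * w_(j+1)
  repairs this: by 1 + cnj a * \<sigma>_a = sqrt(1 - |a|^2) k_a it replaces k_a by sqrt(1 - |a|^2)
  k_a^2, whose derivative is exactly 2 cnj a * k_a^3. This is the origin of the third test function
  and of the fourth powers in \<open>pair_kernel\<close>.\<close>

lemma nn_integral_lborel_translate:
  fixes g :: "'a::euclidean_space \<Rightarrow> ennreal"
  assumes [measurable]: "g \<in> borel_measurable borel"
  shows "(\<integral>\<^sup>+x. g (x + c) \<partial>lborel) = (\<integral>\<^sup>+x. g x \<partial>lborel)"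
proof -
  have "(\<integral>\<^sup>+x. g x \<partial>lborel) = (\<integral>\<^sup>+x. g x \<partial>distr lborel borel ((+) c))"
    by (simp add: lborel_distr_plus)
  also have "\<dots> = (\<integral>\<^sup>+x. g (c + x) \<partial>lborel)"
    by (rule nn_integral_distr) auto
  finally show ?thesis by (simp add: add.commute)
qed

lemma nn_integral_lborel_reflect:
  fixes g :: "complex \<Rightarrow> ennreal"
  assumes [measurable]: "g \<in> borel_measurable borel"
  shows "(\<integral>\<^sup>+x. g (c - x) \<partial>lborel) = (\<integral>\<^sup>+x. g x \<partial>lborel)"
proof -
  have "(\<integral>\<^sup>+x. g x \<partial>lborel) = (\<integral>\<^sup>+x. g x \<partial>distr lborel borel (\<lambda>x. c + (-1) *\<^sub>R x))"
    using lborel_affine[of "-1" c] by (simp add: density_1 cong: distr_cong)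
  also have "\<dots> = (\<integral>\<^sup>+x. g (c + (-1) *\<^sub>R x) \<partial>lborel)"
    by (rule nn_integral_distr) auto
  finally show ?thesis by simp
qed

text \<open>Translation invariance determines \<^const>\<open>lborel\<close> up to a factor; the unit disc fixes that factor.\<close>
lemma nn_integral_lborel_rotate:
  fixes f :: "complex \<Rightarrow> ennreal"
  assumes [measurable]: "f \<in> borel_measurable borel" and c: "cmod c = 1"
  shows "(\<integral>\<^sup>+x. f (c * x) \<partial>lborel) = (\<integral>\<^sup>+x. f x \<partial>lborel)"
proof -
  define g :: "complex \<Rightarrow> ennreal" where "g = indicator (ball 0 1)"
  have [measurable]: "g \<in> borel_measurable borel" unfolding g_def by (rule borel_measurable_indicator) simp
  have c0: "c \<noteq> 0" using c by auto
  have gc: "g (c * x) = g x" for x by (simp add: g_def indicator_def norm_mult c)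
  have gint: "(\<integral>\<^sup>+x. g x \<partial>lborel) = ennreal pi"
    by (simp add: g_def emeasure_ball unit_ball_vol_2)
  have "(\<integral>\<^sup>+x. f (c * x) \<partial>lborel) * (\<integral>\<^sup>+y. g y \<partial>lborel)
      = (\<integral>\<^sup>+x. (\<integral>\<^sup>+y. f (c * x) * g y \<partial>lborel) \<partial>lborel)"
    by (simp add: nn_integral_cmult nn_integral_multc)
  also have "\<dots> = (\<integral>\<^sup>+x. (\<integral>\<^sup>+y. f (c * x) * g (y + c * x) \<partial>lborel) \<partial>lborel)"
    by (simp add: nn_integral_cmult nn_integral_lborel_translate)
  also have "\<dots> = (\<integral>\<^sup>+y. (\<integral>\<^sup>+x. f (c * x) * g (y + c * x) \<partial>lborel) \<partial>lborel)"
    by (rule lborel_pair.Fubini') measurable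
  \<comment> \<open>The shift of \<open>x\<close> by -y/c moves \<open>y\<close> from the argument
    of \<open>g\<close> to that of \<open>f\<close>. After one more exchange of the integrals, the
    inner integral over \<open>y\<close> of \<open>f (c * x - y)\<close> no longer depends on
    \<open>x\<close>.\<close>
  also have "\<dots> = (\<integral>\<^sup>+y. (\<integral>\<^sup>+x. f (c * (x + (- y / c))) * g (y + c * (x + (- y / c))) \<partial>lborel) \<partial>lborel)"
    by (intro nn_integral_cong nn_integral_lborel_translate[symmetric]) measurable
  also have "\<dots> = (\<integral>\<^sup>+y. (\<integral>\<^sup>+x. f (c * x - y) * g (c * x) \<partial>lborel) \<partial>lborel)"
    using c0 by (simp add: algebra_simps)
  also have "\<dots> = (\<integral>\<^sup>+x. (\<integral>\<^sup>+y. f (c * x - y) * g (c * x) \<partial>lborel) \<partial>lborel)"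
    by (rule lborel_pair.Fubini') measurable
  also have "\<dots> = (\<integral>\<^sup>+x. f x \<partial>lborel) * (\<integral>\<^sup>+y. g y \<partial>lborel)"
    by (simp add: nn_integral_multc nn_integral_cmult nn_integral_lborel_reflect gc)
  finally show ?thesis
    using pi_gt_zero by (simp add: gint mult.commute[of _ "ennreal pi"] ennreal_mult_cancel_left)
qed

text \<open>Stands in for the angular part of polar coordinates: rotations preserve area, so
  \<open>f\<close> may be averaged over them, and the inner integral then runs over the full circle
  through \<open>z\<close>, where Parseval applies.\<close>

lemma nn_integral_lborel_circle_average:
  fixes f :: "complex \<Rightarrow> ennreal"
  assumes [measurable]: "f \<in> borel_measurable borel"
  shows "ennreal (2 * pi) * (\<integral>\<^sup>+z. f z \<partial>lborel)
    = (\<integral>\<^sup>+z. (\<integral>\<^sup>+t. f (cis t * z) * indicator {0..2*pi} t \<partial>lborel) \<partial>lborel)"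
proof -
  have [measurable]: "cis \<in> borel_measurable borel"
    by (intro borel_measurable_continuous_onI continuous_intros)
  have "ennreal (2 * pi) * (\<integral>\<^sup>+z. f z \<partial>lborel)
     = (\<integral>\<^sup>+t. (\<integral>\<^sup>+z. f z \<partial>lborel) * indicator {0..2*pi} (t::real) \<partial>lborel)"
    by (subst nn_integral_cmult) (simp_all add: mult.commute)
  also have "\<dots> = (\<integral>\<^sup>+t. (\<integral>\<^sup>+z. f (cis t * z) * indicator {0..2*pi} t \<partial>lborel) \<partial>lborel)"
    by (intro nn_integral_cong) (simp add: nn_integral_lborel_rotate nn_integral_multc)
  also have "\<dots> = (\<integral>\<^sup>+z. (\<integral>\<^sup>+t. f (cis t * z) * indicator {0..2*pi} t \<partial>lborel) \<partial>lborel)"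
    by (rule lborel_pair.Fubini') measurable
  finally show ?thesis .
qed

text \<open>The set where |z|^2 exceeds x has area pi (1 - x), so the image of area on the disc
  under |z|^2 agrees on all half-lines with pi times length on [0,1), and finite measures on the
  line are determined by half-lines. This is the radial part of polar coordinates.\<close>

lemma nn_integral_disc_radial:
  fixes g :: "real \<Rightarrow> ennreal"
  assumes [measurable]: "g \<in> borel_measurable borel"
  shows "(\<integral>\<^sup>+z. g ((cmod z)\<^sup>2) * indicator unit_disc z \<partial>lborel)
    = ennreal pi * (\<integral>\<^sup>+s. g s * indicator {0..<1} s \<partial>lborel)"
proof -
  define N where "N = distr (density lborel (indicator unit_disc)) borel (\<lambda>z. (cmod z)\<^sup>2)"
  define N' where "N' = density lborel (\<lambda>s::real. ennreal pi * indicator {0..<1} s)"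
  have [measurable]: "unit_disc \<in> sets borel" by simp
  have [measurable]: "(indicator unit_disc :: complex \<Rightarrow> ennreal) \<in> borel_measurable borel"
    by (rule borel_measurable_indicator) simp
  have eN: "emeasure N A = emeasure lborel {z \<in> unit_disc. (cmod z)\<^sup>2 \<in> A}" if [measurable]: "A \<in> sets borel" for A
  proof -
    have [measurable]: "(\<lambda>z::complex. (cmod z)\<^sup>2) -` A \<in> sets borel"
      by (rule measurable_sets_borel[OF _ that]) measurable
    have "emeasure N A = emeasure (density lborel (indicator unit_disc)) ((\<lambda>z. (cmod z)\<^sup>2) -` A)"
      unfolding N_def by (subst emeasure_distr) auto
    also have "\<dots> = (\<integral>\<^sup>+z. indicator unit_disc z * indicator ((\<lambda>z. (cmod z)\<^sup>2) -` A) z \<partial>lborel)"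
      by (rule emeasure_density) auto
    also have "\<dots> = (\<integral>\<^sup>+z. indicator {z \<in> unit_disc. (cmod z)\<^sup>2 \<in> A} z \<partial>lborel)"
      by (intro nn_integral_cong) (simp split: split_indicator)
    also have "\<dots> = emeasure lborel {z \<in> unit_disc. (cmod z)\<^sup>2 \<in> A}"
      by (subst nn_integral_indicator) auto
    finally show ?thesis .
  qed
  have eN': "emeasure N' A = ennreal pi * emeasure lborel ({0..<1} \<inter> A)" if "A \<in> sets borel" for A
  proof -
    have "emeasure N' A = (\<integral>\<^sup>+s. ennreal pi * indicator ({0..<1} \<inter> A) s \<partial>lborel)"
      unfolding N'_def using that
      by (subst emeasure_density) (auto intro!: nn_integral_cong simp: indicator_def)
    also have "\<dots> = ennreal pi * emeasure lborel ({0..<1} \<inter> A)"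
      using that by (subst nn_integral_cmult) auto
    finally show ?thesis .
  qed
  have ball: "emeasure lborel (ball (0::complex) 1) = ennreal pi"
    by (simp add: emeasure_ball unit_ball_vol_2)
  have key: "emeasure N {x<..} = emeasure N' {x<..}" for x
  proof -
    have x: "{x<..} \<in> sets borel" by simp
    consider "x < 0" | "0 \<le> x" "x < 1" | "x \<ge> 1" by linarith
    then show ?thesis
    proof cases
      case 1
      then have e: "{z \<in> unit_disc. (cmod z)\<^sup>2 \<in> {x<..}} = unit_disc" "{0..<1} \<inter> {x<..} = {0..<1::real}"
        by (auto intro: less_le_trans[OF 1])
      show ?thesis unfolding eN[OF x] eN'[OF x] e by (simp add: ball)
    next
      case 2
      have eq: "(cmod z)\<^sup>2 > x \<longleftrightarrow> cmod z > sqrt x" for z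
        using 2 by (metis norm_ge_zero real_less_lsqrt real_sqrt_abs abs_norm_cancel real_sqrt_less_iff)
      have e: "{z \<in> unit_disc. (cmod z)\<^sup>2 \<in> {x<..}} = ball 0 1 - cball 0 (sqrt x)"
         "{0..<1} \<inter> {x<..} = {x<..<1::real}"
        using 2 by (auto simp: eq)
      have "sqrt x < 1" using 2 by (simp add: real_sqrt_lt_1_iff)
      have "emeasure lborel (ball 0 1 - cball (0::complex) (sqrt x)) = ennreal pi - ennreal (pi * x)"
      proof (subst emeasure_Diff)
        show "cball (0::complex) (sqrt x) \<subseteq> ball 0 1" using cball_subset_ball_iff[of "0::complex" "sqrt x" 0 1] \<open>sqrt x < 1\<close> by simp
      qed (use 2 in \<open>auto simp: ball emeasure_cball unit_ball_vol_2\<close>)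
      also have "\<dots> = ennreal pi * ennreal (1 - x)"
        using 2 by (simp add: ennreal_minus ennreal_mult'[symmetric] right_diff_distrib)
      finally show ?thesis using 2 unfolding eN[OF x] eN'[OF x] e by simp
    next
      case 3
      have "(cmod z)\<^sup>2 < 1" if "cmod z < 1" for z
        using that by (simp add: power_less_one_iff abs_square_less_1)
      then have e: "{z \<in> unit_disc. (cmod z)\<^sup>2 \<in> {x<..}} = {}" "{0..<1} \<inter> {x<..} = {}"
        using 3 by fastforce+
      show ?thesis unfolding eN[OF x] eN'[OF x] e by simp
    qed
  qed
  have "N = N'"
  proof (rule measure_eqI_lessThan)
    fix x :: real
    have "emeasure lborel ({0..<1} \<inter> {x<..}) \<le> emeasure lborel {0..<1::real}"
      by (rule emeasure_mono) auto
    then show "emeasure N {x<..} < \<infinity>"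
      unfolding key by (simp add: eN' ennreal_mult_less_top le_less_trans)
  qed (auto simp: N_def N'_def key[unfolded N_def N'_def])
  have "(\<integral>\<^sup>+z. g ((cmod z)\<^sup>2) * indicator unit_disc z \<partial>lborel) = (\<integral>\<^sup>+s. g s \<partial>N)"
    unfolding N_def by (subst nn_integral_distr) (auto simp: nn_integral_density mult.commute)
  also have "\<dots> = ennreal pi * (\<integral>\<^sup>+s. g s * indicator {0..<1} s \<partial>lborel)"
    unfolding \<open>N = N'\<close> N'_def
    by (subst nn_integral_density) (auto simp: nn_integral_cmult[symmetric] mult_ac)
  finally show ?thesis .
qed

section \<open>Orthogonality of exponentials and Parseval's identity on circles\<close>

lemma has_integral_cis_int:
  "((\<lambda>t. cis (of_int k * t)) has_integral (if k = 0 then 2 * pi else 0)) {0..2*pi}"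
proof (cases "k = 0")
  case True
  have "((\<lambda>t::real. 1::complex) has_integral (2*pi - 0) *\<^sub>R 1) {0..2*pi}"
    using has_integral_const_real[of "1::complex" 0 "2*pi"] by simp
  then show ?thesis using True by (simp add: scaleR_conv_of_real)
next
  case False
  let ?F = "\<lambda>t. cis (of_int k * t) / (\<i> * of_int k)"
  have "((\<lambda>t. cis (of_int k * t)) has_integral (?F (2*pi) - ?F 0)) {0..2*pi}"
  proof (rule fundamental_theorem_of_calculus)
    fix x :: real
    show "(?F has_vector_derivative cis (of_int k * x)) (at x within {0..2*pi})"
      unfolding has_vector_derivative_def using False
      by (auto intro!: derivative_eq_intros simp: scaleR_conv_of_real field_simps)
  qed simp
  moreover have "cis (of_int k * (2*pi)) = 1"
    using cis_multiple_2pi[of "of_int k"] by (simp add: mult_ac)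
  ultimately show ?thesis using False by simp
qed

lemma nn_integral_trig_polynomial:
  "(\<integral>\<^sup>+t. ennreal ((cmod (\<Sum>n<N. c n * cis (real n * t)))\<^sup>2) * indicator {0..2*pi} t \<partial>lborel)
     = ennreal (2 * pi * (\<Sum>n<N. (cmod (c n))\<^sup>2))"
proof -
  let ?P = "\<lambda>t. \<Sum>n<N. c n * cis (real n * t)"
  have 1: "complex_of_real ((cmod (?P t))\<^sup>2) = (\<Sum>n<N. \<Sum>m<N. c n * cnj (c m) * cis (of_int (int n - int m) * t))" for t
  proof -
    have "complex_of_real ((cmod (?P t))\<^sup>2) = ?P t * cnj (?P t)"
      by (rule complex_norm_square)
    also have "\<dots> = (\<Sum>n<N. \<Sum>m<N. c n * cnj (c m) * (cis (real n * t) * cis (- (real m * t))))"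
      by (simp add: sum_product cis_cnj mult_ac)
    finally show ?thesis by (simp add: cis_mult algebra_simps)
  qed
  have 2: "((\<lambda>t. \<Sum>n<N. \<Sum>m<N. c n * cnj (c m) * cis (of_int (int n - int m) * t)) has_integral
     (\<Sum>n<N. \<Sum>m<N. c n * cnj (c m) * (if int n - int m = 0 then 2 * pi else 0))) {0..2*pi}"
    by (intro has_integral_sum has_integral_mult_right has_integral_cis_int) auto
  have 3: "(\<Sum>n<N. \<Sum>m<N. c n * cnj (c m) * (if int n - int m = 0 then 2 * pi else 0)) = 
      complex_of_real (2 * pi * (\<Sum>n<N. (cmod (c n))\<^sup>2))"
  proof -
    have "(\<Sum>m<N. c n * cnj (c m) * (if int n - int m = 0 then 2 * pi else 0)) = 2 * pi * (c n * cnj (c n))" if "n < N" for n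
    proof -
      have "(\<Sum>m<N. c n * cnj (c m) * (if int n - int m = 0 then 2 * pi else 0)) 
         = (\<Sum>m<N. if m = n then 2 * pi * (c n * cnj (c n)) else 0)"
        by (intro sum.cong) auto
      then show ?thesis using that by (simp add: sum.delta)
    qed
    then show ?thesis
      by (simp add: complex_norm_square[symmetric] sum_distrib_left)
  qed
  have "((\<lambda>t. complex_of_real ((cmod (?P t))\<^sup>2)) has_integral complex_of_real (2 * pi * (\<Sum>n<N. (cmod (c n))\<^sup>2))) {0..2*pi}"
    unfolding 1 using 2 unfolding 3 .
  from has_integral_linear[OF this bounded_linear_Re]
  have "((\<lambda>t. (cmod (?P t))\<^sup>2) has_integral (2 * pi * (\<Sum>n<N. (cmod (c n))\<^sup>2))) {0..2*pi}"
    by (simp add: o_def)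
  then have "((\<lambda>t. (cmod (?P t))\<^sup>2 * indicator {0..2*pi} t) has_integral (2 * pi * (\<Sum>n<N. (cmod (c n))\<^sup>2))) UNIV"
    by (subst (asm) has_integral_restrict_UNIV[symmetric])
       (auto elim!: has_integral_eq[rotated] simp: indicator_def)
  then have "(\<integral>\<^sup>+t. ennreal ((cmod (?P t))\<^sup>2 * indicator {0..2*pi} t) \<partial>lborel) = ennreal (2 * pi * (\<Sum>n<N. (cmod (c n))\<^sup>2))"
  proof (intro nn_integral_has_integral_lborel)
    have [measurable]: "(\<lambda>t. ?P t) \<in> borel_measurable borel"
      by (intro borel_measurable_continuous_onI continuous_intros)
    show "(\<lambda>t. (cmod (?P t))\<^sup>2 * indicator {0..2*pi} t) \<in> borel_measurable borel" by measurable
  qed auto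
  then show ?thesis by (simp add: ennreal_mult' ennreal_indicator)
qed

text \<open>The sum of the moduli of the coefficients dominates all partial sums, so the identity
  for polynomials passes to the limit by dominated convergence. Power series on circles strictly
  inside the disc of convergence satisfy the hypothesis.\<close>

lemma nn_integral_fourier_series:
  assumes "summable (\<lambda>n. cmod (c n))"
  shows "(\<integral>\<^sup>+t. ennreal ((cmod (\<Sum>n. c n * cis (real n * t)))\<^sup>2) * indicator {0..2*pi} t \<partial>lborel)
     = ennreal (2 * pi) * (\<Sum>n. ennreal ((cmod (c n))\<^sup>2))"
proof -
  let ?P = "\<lambda>N t. \<Sum>n<N. c n * cis (real n * t)"
  let ?f = "\<lambda>t. \<Sum>n. c n * cis (real n * t)"
  define B where "B = (\<Sum>n. cmod (c n))"
  have sm: "summable (\<lambda>n. c n * cis (real n * t))" for t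
    by (rule summable_norm_cancel) (simp add: norm_mult assms)
  have lim: "(\<lambda>N. ?P N t) \<longlonglongrightarrow> ?f t" for t
    using summable_LIMSEQ[OF sm] .
  have PB: "cmod (?P N t) \<le> B" for N t
  proof -
    have "cmod (?P N t) \<le> (\<Sum>n<N. cmod (c n))"
      by (rule order_trans[OF norm_sum]) (simp add: norm_mult)
    also have "\<dots> \<le> B" unfolding B_def by (rule sum_le_suminf[OF assms]) auto
    finally show ?thesis .
  qed
  have [measurable]: "?P N \<in> borel_measurable borel" for N
    by (intro borel_measurable_continuous_onI continuous_intros)
  have [measurable]: "?f \<in> borel_measurable borel"
    by (rule borel_measurable_LIMSEQ_metric[OF _ lim]) measurable
  have "(\<lambda>N. \<integral>\<^sup>+t. ennreal ((cmod (?P N t))\<^sup>2) * indicator {0..2*pi} t \<partial>lborel) \<longlonglongrightarrow>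
    (\<integral>\<^sup>+t. ennreal ((cmod (?f t))\<^sup>2) * indicator {0..2*pi} t \<partial>lborel)"
  proof (rule nn_integral_dominated_convergence[where w = "\<lambda>t. ennreal (B\<^sup>2) * indicator {0..2*pi} t"])
    show "AE t in lborel. ennreal ((cmod (?P N t))\<^sup>2) * indicator {0..2*pi} t \<le> ennreal (B\<^sup>2) * indicator {0..2*pi} t" for N
      using PB by (intro AE_I2 mult_right_mono ennreal_leI power_mono) auto
    show "(\<integral>\<^sup>+t. ennreal (B\<^sup>2) * indicator {0..2*pi} t \<partial>lborel) < \<infinity>"
      by (subst nn_integral_cmult_indicator) (auto simp: ennreal_mult_less_top)
    show "AE t in lborel. (\<lambda>N. ennreal ((cmod (?P N t))\<^sup>2) * indicator {0..2*pi} t) \<longlonglongrightarrow> ennreal ((cmod (?f t))\<^sup>2) * indicator {0..2*pi} t"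
    proof (intro AE_I2)
      fix t :: real
      have "(\<lambda>N. ennreal ((cmod (?P N t))\<^sup>2)) \<longlonglongrightarrow> ennreal ((cmod (?f t))\<^sup>2)"
        by (intro tendsto_intros lim)
      then show "(\<lambda>N. ennreal ((cmod (?P N t))\<^sup>2) * indicator {0..2*pi} t) \<longlonglongrightarrow> ennreal ((cmod (?f t))\<^sup>2) * indicator {0..2*pi} t"
        by (cases "t \<in> {0..2*pi}") auto
    qed
  qed measurable
  moreover have "(\<lambda>N. ennreal (2 * pi) * (\<Sum>n<N. ennreal ((cmod (c n))\<^sup>2))) \<longlonglongrightarrow> ennreal (2 * pi) * (\<Sum>n. ennreal ((cmod (c n))\<^sup>2))"
    by (intro ennreal_tendsto_cmult summable_LIMSEQ) auto
  moreover have "ennreal (2 * pi * (\<Sum>n<N. (cmod (c n))\<^sup>2)) = ennreal (2 * pi) * (\<Sum>n<N. ennreal ((cmod (c n))\<^sup>2))" for N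
    by (simp add: ennreal_mult' sum_nonneg sum_ennreal)
  ultimately show ?thesis
    unfolding nn_integral_trig_polynomial by (simp only: LIMSEQ_unique)
qed

section \<open>Taylor coefficients of holomorphic functions\<close>

definition taylor_coeff :: "(complex \<Rightarrow> complex) \<Rightarrow> nat \<Rightarrow> complex" where
  "taylor_coeff f n = (deriv ^^ n) f 0 / fact n"

lemma taylor_coeff_sums:
  assumes "f holomorphic_on ball 0 R" "cmod z < R"
  shows "(\<lambda>n. taylor_coeff f n * z ^ n) sums f z"
  using holomorphic_power_series[OF assms(1), of z] assms(2) by (simp add: taylor_coeff_def)

lemma taylor_coeff_abs_summable:
  assumes "f holomorphic_on ball 0 R" "cmod z < R"
  shows "summable (\<lambda>n. cmod (taylor_coeff f n * z ^ n))"
proof -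
  obtain r where r: "cmod z < r" "r < R" using assms(2) dense by blast
  have "r > 0" using r(1) norm_ge_zero[of z] by linarith
  have "summable (\<lambda>n. taylor_coeff f n * (of_real r) ^ n)"
    using taylor_coeff_sums[OF assms(1), of "of_real r"] r \<open>r > 0\<close> by (auto simp: sums_iff)
  from powser_insidea[OF this, of z] show ?thesis
    using r \<open>r > 0\<close> by simp
qed

lemma taylor_coeff_eqI:
  assumes "\<And>z. cmod z < 1 \<Longrightarrow> (\<lambda>n. c n * z ^ n) sums f z"
  shows "taylor_coeff f n = c n"
proof -
  have "f has_fps_expansion Abs_fps c"
  proof (rule has_fps_expansionI)
    show "\<forall>\<^sub>F u in nhds 0. (\<lambda>n. fps_nth (Abs_fps c) n * u ^ n) sums f u"
      using eventually_nhds_in_open[of "ball 0 1" "0::complex"]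
      by (auto elim!: eventually_mono simp: assms)
  qed
  from fps_nth_fps_expansion[OF this, of n] show ?thesis by (simp add: taylor_coeff_def)
qed

lemma taylor_coeff_deriv: "taylor_coeff (deriv f) n = of_nat (Suc n) * taylor_coeff f (Suc n)"
proof -
  have "(deriv ^^ n) (deriv f) = (deriv ^^ Suc n) f" by (simp add: funpow_swap1)
  then show ?thesis by (simp add: taylor_coeff_def field_simps del: of_nat_Suc)
qed

lemma nn_integral_circle_taylor:
  assumes "f holomorphic_on ball 0 R" "cmod z < R"
  shows "(\<integral>\<^sup>+t. ennreal ((cmod (f (cis t * z)))\<^sup>2) * indicator {0..2*pi} t \<partial>lborel)
     = ennreal (2 * pi) * (\<Sum>n. ennreal ((cmod (taylor_coeff f n))\<^sup>2 * (cmod z) ^ (2*n)))"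
proof -
  have "f (cis t * z) = (\<Sum>n. taylor_coeff f n * z ^ n * cis (real n * t))" for t
    using taylor_coeff_sums[OF assms(1), of "cis t * z"] assms(2)
      Complex.DeMoivre[of t]
    by (simp add: sums_iff norm_mult power_mult_distrib ac_simps)
  then show ?thesis
    using nn_integral_fourier_series[OF taylor_coeff_abs_summable[OF assms]]
    by (simp add: norm_mult norm_power power_mult_distrib power_mult power_even_eq mult.commute)
qed

section \<open>Hardy and Bergman norms in terms of Taylor coefficients\<close>

text \<open>A function holomorphic on the disc is arbitrary, possibly not even measurable, outside
  of it. Only the integrand cut off by the indicator is known to be measurable.\<close>

lemma borel_measurable_ennreal_indicator:
  fixes h :: "'a::topological_space \<Rightarrow> real"
  assumes "continuous_on A h" "open A"
  shows "(\<lambda>x. ennreal (h x) * indicator A x) \<in> borel_measurable borel"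
proof -
  have "(\<lambda>x. ennreal (indicator A x *\<^sub>R h x)) \<in> borel_measurable borel"
    using borel_measurable_continuous_on_indicator[OF _ assms(1)] assms(2) by measurable
  also have "(\<lambda>x. ennreal (indicator A x *\<^sub>R h x)) = (\<lambda>x. ennreal (h x) * indicator A x)"
    by (auto simp: indicator_def)
  finally show ?thesis .
qed

lemma holomorphic_on_unit_disc_circle_measurable:
  assumes "f holomorphic_on unit_disc" "0 \<le> r" "r < 1"
  shows "(\<lambda>t. f (complex_of_real r * cis t)) \<in> borel_measurable borel"
proof (rule borel_measurable_continuous_onI)
  have "continuous_on UNIV (f \<circ> (\<lambda>t. complex_of_real r * cis t))"
    using assms by (intro continuous_on_compose continuous_intros
        continuous_on_subset[OF holomorphic_on_imp_continuous_on[OF assms(1)]]) (auto simp: norm_mult)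
  then show "continuous_on UNIV (\<lambda>t. f (complex_of_real r * cis t))" by (simp add: o_def)
qed

lemma sum_power2_le: "(a + b)\<^sup>2 \<le> 2 * (a\<^sup>2 + b\<^sup>2)" for a b :: real
  using zero_le_power2[of "a - b"] by (simp add: power2_eq_square algebra_simps)

lemma A12_normsq_mono:
  assumes "\<And>z. z \<in> unit_disc \<Longrightarrow> cmod (f z) \<le> cmod (g z)"
  shows "A12_normsq f \<le> A12_normsq g"
  unfolding A12_normsq_def
proof (intro nn_integral_mono)
  fix z :: complex
  show "ennreal ((cmod (f z))\<^sup>2 * (2 * (1 - (cmod z)\<^sup>2)) / pi) * indicator unit_disc z
     \<le> ennreal ((cmod (g z))\<^sup>2 * (2 * (1 - (cmod z)\<^sup>2)) / pi) * indicator unit_disc z"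
  proof (cases "z \<in> unit_disc")
    case True
    then have "(cmod z)\<^sup>2 \<le> 1" by (simp add: abs_square_le_1)
    then show ?thesis using assms[OF True]
      by (intro mult_right_mono ennreal_leI divide_right_mono power_mono) auto
  qed simp
qed

lemma H2_normsq_mono:
  assumes "\<And>z. z \<in> unit_disc \<Longrightarrow> cmod (f z) \<le> cmod (g z)"
  shows "H2_normsq f \<le> H2_normsq g"
  unfolding H2_normsq_def
proof (rule SUP_mono)
  fix r :: real assume r: "r \<in> {0..<1}"
  have "complex_of_real r * cis t \<in> unit_disc" for t using r by (simp add: norm_mult)
  then show "\<exists>m\<in>{0..<1}. ennreal (1 / (2 * pi)) * (\<integral>\<^sup>+ t. ennreal ((cmod (f (complex_of_real r * cis t)))\<^sup>2) * indicator {0..2 * pi} t \<partial>lborel)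
     \<le> ennreal (1 / (2 * pi)) * (\<integral>\<^sup>+ t. ennreal ((cmod (g (complex_of_real m * cis t)))\<^sup>2) * indicator {0..2 * pi} t \<partial>lborel)"
    using r assms by (intro bexI[of _ r] mult_left_mono nn_integral_mono mult_right_mono ennreal_leI power_mono) auto
qed

lemma A12_weight_continuous:
  assumes "f holomorphic_on unit_disc"
  shows "continuous_on unit_disc (\<lambda>z. (cmod (f z))\<^sup>2 * (2 * (1 - (cmod z)\<^sup>2)) / pi)"
  using holomorphic_on_imp_continuous_on[OF assms] by (intro continuous_intros) auto

text \<open>Squared norms replace the triangle inequality by (x + y)^2 \<le> 2 (x^2 + y^2). The
  pointwise hypothesis covers sums and differences, also with coefficient functions of modulus at
  most one.\<close>

lemma A12_normsq_add_le:
  assumes f: "f holomorphic_on unit_disc" and g: "g holomorphic_on unit_disc"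
    and le: "\<And>z. z \<in> unit_disc \<Longrightarrow> cmod (h z) \<le> cmod (f z) + cmod (g z)"
  shows "A12_normsq h \<le> 2 * (A12_normsq f + A12_normsq g)"
proof -
  let ?w = "\<lambda>f z. ennreal ((cmod (f z))\<^sup>2 * (2 * (1 - (cmod z)\<^sup>2)) / pi) * indicator unit_disc z"
  have [measurable]: "?w f \<in> borel_measurable borel" "?w g \<in> borel_measurable borel"
    by (intro borel_measurable_ennreal_indicator A12_weight_continuous assms open_ball)+
  have "A12_normsq h \<le> (\<integral>\<^sup>+z. 2 * (?w f z + ?w g z) \<partial>lborel)"
    unfolding A12_normsq_def
  proof (intro nn_integral_mono)
    fix z :: complex
    show "?w h z \<le> 2 * (?w f z + ?w g z)"
    proof (cases "z \<in> unit_disc")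
      case True
      then have w: "0 \<le> 2 * (1 - (cmod z)\<^sup>2) / pi" by (simp add: abs_square_le_1)
      have "(cmod (h z))\<^sup>2 \<le> (cmod (f z) + cmod (g z))\<^sup>2"
        by (rule power_mono) (use le[OF True] in auto)
      also have "\<dots> \<le> 2 * ((cmod (f z))\<^sup>2 + (cmod (g z))\<^sup>2)" by (rule sum_power2_le)
      finally have "(cmod (h z))\<^sup>2 * (2 * (1 - (cmod z)\<^sup>2) / pi) \<le>
          2 * ((cmod (f z))\<^sup>2 + (cmod (g z))\<^sup>2) * (2 * (1 - (cmod z)\<^sup>2) / pi)"
        by (rule mult_right_mono[OF _ w])
      also have "\<dots> = 2 * ((cmod (f z))\<^sup>2 * (2 * (1 - (cmod z)\<^sup>2) / pi) + (cmod (g z))\<^sup>2 * (2 * (1 - (cmod z)\<^sup>2) / pi))"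
        by (simp only: distrib_right mult.assoc)
      finally have "ennreal ((cmod (h z))\<^sup>2 * (2 * (1 - (cmod z)\<^sup>2) / pi))
         \<le> ennreal (2 * ((cmod (f z))\<^sup>2 * (2 * (1 - (cmod z)\<^sup>2) / pi) + (cmod (g z))\<^sup>2 * (2 * (1 - (cmod z)\<^sup>2) / pi)))"
        by (rule ennreal_leI)
      also have "\<dots> = 2 * (ennreal ((cmod (f z))\<^sup>2 * (2 * (1 - (cmod z)\<^sup>2) / pi)) + ennreal ((cmod (g z))\<^sup>2 * (2 * (1 - (cmod z)\<^sup>2) / pi)))"
        using w by (subst ennreal_mult') (auto simp del: times_divide_eq_right intro!: ennreal_plus mult_nonneg_nonneg)
      finally show ?thesis using True by simp
    qed simp
  qed
  also have "\<dots> = 2 * (A12_normsq f + A12_normsq g)"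
  proof -
    have "(\<integral>\<^sup>+z. 2 * (?w f z + ?w g z) \<partial>lborel) = 2 * (\<integral>\<^sup>+z. ?w f z + ?w g z \<partial>lborel)"
      by (rule nn_integral_cmult) measurable
    also have "(\<integral>\<^sup>+z. ?w f z + ?w g z \<partial>lborel) = (\<integral>\<^sup>+z. ?w f z \<partial>lborel) + (\<integral>\<^sup>+z. ?w g z \<partial>lborel)"
      by (rule nn_integral_add) measurable
    finally show ?thesis unfolding A12_normsq_def .
  qed
  finally show ?thesis .
qed

lemma H2_normsq_add_le:
  assumes f: "f holomorphic_on unit_disc" and g: "g holomorphic_on unit_disc"
    and le: "\<And>z. z \<in> unit_disc \<Longrightarrow> cmod (h z) \<le> cmod (f z) + cmod (g z)"
  shows "H2_normsq h \<le> 2 * (H2_normsq f + H2_normsq g)"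
  unfolding H2_normsq_def[of h]
proof (rule SUP_least)
  fix r :: real assume r: "r \<in> {0..<1}"
  let ?I = "\<lambda>f. \<integral>\<^sup>+ t. ennreal ((cmod (f (complex_of_real r * cis t)))\<^sup>2) * indicator {0..2 * pi} t \<partial>lborel"
  have [measurable]: "(\<lambda>t. f (complex_of_real r * cis t)) \<in> borel_measurable borel"
     "(\<lambda>t. g (complex_of_real r * cis t)) \<in> borel_measurable borel"
    using r by (auto intro!: holomorphic_on_unit_disc_circle_measurable f g)
  have le': "ennreal ((cmod (h z))\<^sup>2) \<le> 2 * (ennreal ((cmod (f z))\<^sup>2) + ennreal ((cmod (g z))\<^sup>2))"
     if "z \<in> unit_disc" for z
  proof -
    have "(cmod (h z))\<^sup>2 \<le> (cmod (f z) + cmod (g z))\<^sup>2"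
      by (rule power_mono) (use le[OF that] in auto)
    also have "\<dots> \<le> 2 * ((cmod (f z))\<^sup>2 + (cmod (g z))\<^sup>2)" by (rule sum_power2_le)
    finally have "ennreal ((cmod (h z))\<^sup>2) \<le> ennreal (2 * ((cmod (f z))\<^sup>2 + (cmod (g z))\<^sup>2))"
      by (rule ennreal_leI)
    then show ?thesis by (simp add: ennreal_mult')
  qed
  have "?I h \<le> (\<integral>\<^sup>+ t. 2 * (ennreal ((cmod (f (complex_of_real r * cis t)))\<^sup>2) * indicator {0..2 * pi} t
      + ennreal ((cmod (g (complex_of_real r * cis t)))\<^sup>2) * indicator {0..2 * pi} t) \<partial>lborel)"
  proof (intro nn_integral_mono)
    fix t :: real
    have "complex_of_real r * cis t \<in> unit_disc" using r by (simp add: norm_mult)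
    from le'[OF this] show "ennreal ((cmod (h (complex_of_real r * cis t)))\<^sup>2) * indicator {0..2 * pi} t \<le>
       2 * (ennreal ((cmod (f (complex_of_real r * cis t)))\<^sup>2) * indicator {0..2 * pi} t
      + ennreal ((cmod (g (complex_of_real r * cis t)))\<^sup>2) * indicator {0..2 * pi} t)"
      by (simp split: split_indicator)
  qed
  also have "\<dots> = 2 * (?I f + ?I g)"
    by (simp add: nn_integral_cmult nn_integral_add)
  finally have "ennreal (1 / (2 * pi)) * ?I h \<le> 2 * (ennreal (1 / (2 * pi)) * ?I f + ennreal (1 / (2 * pi)) * ?I g)"
    by (metis (no_types, lifting) distrib_left mult.left_commute mult_left_mono zero_le)
  also have "\<dots> \<le> 2 * (H2_normsq f + H2_normsq g)"
    unfolding H2_normsq_def using r by (intro mult_left_mono add_mono SUP_upper) auto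
  finally show "ennreal (1 / (2 * pi)) * ?I h \<le> 2 * (H2_normsq f + H2_normsq g)" .
qed

lemma H2_normsq_eq_suminf:
  assumes f: "f holomorphic_on unit_disc"
  shows "H2_normsq f = (\<Sum>n. ennreal ((cmod (taylor_coeff f n))\<^sup>2))"
proof -
  have r: "ennreal (1 / (2 * pi)) * (\<integral>\<^sup>+ t. ennreal ((cmod (f (complex_of_real r * cis t)))\<^sup>2) * indicator {0..2 * pi} t \<partial>lborel)
     = (\<Sum>n. ennreal ((cmod (taylor_coeff f n))\<^sup>2 * r ^ (2*n)))" if "r \<in> {0..<1}" for r
  proof -
    have c: "ennreal (1 / (2 * pi)) * (ennreal (2 * pi) * x) = x" for x
      by (simp add: mult.assoc[symmetric] ennreal_mult'[symmetric])
    have r: "cmod (complex_of_real r) = r" "cmod (complex_of_real r) < 1" using that by auto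
    have comm: "complex_of_real r * cis t = cis t * complex_of_real r" for t by (rule mult.commute)
    show ?thesis
      unfolding comm nn_integral_circle_taylor[OF f r(2)] c r(1) ..
  qed
  have H: "H2_normsq f = (SUP r\<in>{0..<1::real}. (\<Sum>n. ennreal ((cmod (taylor_coeff f n))\<^sup>2 * r ^ (2*n))))"
    unfolding H2_normsq_def by (intro SUP_cong r refl)
  show ?thesis
  proof (rule antisym)
    show "H2_normsq f \<le> (\<Sum>n. ennreal ((cmod (taylor_coeff f n))\<^sup>2))"
      unfolding H by (intro SUP_least suminf_le ennreal_leI) (auto intro!: mult_left_le power_le_one)
    show "(\<Sum>n. ennreal ((cmod (taylor_coeff f n))\<^sup>2)) \<le> H2_normsq f"
    proof (rule suminf_le_const)
      fix N
      \<comment> \<open>Only finitely many terms are carried to the limit r = 1. Each finite sum is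
        then below the supremum, and so is the whole series.\<close>
      have "((\<lambda>r. (\<Sum>n<N. ennreal ((cmod (taylor_coeff f n))\<^sup>2 * r ^ (2*n)))) \<longlongrightarrow>
          (\<Sum>n<N. ennreal ((cmod (taylor_coeff f n))\<^sup>2 * 1 ^ (2*n)))) (at_left 1)"
        by (intro tendsto_sum tendsto_ennrealI tendsto_intros)
      then have "(\<Sum>n<N. ennreal ((cmod (taylor_coeff f n))\<^sup>2 * 1 ^ (2*n))) \<le> H2_normsq f"
      proof (rule tendsto_upperbound)
        have "\<forall>\<^sub>F r in at_left (1::real). r \<in> {0<..<1}"
          by (rule eventually_at_leftI[of 0]) auto
        then show "\<forall>\<^sub>F r in at_left 1. (\<Sum>n<N. ennreal ((cmod (taylor_coeff f n))\<^sup>2 * r ^ (2*n))) \<le> H2_normsq f"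
        proof eventually_elim
          case (elim r)
          have "(\<Sum>n<N. ennreal ((cmod (taylor_coeff f n))\<^sup>2 * r ^ (2*n))) \<le> (\<Sum>n. ennreal ((cmod (taylor_coeff f n))\<^sup>2 * r ^ (2*n)))"
            by (rule sum_le_suminf) auto
          also have "\<dots> \<le> H2_normsq f" unfolding H using elim by (intro SUP_upper) auto
          finally show ?case .
        qed
      qed simp
      then show "(\<Sum>n<N. ennreal ((cmod (taylor_coeff f n))\<^sup>2)) \<le> H2_normsq f" by simp
    qed simp
  qed
qed

text \<open>With s = |z|^2 this is the Beta integral of 2 s^n (1 - s) over [0,1), that is 2/(n+1) -
  2/(n+2).\<close>

lemma disc_moment:
  "(\<integral>\<^sup>+z. ennreal ((cmod z) ^ (2*n) * (2 * (1 - (cmod z)\<^sup>2) / pi)) * indicator unit_disc z \<partial>lborel)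
     = ennreal (2 / ((real n + 1) * (real n + 2)))"
proof -
  have "(\<integral>\<^sup>+z. ennreal ((cmod z) ^ (2*n) * (2 * (1 - (cmod z)\<^sup>2) / pi)) * indicator unit_disc z \<partial>lborel)
    = ennreal pi * (\<integral>\<^sup>+s. ennreal (s ^ n * (2 * (1 - s) / pi)) * indicator {0..<1} s \<partial>lborel)"
    by (subst nn_integral_disc_radial[symmetric]) (auto simp: power_mult)
  also have "\<dots> = (\<integral>\<^sup>+s. ennreal pi * (ennreal (s ^ n * (2 * (1 - s) / pi)) * indicator {0..<1} s) \<partial>lborel)"
    by (subst nn_integral_cmult) auto
  also have "\<dots> = (\<integral>\<^sup>+s. ennreal (2 * s ^ n - 2 * s ^ (n + 1)) * indicator {0..1} s \<partial>lborel)"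
    by (intro nn_integral_cong)
       (auto split: split_indicator simp: ennreal_mult'[symmetric] algebra_simps diff_divide_distrib)
  also have "\<dots> = ennreal ((2 * 1 ^ (n+1) / (real n + 1) - 2 * 1 ^ (n+2) / (real n + 2)) - (2 * 0 ^ (n+1) / (real n + 1) - 2 * 0 ^ (n+2) / (real n + 2)))"
  proof (rule nn_integral_FTC_Icc)
    fix x :: real assume x: "x \<in> {0..1}"
    have p: "((\<lambda>x. x ^ (m + 1)) has_real_derivative (real m + 1) * x ^ m) (at x)" for m
      using DERIV_pow[of "m + 1" x UNIV] by (simp add: add.commute)
    have c: "2 * ((2 + real n) * y) / (real n + 2) = 2 * y" for y
      by (simp add: field_simps)
    show "((\<lambda>x. 2 * x ^ (n+1) / (real n + 1) - 2 * x ^ (n+2) / (real n + 2)) has_real_derivative (2 * x ^ n - 2 * x ^ (n + 1))) (at x)"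
      using DERIV_diff[OF DERIV_cmult[OF p[of n], of "2 / (real n + 1)"] DERIV_cmult[OF p[of "n + 1"], of "2 / (real n + 2)"]]
      by (simp add: add.assoc c)
    show "0 \<le> 2 * x ^ n - 2 * x ^ (n + 1)"
      using x by (simp add: mult_left_le_one_le)
  qed auto
  also have "(2 * 1 ^ (n+1) / (real n + 1) - 2 * 1 ^ (n+2) / (real n + 2)) - (2 * 0 ^ (n+1) / (real n + 1) - 2 * 0 ^ (n+2) / (real n + 2)) = 2 / ((real n + 1) * (real n + 2))"
    by (simp add: field_simps)
  finally show ?thesis .
qed

text \<open>Averaging over rotations turns |f|^2 at \<open>z\<close> into the Parseval sum on the
  circle through \<open>z\<close>; termwise integration leaves the moments of
  \<open>disc_moment\<close>.\<close>

lemma A12_normsq_eq_suminf: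
  assumes f: "f holomorphic_on unit_disc"
  shows "A12_normsq f = (\<Sum>n. ennreal ((cmod (taylor_coeff f n))\<^sup>2 * (2 / ((real n + 1) * (real n + 2)))))"
proof -
  let ?v = "\<lambda>z. 2 * (1 - (cmod z)\<^sup>2) / pi"
  have v0: "0 \<le> ?v z" if "z \<in> unit_disc" for z using that by (simp add: abs_square_le_1)
  let ?w = "\<lambda>z. ennreal ((cmod (f z))\<^sup>2 * (2 * (1 - (cmod z)\<^sup>2)) / pi) * indicator unit_disc z"
  have [measurable]: "?w \<in> borel_measurable borel"
    by (intro borel_measurable_ennreal_indicator A12_weight_continuous assms open_ball)+
  let ?m = "\<lambda>n z. ennreal ((cmod z) ^ (2*n) * ?v z) * indicator unit_disc z"
  have [measurable]: "?m n \<in> borel_measurable borel" for n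
    by (intro borel_measurable_ennreal_indicator continuous_intros) auto
  have circ: "(\<integral>\<^sup>+t. ?w (cis t * z) * indicator {0..2*pi} t \<partial>lborel)
      = ennreal (2 * pi) * (\<Sum>n. ennreal ((cmod (taylor_coeff f n))\<^sup>2) * ?m n z)" for z
  proof (cases "z \<in> unit_disc")
    case True
    have meas: "(\<lambda>t. f (cis t * z)) \<in> borel_measurable borel"
    proof (rule borel_measurable_continuous_onI)
      have "continuous_on UNIV (f \<circ> (\<lambda>t. cis t * z))"
        using True by (intro continuous_on_compose continuous_intros
            continuous_on_subset[OF holomorphic_on_imp_continuous_on[OF f]]) (auto simp: norm_mult)
      then show "continuous_on UNIV (\<lambda>t. f (cis t * z))" by (simp add: o_def)
    qed
    have "(\<integral>\<^sup>+t. ?w (cis t * z) * indicator {0..2*pi} t \<partial>lborel)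
       = (\<integral>\<^sup>+t. ennreal (?v z) * (ennreal ((cmod (f (cis t * z)))\<^sup>2) * indicator {0..2*pi} t) \<partial>lborel)"
      using True v0[OF True] by (intro nn_integral_cong) 
        (auto simp: norm_mult ennreal_mult'[symmetric] mult.commute split: split_indicator)
    also have "\<dots> = ennreal (?v z) * (ennreal (2 * pi) * (\<Sum>n. ennreal ((cmod (taylor_coeff f n))\<^sup>2 * (cmod z) ^ (2*n))))"
      using meas by (subst nn_integral_cmult) (use True in \<open>simp_all add: nn_integral_circle_taylor[OF f]\<close>)
    also have "\<dots> = ennreal (2 * pi) * (\<Sum>n. ennreal (?v z) * ennreal ((cmod (taylor_coeff f n))\<^sup>2 * (cmod z) ^ (2*n)))"
      by (subst ennreal_suminf_cmult) (simp add: mult_ac)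
    also have "(\<lambda>n. ennreal (?v z) * ennreal ((cmod (taylor_coeff f n))\<^sup>2 * (cmod z) ^ (2*n)))
        = (\<lambda>n. ennreal ((cmod (taylor_coeff f n))\<^sup>2) * ?m n z)"
    proof
      fix n
      have "ennreal v * ennreal (A * B) = ennreal A * ennreal (B * v)" if "v \<ge> 0" "A \<ge> 0" "B \<ge> 0" for v A B
        using that by (simp add: ennreal_mult mult_ac)
      from this[OF v0[OF True], of "(cmod (taylor_coeff f n))\<^sup>2" "(cmod z) ^ (2*n)"]
      show "ennreal (?v z) * ennreal ((cmod (taylor_coeff f n))\<^sup>2 * (cmod z) ^ (2*n))
        = ennreal ((cmod (taylor_coeff f n))\<^sup>2) * ?m n z"
        using True by (simp only: indicator_simps mult_1_right zero_le_power zero_le_power2 norm_ge_zero)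
    qed
    finally show ?thesis .
  next
    case False
    then show ?thesis by (simp add: norm_mult)
  qed
  have "ennreal (2 * pi) * A12_normsq f = (\<integral>\<^sup>+z. ennreal (2 * pi) * (\<Sum>n. ennreal ((cmod (taylor_coeff f n))\<^sup>2) * ?m n z) \<partial>lborel)"
    unfolding A12_normsq_def by (subst nn_integral_lborel_circle_average) (auto simp only: circ intro: \<open>?w \<in> _\<close>)
  also have "\<dots> = ennreal (2 * pi) * (\<Sum>n. ennreal ((cmod (taylor_coeff f n))\<^sup>2) * ennreal (2 / ((real n + 1) * (real n + 2))))"
  proof -
    have "(\<integral>\<^sup>+z. ennreal (2 * pi) * (\<Sum>n. ennreal ((cmod (taylor_coeff f n))\<^sup>2) * ?m n z) \<partial>lborel)
      = ennreal (2 * pi) * (\<integral>\<^sup>+z. (\<Sum>n. ennreal ((cmod (taylor_coeff f n))\<^sup>2) * ?m n z) \<partial>lborel)"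
      by (rule nn_integral_cmult) measurable
    also have "(\<integral>\<^sup>+z. (\<Sum>n. ennreal ((cmod (taylor_coeff f n))\<^sup>2) * ?m n z) \<partial>lborel)
      = (\<Sum>n. (\<integral>\<^sup>+z. ennreal ((cmod (taylor_coeff f n))\<^sup>2) * ?m n z \<partial>lborel))"
      by (rule nn_integral_suminf) measurable
    also have "(\<lambda>n. \<integral>\<^sup>+z. ennreal ((cmod (taylor_coeff f n))\<^sup>2) * ?m n z \<partial>lborel)
      = (\<lambda>n. ennreal ((cmod (taylor_coeff f n))\<^sup>2) * (\<integral>\<^sup>+z. ?m n z \<partial>lborel))"
      by (intro ext nn_integral_cmult) measurable
    finally show ?thesis unfolding disc_moment .
  qed
  finally have "A12_normsq f = (\<Sum>n. ennreal ((cmod (taylor_coeff f n))\<^sup>2) * ennreal (2 / ((real n + 1) * (real n + 2))))"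
    using pi_gt_zero by (subst (asm) ennreal_mult_cancel_left) (auto simp: ennreal_eq_0_iff)
  then show ?thesis by (simp add: ennreal_mult del: times_divide_eq_right)
qed

lemma A12_normsq_le_H2_normsq:
  assumes "f holomorphic_on unit_disc"
  shows "A12_normsq f \<le> H2_normsq f"
  unfolding A12_normsq_eq_suminf[OF assms] H2_normsq_eq_suminf[OF assms]
proof (intro suminf_le summableI ennreal_leI mult_left_le)
  fix n
  have "2 \<le> (real n + 1) * (real n + 2)"
    using mult_mono[of 1 "real n + 1" 2 "real n + 2"] by simp
  then show "2 / ((real n + 1) * (real n + 2)) \<le> 1" by simp
qed simp

text \<open>The coefficient (n+1) of differentiation and the moment combine to the weight
  2(n+1)/(n+2), which lies between 1 and 2. Hence the two norm comparisons below, with constants 2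
  and 1.\<close>

lemma A12_normsq_deriv_eq_suminf:
  assumes "f holomorphic_on unit_disc"
  shows "A12_normsq (deriv f) = (\<Sum>n. ennreal ((cmod (taylor_coeff f (Suc n)))\<^sup>2 * (2 * (real n + 1) / (real n + 2))))"
proof -
  have "(cmod (taylor_coeff (deriv f) n))\<^sup>2 * (2 / ((real n + 1) * (real n + 2)))
     = (cmod (taylor_coeff f (Suc n)))\<^sup>2 * (2 * (real n + 1) / (real n + 2))" for n
  proof -
    have n: "cmod (of_nat (Suc n)) = real n + 1" by (simp add: norm_of_nat del: of_nat_Suc)
    have "(x * c)\<^sup>2 * (2 / (x * y)) = c\<^sup>2 * (2 * x / y)" if "x > 0" for x y c :: real
      using that by (simp add: power2_eq_square)
    from this[of "real n + 1"] show ?thesis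
      unfolding taylor_coeff_deriv norm_mult n by simp
  qed
  then show ?thesis
    using A12_normsq_eq_suminf[OF holomorphic_deriv[OF assms open_ball]] by simp
qed

lemma H2_normsq_split_head:
  assumes "f holomorphic_on unit_disc"
  shows "H2_normsq f = (\<Sum>n. ennreal ((cmod (taylor_coeff f (Suc n)))\<^sup>2)) + ennreal ((cmod (f 0))\<^sup>2)"
  unfolding H2_normsq_eq_suminf[OF assms]
  by (subst suminf_offset[where i = 1]) (auto simp: taylor_coeff_def)

lemma A12_normsq_deriv_le:
  assumes "f holomorphic_on unit_disc"
  shows "A12_normsq (deriv f) \<le> 2 * H2_normsq f"
proof -
  have "A12_normsq (deriv f) \<le> (\<Sum>n. 2 * ennreal ((cmod (taylor_coeff f (Suc n)))\<^sup>2))"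
    unfolding A12_normsq_deriv_eq_suminf[OF assms]
  proof (intro suminf_le summableI)
    fix n
    have "2 * (real n + 1) / (real n + 2) \<le> 2" by (simp add: field_simps)
    then have "(cmod (taylor_coeff f (Suc n)))\<^sup>2 * (2 * (real n + 1) / (real n + 2)) \<le> 2 * (cmod (taylor_coeff f (Suc n)))\<^sup>2"
      using mult_left_mono[of "2 * (real n + 1) / (real n + 2)" 2 "(cmod (taylor_coeff f (Suc n)))\<^sup>2"]
      by (simp only: mult.commute zero_le_power2)
    then show "ennreal ((cmod (taylor_coeff f (Suc n)))\<^sup>2 * (2 * (real n + 1) / (real n + 2))) \<le> 2 * ennreal ((cmod (taylor_coeff f (Suc n)))\<^sup>2)"
      by (metis ennreal_leI ennreal_mult' ennreal_numeral zero_le_numeral)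
  qed
  also have "\<dots> \<le> 2 * H2_normsq f"
    unfolding H2_normsq_split_head[OF assms] by (simp add: mult_left_mono distrib_left)
  finally show ?thesis .
qed

lemma H2_normsq_le_deriv:
  assumes "f holomorphic_on unit_disc"
  shows "H2_normsq f \<le> ennreal ((cmod (f 0))\<^sup>2) + A12_normsq (deriv f)"
proof -
  have "(\<Sum>n. ennreal ((cmod (taylor_coeff f (Suc n)))\<^sup>2)) \<le> A12_normsq (deriv f)"
    unfolding A12_normsq_deriv_eq_suminf[OF assms]
  proof (intro suminf_le summableI ennreal_leI)
    fix n
    have "1 \<le> 2 * (real n + 1) / (real n + 2)" by (simp add: field_simps)
    from mult_left_mono[OF this, of "(cmod (taylor_coeff f (Suc n)))\<^sup>2"]
    show "(cmod (taylor_coeff f (Suc n)))\<^sup>2 \<le> (cmod (taylor_coeff f (Suc n)))\<^sup>2 * (2 * (real n + 1) / (real n + 2))"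
      by simp
  qed
  then show ?thesis unfolding H2_normsq_split_head[OF assms] by (simp add: add.commute add_mono)
qed

section \<open>Sub-mean-value property and pointwise growth\<close>

lemma holomorphic_submean_ball:
  assumes f: "f holomorphic_on ball p R" and R: "0 < R"
  shows "ennreal (pi * R\<^sup>2) * ennreal ((cmod (f p))\<^sup>2) \<le> (\<integral>\<^sup>+z. ennreal ((cmod (f z))\<^sup>2) * indicator (ball p R) z \<partial>lborel)"
proof -
  define g where "g = (\<lambda>z. f (z + p))"
  have g: "g holomorphic_on ball 0 R"
    unfolding g_def
    by (rule holomorphic_on_compose_gen[OF _ f, unfolded o_def]) (auto intro!: holomorphic_intros simp: dist_norm)
  let ?w = "\<lambda>z. ennreal ((cmod (g z))\<^sup>2) * indicator (ball 0 R) z"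
  have [measurable]: "?w \<in> borel_measurable borel"
    "(\<lambda>z. ennreal ((cmod (f z))\<^sup>2) * indicator (ball p R) z) \<in> borel_measurable borel"
    by (intro borel_measurable_ennreal_indicator continuous_intros holomorphic_on_imp_continuous_on f g open_ball)+
  have shift: "(\<integral>\<^sup>+z. ennreal ((cmod (f z))\<^sup>2) * indicator (ball p R) z \<partial>lborel) = (\<integral>\<^sup>+z. ?w z \<partial>lborel)"
    by (subst nn_integral_lborel_translate[where c = p, symmetric])
      (auto simp: g_def dist_norm intro!: nn_integral_cong split: split_indicator)
  have circ: "ennreal (2 * pi) * (ennreal ((cmod (f p))\<^sup>2) * indicator (ball 0 R) z)
     \<le> (\<integral>\<^sup>+t. ?w (cis t * z) * indicator {0..2*pi} t \<partial>lborel)" for z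
  proof (cases "z \<in> ball 0 R")
    case True
    then have z: "cmod z < R" by simp
    \<comment> \<open>\<open>f p\<close> is the constant coefficient of \<open>g\<close>, and its
      square is the first term of a Parseval sum of nonnegative terms. So no circle mean of |f|^2
      about \<open>p\<close> falls below |f p|^2.\<close>
    have "ennreal ((cmod (f p))\<^sup>2) = (\<Sum>n<1. ennreal ((cmod (taylor_coeff g n))\<^sup>2 * (cmod z) ^ (2*n)))"
      by (simp add: taylor_coeff_def g_def)
    also have "\<dots> \<le> (\<Sum>n. ennreal ((cmod (taylor_coeff g n))\<^sup>2 * (cmod z) ^ (2*n)))"
      by (rule sum_le_suminf) auto
    finally have "ennreal (2 * pi) * ennreal ((cmod (f p))\<^sup>2) \<le> 
        (\<integral>\<^sup>+t. ennreal ((cmod (g (cis t * z)))\<^sup>2) * indicator {0..2*pi} t \<partial>lborel)"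
      unfolding nn_integral_circle_taylor[OF g z] by (rule mult_left_mono) simp
    then show ?thesis using z by (simp add: norm_mult)
  qed simp
  have "ennreal (2 * pi) * (ennreal (pi * R\<^sup>2) * ennreal ((cmod (f p))\<^sup>2))
     = (\<integral>\<^sup>+z. ennreal (2 * pi) * (ennreal ((cmod (f p))\<^sup>2) * indicator (ball 0 R) (z::complex)) \<partial>lborel)"
  proof -
    have "(\<integral>\<^sup>+z. ennreal (2 * pi) * (ennreal ((cmod (f p))\<^sup>2) * indicator (ball 0 R) (z::complex)) \<partial>lborel)
      = ennreal (2 * pi) * (\<integral>\<^sup>+z. ennreal ((cmod (f p))\<^sup>2) * indicator (ball 0 R) (z::complex) \<partial>lborel)"
      by (rule nn_integral_cmult) (simp only: measurable_lborel2, rule borel_measurable_ennreal_indicator[OF continuous_on_const open_ball])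
    also have "(\<integral>\<^sup>+z. ennreal ((cmod (f p))\<^sup>2) * indicator (ball 0 R) (z::complex) \<partial>lborel) = ennreal ((cmod (f p))\<^sup>2) * ennreal (pi * R\<^sup>2)"
      using R by (subst nn_integral_cmult_indicator) (simp_all add: emeasure_ball unit_ball_vol_2)
    finally show ?thesis by (simp only: mult.commute[of "ennreal (pi * R\<^sup>2)"])
  qed
  also have "\<dots> \<le> (\<integral>\<^sup>+z. (\<integral>\<^sup>+t. ?w (cis t * z) * indicator {0..2*pi} t \<partial>lborel) \<partial>lborel)"
    by (rule nn_integral_mono) (rule circ)
  also have "\<dots> = ennreal (2 * pi) * (\<integral>\<^sup>+z. ?w z \<partial>lborel)"
    by (rule nn_integral_lborel_circle_average[symmetric]) measurable
  finally show ?thesis unfolding shift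
    by (subst (asm) ennreal_mult_le_mult_iff) (simp_all add: ennreal_eq_0_iff not_le)
qed

text \<open>The ball reaches half way to the unit circle, so 1 - |a| stays above d/2 for d = 1 -
  |p|, and 1 - |a|^2 is larger still. This lets plain area means over such balls pass to integrals
  against dA_1.\<close>

lemma unit_disc_weight_bounds:
  assumes p: "p \<in> unit_disc" and a: "a \<in> ball p ((1 - cmod p) / 2)"
  shows "a \<in> unit_disc" "(1 - cmod p) / 2 \<le> 1 - (cmod a)\<^sup>2" 
proof -
  have "cmod a \<le> cmod p + cmod (a - p)" using norm_triangle_ineq[of p "a - p"] by simp
  also have "cmod (a - p) < (1 - cmod p) / 2" using a by (simp add: dist_norm norm_minus_commute)
  finally have 1: "cmod a \<le> (1 + cmod p) / 2" by (simp add: field_simps)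
  then show "a \<in> unit_disc" using p by simp
  have "(cmod a)\<^sup>2 \<le> cmod a" using \<open>a \<in> unit_disc\<close> by (simp add: power2_eq_square mult_left_le)
  then show "(1 - cmod p) / 2 \<le> 1 - (cmod a)\<^sup>2" using 1 by (simp add: field_simps)
qed

text \<open>The ball of radius d/2, where d = 1 - |p|, has area pi d^2/4, and the density of dA_1 is
  at least d/pi on it. The product d^3/4 gives both the exponent and the constant.\<close>

lemma A12_growth:
  assumes f: "f holomorphic_on unit_disc" and p: "p \<in> unit_disc"
  shows "ennreal ((1 - cmod p) ^ 3) * ennreal ((cmod (f p))\<^sup>2) \<le> 4 * A12_normsq f"
proof -
  define d where "d = 1 - cmod p"
  have d: "0 < d" using p by (simp add: d_def)
  have sub: "ball p (d/2) \<subseteq> unit_disc"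
    using unit_disc_weight_bounds(1)[OF p] by (auto simp: d_def)
  let ?w = "\<lambda>z. ennreal ((cmod (f z))\<^sup>2 * (2 * (1 - (cmod z)\<^sup>2)) / pi) * indicator unit_disc z"
  have [measurable]: "?w \<in> borel_measurable borel"
    by (intro borel_measurable_ennreal_indicator A12_weight_continuous assms open_ball)+
  have "ennreal (d / pi) * (ennreal (pi * (d/2)\<^sup>2) * ennreal ((cmod (f p))\<^sup>2))
    \<le> ennreal (d / pi) * (\<integral>\<^sup>+z. ennreal ((cmod (f z))\<^sup>2) * indicator (ball p (d/2)) z \<partial>lborel)"
    by (intro mult_left_mono holomorphic_submean_ball holomorphic_on_subset[OF f sub]) (use d in auto)
  also have "\<dots> = (\<integral>\<^sup>+z. ennreal (d / pi) * (ennreal ((cmod (f z))\<^sup>2) * indicator (ball p (d/2)) z) \<partial>lborel)"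
    by (rule nn_integral_cmult[symmetric], simp, rule borel_measurable_ennreal_indicator)
       (intro continuous_intros holomorphic_on_imp_continuous_on holomorphic_on_subset[OF f sub] open_ball)+
  also have "\<dots> \<le> A12_normsq f"
    unfolding A12_normsq_def
  proof (rule nn_integral_mono)
    fix z :: complex
    show "ennreal (d / pi) * (ennreal ((cmod (f z))\<^sup>2) * indicator (ball p (d/2)) z) \<le> ?w z"
    proof (cases "z \<in> ball p (d/2)")
      case True
      with unit_disc_weight_bounds[OF p, of z] have "z \<in> unit_disc" "d / 2 \<le> 1 - (cmod z)\<^sup>2"
        by (auto simp: d_def)
      then have "d / pi * (cmod (f z))\<^sup>2 \<le> (2 * (1 - (cmod z)\<^sup>2)) / pi * (cmod (f z))\<^sup>2"
        by (intro mult_right_mono divide_right_mono) auto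
      then show ?thesis using True \<open>z \<in> unit_disc\<close> d
        by (simp add: ennreal_mult'[symmetric] mult.commute ennreal_leI)
    qed simp
  qed
  finally have "4 * (ennreal (d / pi) * (ennreal (pi * (d/2)\<^sup>2) * ennreal ((cmod (f p))\<^sup>2))) \<le> 4 * A12_normsq f"
    by (rule mult_left_mono) simp
  also have "4 * (ennreal (d / pi) * (ennreal (pi * (d/2)\<^sup>2) * ennreal ((cmod (f p))\<^sup>2))) = ennreal (d ^ 3) * ennreal ((cmod (f p))\<^sup>2)"
  proof -
    have "ennreal (d ^ 3) = ennreal (4 * (d / pi) * (pi * (d/2)\<^sup>2))"
      by (simp add: power2_eq_square power3_eq_cube mult.assoc)
    also have "\<dots> = 4 * ennreal (d / pi) * ennreal (pi * (d/2)\<^sup>2)"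
      using d by (subst ennreal_mult, simp, simp, subst ennreal_mult) auto
    finally show ?thesis by (simp only: mult.assoc)
  qed
  finally show ?thesis unfolding d_def .
qed

section \<open>Kernel estimates\<close>

definition disc_aut :: "complex \<Rightarrow> complex \<Rightarrow> complex" where
  "disc_aut a z = (z - a) / (1 - cnj a * z)"

definition szego :: "complex \<Rightarrow> complex \<Rightarrow> complex" where
  "szego a z = complex_of_real (sqrt (1 - (cmod a)\<^sup>2)) / (1 - cnj a * z)"

lemma one_minus_cnj_mult_neq_0:
  assumes "a \<in> unit_disc" "z \<in> unit_disc"
  shows "1 - cnj a * z \<noteq> 0"
proof
  assume "1 - cnj a * z = 0"
  then have "cmod (cnj a * z) = 1" by simp
  moreover have "cmod (cnj a * z) < 1 * 1"
    unfolding norm_mult using assms by (intro mult_strict_mono') auto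
  ultimately show False by simp
qed

lemma of_real_sqrt_weight:
  assumes "a \<in> unit_disc"
  shows "complex_of_real (sqrt (1 - (cmod a)\<^sup>2)) * complex_of_real (sqrt (1 - (cmod a)\<^sup>2)) = 1 - a * cnj a"
proof -
  have "0 \<le> 1 - (cmod a)\<^sup>2" using assms by (simp add: abs_square_le_1)
  then have "complex_of_real (sqrt (1 - (cmod a)\<^sup>2)) * complex_of_real (sqrt (1 - (cmod a)\<^sup>2)) = complex_of_real (1 - (cmod a)\<^sup>2)"
    unfolding of_real_mult[symmetric] by simp
  then show ?thesis by (simp add: complex_norm_square del: of_real_power)
qed

text \<open>Converts the factor s - t of the overview into a Euclidean distance times two kernels.
  All size estimates for this factor go through this identity.\<close>

lemma disc_aut_diff:
  assumes "a \<in> unit_disc" "p \<in> unit_disc" "q \<in> unit_disc"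
  shows "disc_aut a p - disc_aut a q = (p - q) * szego a p * szego a q"
proof -
  have n: "1 - cnj a * p \<noteq> 0" "1 - cnj a * q \<noteq> 0" using assms one_minus_cnj_mult_neq_0 by blast+
  have "(p - q) * szego a p * szego a q = (p - q) * (1 - a * cnj a) / ((1 - cnj a * p) * (1 - cnj a * q))"
    unfolding of_real_sqrt_weight[OF assms(1), symmetric] szego_def by simp
  also have "\<dots> = disc_aut a p - disc_aut a q"
    unfolding disc_aut_def using n by (simp add: divide_simps) (simp add: algebra_simps)
  finally show ?thesis ..
qed

text \<open>Source of the additional kernel power: a test function plus \<open>cnj a\<close> times
  the next one equals the former multiplied by sqrt(1 - |a|^2) k_a.\<close>

lemma one_plus_disc_aut:
  assumes "a \<in> unit_disc" "z \<in> unit_disc"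
  shows "1 + cnj a * disc_aut a z = complex_of_real (sqrt (1 - (cmod a)\<^sup>2)) * szego a z"
proof -
  have n: "1 - cnj a * z \<noteq> 0" using assms one_minus_cnj_mult_neq_0 by blast
  show ?thesis
    unfolding szego_def times_divide_eq_right of_real_sqrt_weight[OF assms(1)] disc_aut_def
    using n by (simp add: divide_simps) (simp add: algebra_simps)
qed

lemma szego_normsq:
  assumes "a \<in> unit_disc"
  shows "(cmod (szego a z))\<^sup>2 = (1 - (cmod a)\<^sup>2) / (cmod (1 - cnj a * z))\<^sup>2"
proof -
  have "0 \<le> 1 - (cmod a)\<^sup>2" using assms by (simp add: abs_square_le_1)
  then show ?thesis by (simp add: szego_def norm_divide power_divide)
qed

lemma disc_aut_bound:
  assumes "a \<in> unit_disc" "z \<in> unit_disc"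
  shows "cmod (disc_aut a z) \<le> 1"
proof -
  have n: "1 - cnj a * z \<noteq> 0" using assms one_minus_cnj_mult_neq_0 by blast
  have "(cmod (1 - cnj a * z))\<^sup>2 - (cmod (z - a))\<^sup>2 = (1 - (cmod a)\<^sup>2) * (1 - (cmod z)\<^sup>2)"
    unfolding cmod_power2 by (simp add: algebra_simps power2_eq_square)
  also have "\<dots> \<ge> 0" using assms by (intro mult_nonneg_nonneg) (simp_all add: abs_square_le_1)
  finally have "(cmod (z - a))\<^sup>2 \<le> (cmod (1 - cnj a * z))\<^sup>2" by simp
  then have "cmod (z - a) \<le> cmod (1 - cnj a * z)" by (rule power2_le_imp_le) simp
  then show ?thesis using n by (simp add: disc_aut_def norm_divide divide_le_eq)
qed

text \<open>Up to constants, \<open>szego a ^ 3\<close> and \<open>sqrt (1 - |a|\<^sup>2) * szego a ^ 4\<close> are unit vectors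
  of \<open>A_1^2\<close> concentrated near \<open>a\<close>. The first summand tests \<open>\<alpha> C\<^sub>p - \<beta> C\<^sub>q\<close> on the latter; the second one
  controls the error made when \<open>p\<close> is replaced by \<open>q\<close>.\<close>
definition pair_kernel :: "complex \<Rightarrow> complex \<Rightarrow> complex \<Rightarrow> complex \<Rightarrow> complex \<Rightarrow> real" where
  "pair_kernel \<alpha> \<beta> p q a =
     (1 - (cmod a)\<^sup>2) * (cmod (\<alpha> * szego a p ^ 4 - \<beta> * szego a q ^ 4))\<^sup>2
   + (cmod (disc_aut a p - disc_aut a q))\<^sup>2 * ((cmod (\<alpha> * szego a p ^ 3))\<^sup>2 + (cmod (\<beta> * szego a q ^ 3))\<^sup>2)"

text \<open>The lower bound for |1 - cnj a * p| uses |a| < 1. The upper one splits off 1 - |p|^2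
  \<le> 2d; the rest, (cnj p - cnj a) * p, is at most d/2.\<close>

lemma szego_near_bounds:
  assumes p: "p \<in> unit_disc" and a: "a \<in> ball p ((1 - cmod p) / 2)"
  defines "d \<equiv> 1 - cmod p"
  shows "a \<in> unit_disc" "d / 2 \<le> 1 - (cmod a)\<^sup>2"
    "d \<le> cmod (1 - cnj a * p)" "cmod (1 - cnj a * p) \<le> 5 / 2 * d"
proof -
  show a1: "a \<in> unit_disc" "d / 2 \<le> 1 - (cmod a)\<^sup>2"
    using unit_disc_weight_bounds[OF p a] by (auto simp: d_def)
  have "cmod (cnj a * p) \<le> 1 * cmod p" unfolding norm_mult using a1 by (intro mult_right_mono) auto
  then show "d \<le> cmod (1 - cnj a * p)"
    using norm_triangle_ineq2[of 1 "cnj a * p"] by (simp add: d_def)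
  have "1 - cnj a * p = (1 - p * cnj p) + (cnj p - cnj a) * p" by (simp add: algebra_simps)
  then have "cmod (1 - cnj a * p) \<le> cmod (1 - p * cnj p) + cmod (cnj p - cnj a) * cmod p"
    by (metis norm_triangle_ineq norm_mult)
  also have "cmod (1 - p * cnj p) = 1 - (cmod p)\<^sup>2"
  proof -
    have "1 - p * cnj p = complex_of_real (1 - (cmod p)\<^sup>2)" by (simp add: complex_norm_square del: of_real_power)
    moreover have "0 \<le> 1 - (cmod p)\<^sup>2" using p by (simp add: abs_square_le_1)
    ultimately show ?thesis by (simp del: of_real_diff)
  qed
  also have "1 - (cmod p)\<^sup>2 = d * (1 + cmod p)" by (simp add: d_def power2_eq_square algebra_simps)
  also have "\<dots> \<le> d * 2" using p by (intro mult_left_mono) (auto simp: d_def)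
  also have "cmod (cnj p - cnj a) * cmod p \<le> d / 2 * 1"
    using a p unfolding complex_cnj_diff[symmetric] complex_mod_cnj d_def
    by (intro mult_mono) (auto simp: dist_norm)
  finally show "cmod (1 - cnj a * p) \<le> 5 / 2 * d" by simp
qed

lemma norm_one_minus_cnj_diff:
  assumes "a \<in> unit_disc"
  shows "cmod (1 - cnj a * q) \<le> cmod (1 - cnj a * p) + cmod (p - q)"
proof -
  have "1 - cnj a * q = (1 - cnj a * p) + cnj a * (p - q)" by (simp add: algebra_simps)
  then have "cmod (1 - cnj a * q) \<le> cmod (1 - cnj a * p) + cmod a * cmod (p - q)"
    by (metis norm_triangle_ineq norm_mult complex_mod_cnj)
  also have "cmod a * cmod (p - q) \<le> 1 * cmod (p - q)" using assms by (intro mult_right_mono) auto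
  finally show ?thesis by simp
qed

lemma disc_aut_diff_norm:
  assumes "a \<in> unit_disc" "p \<in> unit_disc" "q \<in> unit_disc"
  shows "cmod (disc_aut a p - disc_aut a q)
    = cmod (p - q) * (1 - (cmod a)\<^sup>2) / (cmod (1 - cnj a * p) * cmod (1 - cnj a * q))"
proof -
  have "0 \<le> 1 - (cmod a)\<^sup>2" using assms by (simp add: abs_square_le_1)
  then show ?thesis
    unfolding disc_aut_diff[OF assms] norm_mult by (simp add: szego_def norm_divide)
qed

text \<open>|k_a(p)|^2 is at least (d/2)/(3d)^2 = 1/(18d), and 5832 = 18^3. The factor 3 leaves room
  for a second point: a \<open>q\<close> within d/8 of \<open>p\<close> still has |1 - cnj a * q|
  \<le> 5d/2 + d/8.\<close>

lemma szego_power6_lower: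
  assumes a: "a \<in> unit_disc" and d: "0 < d" "d / 2 \<le> 1 - (cmod a)\<^sup>2"
    and D: "0 < cmod (1 - cnj a * p)" "cmod (1 - cnj a * p) \<le> 3 * d"
  shows "1 \<le> 5832 * d ^ 3 * (cmod (szego a p ^ 3))\<^sup>2"
proof -
  have "1 / (18 * d) = (d / 2) / (3 * d)\<^sup>2" using d by (simp add: power2_eq_square)
  also have "\<dots> \<le> (1 - (cmod a)\<^sup>2) / (cmod (1 - cnj a * p))\<^sup>2"
  proof (intro frac_le power_mono)
    show "0 \<le> 1 - (cmod a)\<^sup>2" using d by linarith
  qed (use d D in auto)
  also have "\<dots> = (cmod (szego a p))\<^sup>2" by (rule szego_normsq[OF a, symmetric])
  finally have "(1 / (18 * d)) ^ 3 \<le> ((cmod (szego a p))\<^sup>2) ^ 3"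
    using d by (intro power_mono) auto
  then have "5832 * d ^ 3 * (1 / (18 * d)) ^ 3 \<le> 5832 * d ^ 3 * ((cmod (szego a p))\<^sup>2) ^ 3"
    using d by (intro mult_left_mono) auto
  also have "((cmod (szego a p))\<^sup>2) ^ 3 = (cmod (szego a p ^ 3))\<^sup>2"
    by (simp add: norm_power power_mult[symmetric])
  finally show ?thesis using d by (simp add: power_divide power_mult_distrib)
qed

lemma pair_kernel_nonneg: "a \<in> unit_disc \<Longrightarrow> 0 \<le> pair_kernel \<alpha> \<beta> p q a"
  unfolding pair_kernel_def by (intro add_nonneg_nonneg mult_nonneg_nonneg) (auto simp: abs_square_le_1)

text \<open>When |p - q| dominates d, |1 - cnj a * q| is at most 5d/2 + |p - q| \<le> 24 |p - q|, so
  |p - q| cancels in \<open>disc_aut_diff_norm\<close> and the two images under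
  \<open>disc_aut a\<close> are at least 1/120 apart. The constant rounds up 120^2 * 5832.\<close>

lemma pair_kernel_far:
  assumes p: "p \<in> unit_disc" and q: "q \<in> unit_disc" and far: "1 - cmod p \<le> 9 * cmod (p - q)"
    and a: "a \<in> ball p ((1 - cmod p) / 2)"
  shows "1 \<le> 84000000 * (1 - cmod p) ^ 3 * ((cmod (disc_aut a p - disc_aut a q))\<^sup>2 * (cmod (szego a p ^ 3))\<^sup>2)"
proof -
  define d where "d = 1 - cmod p"
  have d: "0 < d" using p by (simp add: d_def)
  note b = szego_near_bounds[OF p a, folded d_def]
  have s: "1 \<le> 5832 * d ^ 3 * (cmod (szego a p ^ 3))\<^sup>2"
    by (rule szego_power6_lower[OF b(1) d b(2)]) (use b(3,4) d in linarith)+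
  have pq: "0 < cmod (p - q)" using far d unfolding d_def by linarith
  have q0: "0 < cmod (1 - cnj a * q)" using one_minus_cnj_mult_neq_0[OF b(1) q] by simp
  have "cmod (1 - cnj a * q) \<le> 24 * cmod (p - q)"
  proof -
    have "X \<le> 24 * Z" if "X \<le> Y + Z" "Y \<le> 5 / 2 * D" "D \<le> 9 * Z" "0 < Z" for X Y Z D :: real
      using that by linarith
    from this[OF norm_one_minus_cnj_diff[OF b(1)] b(4) far[folded d_def] pq] show ?thesis .
  qed
  then have "cmod (1 - cnj a * p) * cmod (1 - cnj a * q) \<le> (5 / 2 * d) * (24 * cmod (p - q))"
    using b d by (intro mult_mono) auto
  then have "(cmod (p - q) * (d / 2)) / ((5 / 2 * d) * (24 * cmod (p - q))) \<le> cmod (disc_aut a p - disc_aut a q)"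
    unfolding disc_aut_diff_norm[OF b(1) p q] using b d q0
    by (intro frac_le mult_left_mono mult_nonneg_nonneg mult_pos_pos) auto
  then have "1 / 120 \<le> cmod (disc_aut a p - disc_aut a q)"
    using d pq by simp
  then have "(1 / 120)\<^sup>2 \<le> (cmod (disc_aut a p - disc_aut a q))\<^sup>2" by (intro power_mono) auto
  then have "(1 / 120)\<^sup>2 * 1 \<le> (cmod (disc_aut a p - disc_aut a q))\<^sup>2 * (5832 * d ^ 3 * (cmod (szego a p ^ 3))\<^sup>2)"
    using s by (intro mult_mono) auto
  then have "14400 * ((1 / 120)\<^sup>2 * 1) \<le> 14400 * ((cmod (disc_aut a p - disc_aut a q))\<^sup>2 * (5832 * d ^ 3 * (cmod (szego a p ^ 3))\<^sup>2))"
    by (rule mult_left_mono) simp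
  also have "\<dots> = 83980800 * (d ^ 3 * ((cmod (disc_aut a p - disc_aut a q))\<^sup>2 * (cmod (szego a p ^ 3))\<^sup>2))"
    by simp
  also have "\<dots> \<le> 84000000 * (d ^ 3 * ((cmod (disc_aut a p - disc_aut a q))\<^sup>2 * (cmod (szego a p ^ 3))\<^sup>2))"
    using d by (intro mult_right_mono) auto
  finally show ?thesis by (simp add: d_def power2_eq_square mult.assoc)
qed

text \<open>By \<open>one_plus_disc_aut\<close>, sqrt(1 - |a|^2) times the difference of the kernels
  is \<open>cnj a\<close> times the difference of the automorphisms. The cofactor in x^4 - y^4 is at
  most (8 + 4 + 2 + 1) |y|^3, and 225 = 15^2.\<close>

lemma szego_pow4_diff:
  assumes a: "a \<in> unit_disc" and p: "p \<in> unit_disc" and q: "q \<in> unit_disc"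
    and le: "cmod (szego a p) \<le> 2 * cmod (szego a q)"
  shows "(1 - (cmod a)\<^sup>2) * (cmod (szego a p ^ 4 - szego a q ^ 4))\<^sup>2
     \<le> 225 * ((cmod (disc_aut a p - disc_aut a q))\<^sup>2 * (cmod (szego a q ^ 3))\<^sup>2)"
proof -
  let ?c = "sqrt (1 - (cmod a)\<^sup>2)" and ?x = "szego a p" and ?y = "szego a q"
  have c: "0 \<le> 1 - (cmod a)\<^sup>2" using a by (simp add: abs_square_le_1)
  have "complex_of_real ?c * (?x - ?y) = cnj a * (disc_aut a p - disc_aut a q)"
    unfolding right_diff_distrib one_plus_disc_aut[OF a p, symmetric] one_plus_disc_aut[OF a q, symmetric] by simp
  then have "?c * cmod (?x - ?y) = cmod a * cmod (disc_aut a p - disc_aut a q)"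
    by (metis norm_mult norm_of_real complex_mod_cnj abs_of_nonneg real_sqrt_ge_zero c)
  also have "\<dots> \<le> 1 * cmod (disc_aut a p - disc_aut a q)" using a by (intro mult_right_mono) auto
  finally have 1: "?c * cmod (?x - ?y) \<le> cmod (disc_aut a p - disc_aut a q)" by simp
  have "?x ^ 4 - ?y ^ 4 = (?x - ?y) * (?x ^ 3 + ?x\<^sup>2 * ?y + ?x * ?y\<^sup>2 + ?y ^ 3)"
    by (simp add: algebra_simps power2_eq_square power3_eq_cube power4_eq_xxxx)
  then have 2: "cmod (?x ^ 4 - ?y ^ 4) = cmod (?x - ?y) * cmod (?x ^ 3 + ?x\<^sup>2 * ?y + ?x * ?y\<^sup>2 + ?y ^ 3)"
    by (simp only: norm_mult)
  have "cmod (?x ^ 3 + ?x\<^sup>2 * ?y + ?x * ?y\<^sup>2 + ?y ^ 3) \<le> cmod (?x ^ 3) + cmod (?x\<^sup>2 * ?y) + cmod (?x * ?y\<^sup>2) + cmod (?y ^ 3)"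
    by (intro order_trans[OF norm_triangle_ineq] add_right_mono order_refl)
  also have "\<dots> = cmod ?x ^ 3 + (cmod ?x)\<^sup>2 * cmod ?y + cmod ?x * (cmod ?y)\<^sup>2 + cmod ?y ^ 3"
    by (simp add: norm_mult norm_power)
  also have "\<dots> \<le> (2 * cmod ?y) ^ 3 + (2 * cmod ?y)\<^sup>2 * cmod ?y + (2 * cmod ?y) * (cmod ?y)\<^sup>2 + cmod ?y ^ 3"
    using le by (intro add_mono mult_right_mono power_mono order_refl) auto
  also have "\<dots> = 15 * cmod ?y ^ 3" by (simp add: power2_eq_square power3_eq_cube)
  finally have 3: "cmod (?x ^ 3 + ?x\<^sup>2 * ?y + ?x * ?y\<^sup>2 + ?y ^ 3) \<le> 15 * cmod ?y ^ 3" .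
  have "?c * cmod (?x ^ 4 - ?y ^ 4) \<le> cmod (disc_aut a p - disc_aut a q) * (15 * cmod ?y ^ 3)"
    using mult_mono'[OF 1 3] c unfolding 2 by (simp add: mult.assoc)
  then have "(?c * cmod (?x ^ 4 - ?y ^ 4))\<^sup>2 \<le> (cmod (disc_aut a p - disc_aut a q) * (15 * cmod ?y ^ 3))\<^sup>2"
    using c by (intro power_mono) auto
  then show ?thesis using c by (simp add: power_mult_distrib norm_power mult_ac)
qed

text \<open>For close points the kernel controls what the splitting (\<alpha> - \<beta>) f p +
  \<beta> (f p - f q) requires: the second part of the kernel bounds \<beta> times the relative
  distance |p - q|/d, and both parts together bound \<alpha> - \<beta>. The constants are 225 * 5832
  and 450 * 25 * 5832.\<close>

lemma pair_kernel_near: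
  assumes p: "p \<in> unit_disc" and q: "q \<in> unit_disc" and near: "cmod (p - q) < (1 - cmod p) / 8"
    and a: "a \<in> ball p ((1 - cmod p) / 2)"
  defines "d \<equiv> 1 - cmod p"
  shows "(cmod \<beta>)\<^sup>2 * ((cmod (p - q))\<^sup>2 / d\<^sup>2) \<le> 1312200 * d ^ 3 * pair_kernel \<alpha> \<beta> p q a" (is ?A)
    and "(cmod (\<alpha> - \<beta>))\<^sup>2 \<le> 65610000 * d ^ 3 * pair_kernel \<alpha> \<beta> p q a" (is ?B)
proof -
  have d: "0 < d" using p by (simp add: d_def)
  note b = szego_near_bounds[OF p a, folded d_def]
  let ?c = "1 - (cmod a)\<^sup>2" and ?x = "szego a p" and ?y = "szego a q"
  let ?Dp = "cmod (1 - cnj a * p)" and ?Dq = "cmod (1 - cnj a * q)"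
  let ?s = "(cmod (disc_aut a p - disc_aut a q))\<^sup>2"
  have c: "0 < ?c" using b(2) d by linarith
  have q0: "0 < ?Dq" using one_minus_cnj_mult_neq_0[OF b(1) q] by simp
  have Dq: "?Dq \<le> 3 * d"
    using norm_one_minus_cnj_diff[OF b(1), of q p] b(4) near d unfolding d_def[symmetric] by linarith
  have sq: "1 \<le> 5832 * d ^ 3 * (cmod (?y ^ 3))\<^sup>2"
    by (rule szego_power6_lower[OF b(1) d b(2) q0 Dq])
  have "?Dp * ?Dq \<le> (5 / 2 * d) * (3 * d)"
    using b(4) Dq d by (intro mult_mono) auto
  then have "(cmod (p - q) * (d / 2)) / ((5 / 2 * d) * (3 * d)) \<le> cmod (disc_aut a p - disc_aut a q)"
    unfolding disc_aut_diff_norm[OF b(1) p q] using b d q0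
    by (intro frac_le mult_left_mono mult_nonneg_nonneg mult_pos_pos) auto
  then have "cmod (p - q) / d \<le> 15 * cmod (disc_aut a p - disc_aut a q)"
    using d by (simp add: field_simps)
  then have "(cmod (p - q) / d)\<^sup>2 \<le> (15 * cmod (disc_aut a p - disc_aut a q))\<^sup>2"
    using d by (intro power_mono) auto
  then have s: "(cmod (p - q))\<^sup>2 / d\<^sup>2 \<le> 225 * ?s" by (simp add: power_divide power_mult_distrib)
  have G: "?s * (cmod (\<beta> * ?y ^ 3))\<^sup>2 \<le> pair_kernel \<alpha> \<beta> p q a"
    "?c * (cmod (\<alpha> * ?x ^ 4 - \<beta> * ?y ^ 4))\<^sup>2 \<le> pair_kernel \<alpha> \<beta> p q a"
    unfolding pair_kernel_def using c by (auto simp: distrib_left intro!: add_nonneg_nonneg mult_nonneg_nonneg)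
  have "(cmod \<beta>)\<^sup>2 * ((cmod (p - q))\<^sup>2 / d\<^sup>2) \<le> (cmod \<beta>)\<^sup>2 * (225 * ?s)"
    using s by (rule mult_left_mono) simp
  also have "\<dots> = ((cmod \<beta>)\<^sup>2 * (225 * ?s)) * 1" by simp
  also have "\<dots> \<le> ((cmod \<beta>)\<^sup>2 * (225 * ?s)) * (5832 * d ^ 3 * (cmod (?y ^ 3))\<^sup>2)"
    using sq by (rule mult_left_mono) simp
  also have "\<dots> = 1312200 * d ^ 3 * (?s * (cmod (\<beta> * ?y ^ 3))\<^sup>2)"
    by (simp add: norm_mult power_mult_distrib)
  also have "\<dots> \<le> 1312200 * d ^ 3 * pair_kernel \<alpha> \<beta> p q a"
    using G(1) d by (intro mult_left_mono) auto
  finally show ?A .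
  \<comment> \<open>|p - q| < d/8 and d \<le> |1 - cnj a * p| make the two denominators comparable,
    which gives the hypothesis of \<open>szego_pow4_diff\<close>.\<close>
  have "?Dq \<le> 2 * ?Dp"
    using norm_one_minus_cnj_diff[OF b(1), of q p] b(3) near d unfolding d_def[symmetric] by linarith
  then have "cmod ?x \<le> 2 * cmod ?y"
  proof -
    assume "?Dq \<le> 2 * ?Dp"
    then have "sqrt ?c / ?Dp \<le> sqrt ?c / (?Dq / 2)"
      using c q0 by (intro frac_le) auto
    then show ?thesis using c by (simp add: szego_def norm_divide mult.commute)
  qed
  note L = szego_pow4_diff[OF b(1) p q this]
  have sp: "1 \<le> 5832 * d ^ 3 * (cmod (?x ^ 3))\<^sup>2"
    by (rule szego_power6_lower[OF b(1) d b(2)]) (use b(3,4) d in linarith)+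
  \<comment> \<open>(1 - |a|^2) |k_a(p)|^2 is the square of (1 - |a|^2) / |1 - cnj a * p|, whose
    terms compare with d/2 and 5d/2. This pays for the step from the sixth to the eighth power of
    |k_a(p)|.\<close>
  have "(1 / 5)\<^sup>2 \<le> (?c / ?Dp)\<^sup>2"
  proof (intro power_mono)
    have "1 / 5 = (d / 2) / (5 / 2 * d)" using d by simp
    also have "\<dots> \<le> ?c / ?Dp" using b d by (intro frac_le) auto
    finally show "1 / 5 \<le> ?c / ?Dp" .
  qed simp
  then have x2: "1 \<le> 25 * (?c * (cmod ?x)\<^sup>2)"
    unfolding szego_normsq[OF b(1)] by (simp add: power_divide power2_eq_square mult_ac)
  have "1 * 1 \<le> (5832 * d ^ 3 * (cmod (?x ^ 3))\<^sup>2) * (25 * (?c * (cmod ?x)\<^sup>2))"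
    using sp x2 by (intro mult_mono) auto
  also have "\<dots> = 145800 * d ^ 3 * (?c * (cmod (?x ^ 4))\<^sup>2)"
    by (simp add: norm_power power_mult[symmetric] power_add[symmetric] mult.assoc)
  finally have Lp: "1 \<le> 145800 * d ^ 3 * (?c * (cmod (?x ^ 4))\<^sup>2)" by simp
  \<comment> \<open>Replacing the kernel at \<open>q\<close> by the one at \<open>p\<close> isolates
    \<alpha> - \<beta>. The error \<beta> (x^4 - y^4) is what \<open>szego_pow4_diff\<close> bounds
    by the second part of the pair kernel.\<close>
  have "(cmod (\<alpha> - \<beta>))\<^sup>2 * (cmod (?x ^ 4))\<^sup>2 = (cmod ((\<alpha> * ?x ^ 4 - \<beta> * ?y ^ 4) - \<beta> * (?x ^ 4 - ?y ^ 4)))\<^sup>2"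
    unfolding power_mult_distrib[symmetric] norm_mult[symmetric] by (simp add: algebra_simps)
  also have "\<dots> \<le> (cmod (\<alpha> * ?x ^ 4 - \<beta> * ?y ^ 4) + cmod (\<beta> * (?x ^ 4 - ?y ^ 4)))\<^sup>2"
    by (intro power_mono norm_triangle_ineq4) auto
  also have "\<dots> \<le> 2 * ((cmod (\<alpha> * ?x ^ 4 - \<beta> * ?y ^ 4))\<^sup>2 + (cmod (\<beta> * (?x ^ 4 - ?y ^ 4)))\<^sup>2)"
    by (rule sum_power2_le)
  finally have "?c * ((cmod (\<alpha> - \<beta>))\<^sup>2 * (cmod (?x ^ 4))\<^sup>2) \<le>
     ?c * (2 * ((cmod (\<alpha> * ?x ^ 4 - \<beta> * ?y ^ 4))\<^sup>2 + (cmod (\<beta> * (?x ^ 4 - ?y ^ 4)))\<^sup>2))"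
    using c by (intro mult_left_mono) auto
  also have "\<dots> = 2 * (?c * (cmod (\<alpha> * ?x ^ 4 - \<beta> * ?y ^ 4))\<^sup>2) + 2 * (cmod \<beta>)\<^sup>2 * (?c * (cmod (?x ^ 4 - ?y ^ 4))\<^sup>2)"
    unfolding norm_mult power_mult_distrib by (simp only: algebra_simps)
  also have "\<dots> \<le> 2 * (?c * (cmod (\<alpha> * ?x ^ 4 - \<beta> * ?y ^ 4))\<^sup>2) + 2 * (cmod \<beta>)\<^sup>2 * (225 * (?s * (cmod (?y ^ 3))\<^sup>2))"
    by (intro add_left_mono mult_left_mono L) auto
  also have "\<dots> = 2 * (?c * (cmod (\<alpha> * ?x ^ 4 - \<beta> * ?y ^ 4))\<^sup>2) + 450 * (?s * (cmod (\<beta> * ?y ^ 3))\<^sup>2)"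
    unfolding norm_mult power_mult_distrib by simp
  also have "\<dots> \<le> 450 * pair_kernel \<alpha> \<beta> p q a"
    unfolding pair_kernel_def using c
    by (simp add: distrib_left add_nonneg_nonneg mult_nonneg_nonneg)
  finally have fin: "?c * ((cmod (\<alpha> - \<beta>))\<^sup>2 * (cmod (?x ^ 4))\<^sup>2) \<le> 450 * pair_kernel \<alpha> \<beta> p q a" .
  have "(cmod (\<alpha> - \<beta>))\<^sup>2 * 1 \<le> (cmod (\<alpha> - \<beta>))\<^sup>2 * (145800 * d ^ 3 * (?c * (cmod (?x ^ 4))\<^sup>2))"
    using Lp by (rule mult_left_mono) simp
  also have "\<dots> = 145800 * d ^ 3 * (?c * ((cmod (\<alpha> - \<beta>))\<^sup>2 * (cmod (?x ^ 4))\<^sup>2))" by simp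
  also have "\<dots> \<le> 145800 * d ^ 3 * (450 * pair_kernel \<alpha> \<beta> p q a)"
    using fin d by (intro mult_left_mono) auto
  finally show ?B by simp
qed

text \<open>Of the factor d^3 with d = 1 - |p|, one d is absorbed into the density of dA_1 through d
  \<le> 2 (1 - |a|^2), and d^2 cancels against the area normalisation in front of \<open>V\<close>.
  \<open>V\<close> is left abstract because it stands once for a multiple of |f p|^2 and once for a
  multiple of a squared difference quotient.\<close>

lemma submean_weighted:
  assumes f: "f holomorphic_on unit_disc" and p: "p \<in> unit_disc"
    and V: "0 \<le> V" "ennreal ((1 - cmod p)\<^sup>2 * V) \<le> (\<integral>\<^sup>+z. ennreal ((cmod (f z))\<^sup>2) * indicator (ball p ((1 - cmod p) / 2)) z \<partial>lborel)"
    and X: "0 \<le> X" "0 \<le> C" "\<And>a. a \<in> ball p ((1 - cmod p) / 2) \<Longrightarrow> X \<le> C * (1 - cmod p) ^ 3 * G a"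
    and G: "\<And>a. a \<in> unit_disc \<Longrightarrow> 0 \<le> G a" "continuous_on unit_disc G"
  shows "ennreal (X * V) \<le> ennreal (C * pi) * (\<integral>\<^sup>+a. ennreal ((cmod (f a))\<^sup>2 * (2 * (1 - (cmod a)\<^sup>2)) / pi * G a) * indicator unit_disc a \<partial>lborel)"
proof -
  define d where "d = 1 - cmod p"
  have d: "0 < d" using p by (simp add: d_def)
  let ?B = "ball p (d / 2)"
  have sub: "?B \<subseteq> unit_disc"
    using unit_disc_weight_bounds(1)[OF p] by (auto simp: d_def)
  have fc: "continuous_on unit_disc f" using f by (rule holomorphic_on_imp_continuous_on)
  have meas: "(\<lambda>a. ennreal ((cmod (f a))\<^sup>2 * (2 * (1 - (cmod a)\<^sup>2)) / pi * G a) * indicator unit_disc a) \<in> borel_measurable borel"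
    by (intro borel_measurable_ennreal_indicator continuous_intros fc G(2) open_ball) auto
  have pt: "ennreal X * (ennreal ((cmod (f a))\<^sup>2) * indicator ?B a)
     \<le> ennreal (C * d\<^sup>2 * pi) * (ennreal ((cmod (f a))\<^sup>2 * (2 * (1 - (cmod a)\<^sup>2)) / pi * G a) * indicator unit_disc a)" for a
  proof (cases "a \<in> ?B")
    case True
    with unit_disc_weight_bounds[OF p, of a] have a: "a \<in> unit_disc" "d \<le> 2 * (1 - (cmod a)\<^sup>2)"
      by (auto simp: d_def)
    have "X * (cmod (f a))\<^sup>2 \<le> (C * d ^ 3 * G a) * (cmod (f a))\<^sup>2"
      using X(3)[of a] True by (intro mult_right_mono) (auto simp: d_def)
    also have "\<dots> = (C * d\<^sup>2 * G a * (cmod (f a))\<^sup>2) * d" by (simp add: power2_eq_square power3_eq_cube)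
    also have "\<dots> \<le> (C * d\<^sup>2 * G a * (cmod (f a))\<^sup>2) * (2 * (1 - (cmod a)\<^sup>2))"
      using a G(1) X(2) by (intro mult_left_mono mult_nonneg_nonneg) auto
    also have "\<dots> = (C * d\<^sup>2 * pi) * ((cmod (f a))\<^sup>2 * (2 * (1 - (cmod a)\<^sup>2)) / pi * G a)"
      by simp
    finally have "ennreal (X * (cmod (f a))\<^sup>2) \<le> ennreal ((C * d\<^sup>2 * pi) * ((cmod (f a))\<^sup>2 * (2 * (1 - (cmod a)\<^sup>2)) / pi * G a))"
      by (rule ennreal_leI)
    moreover have "0 \<le> C * d\<^sup>2 * pi" using X(2) by simp
    ultimately show ?thesis using True a(1)
      by (simp only: ennreal_mult'[OF X(1)] ennreal_mult' indicator_simps mult_1_right)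
  qed simp
  have "ennreal (d\<^sup>2) * ennreal (X * V) = ennreal X * ennreal (d\<^sup>2 * V)"
    using X V by (simp add: ennreal_mult mult_ac)
  also have "\<dots> \<le> ennreal X * (\<integral>\<^sup>+z. ennreal ((cmod (f z))\<^sup>2) * indicator ?B z \<partial>lborel)"
    using V(2) by (intro mult_left_mono) (auto simp: d_def)
  also have "\<dots> = (\<integral>\<^sup>+z. ennreal X * (ennreal ((cmod (f z))\<^sup>2) * indicator ?B z) \<partial>lborel)"
    by (rule nn_integral_cmult[symmetric], simp only: measurable_lborel2, rule borel_measurable_ennreal_indicator)
       (intro continuous_intros continuous_on_subset[OF fc sub] open_ball)+
  also have "\<dots> \<le> (\<integral>\<^sup>+a. ennreal (C * d\<^sup>2 * pi) * (ennreal ((cmod (f a))\<^sup>2 * (2 * (1 - (cmod a)\<^sup>2)) / pi * G a) * indicator unit_disc a) \<partial>lborel)"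
    by (rule nn_integral_mono) (rule pt)
  also have "\<dots> = ennreal (C * d\<^sup>2 * pi) * (\<integral>\<^sup>+a. ennreal ((cmod (f a))\<^sup>2 * (2 * (1 - (cmod a)\<^sup>2)) / pi * G a) * indicator unit_disc a \<partial>lborel)"
    by (rule nn_integral_cmult) (simp only: measurable_lborel2 meas)
  also have "ennreal (C * d\<^sup>2 * pi) = ennreal (d\<^sup>2) * ennreal (C * pi)"
    using X(2) by (simp add: ennreal_mult[symmetric] mult_ac)
  finally show ?thesis
    using d unfolding mult.assoc by (subst (asm) ennreal_mult_le_mult_iff) (auto simp: ennreal_eq_0_iff not_le)
qed

text \<open>A mean-value estimate: the area integral bounds f on the ball of radius d/4, Cauchy's
  inequality with radius d/8 bounds f' on the ball of radius d/8, and the segment from p to q stays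
  there. The constant is 1024 = 16 * 8^2.\<close>

lemma holomorphic_diff_local:
  assumes f: "f holomorphic_on unit_disc" and p: "p \<in> unit_disc" and near: "cmod (p - q) < (1 - cmod p) / 8"
  shows "ennreal ((1 - cmod p)\<^sup>2 * (pi / 1024 * ((1 - cmod p)\<^sup>2 * (cmod (f p - f q))\<^sup>2)))
     \<le> ennreal ((cmod (p - q))\<^sup>2) * (\<integral>\<^sup>+z. ennreal ((cmod (f z))\<^sup>2) * indicator (ball p ((1 - cmod p) / 2)) z \<partial>lborel)"
proof -
  define d where "d = 1 - cmod p"
  have d: "0 < d" using p by (simp add: d_def)
  let ?B = "ball p (d / 2)"
  define J where "J = (\<integral>\<^sup>+z. ennreal ((cmod (f z))\<^sup>2) * indicator ?B z \<partial>lborel)"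
  have sub: "?B \<subseteq> unit_disc"
    using unit_disc_weight_bounds(1)[OF p] by (auto simp: d_def)
  show ?thesis
  proof (cases "q = p \<or> J = top")
    \<comment> \<open>If the integral is infinite, so is the right-hand side unless q = p, and for q
      = p the left-hand side vanishes. Otherwise the integral is a real number and yields a sup
      bound.\<close>
    case True
    then show ?thesis
    proof
      assume "J = top"
      then show ?thesis unfolding d_def[symmetric] J_def[symmetric]
        by (cases "q = p") (auto simp: ennreal_mult_top)
    qed simp
  next
    case False
    then obtain j where j: "J = ennreal j" "0 \<le> j" by (cases J) auto
    \<comment> \<open>The sub-mean-value bound on balls of radius d/4, whose area is pi
      d^2/16.\<close>
    define M where "M = sqrt (16 * j / (pi * d\<^sup>2))"
    have M: "cmod (f w) \<le> M" if w: "w \<in> cball p (d / 4)" for w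
    proof -
      have s: "ball w (d / 4) \<subseteq> ?B"
      proof
        fix x assume "x \<in> ball w (d / 4)"
        then have "dist p x < d / 4 + d / 4"
          using w dist_triangle[of p x w] by (simp add: dist_commute)
        then show "x \<in> ?B" by simp
      qed
      have "ennreal (pi * (d / 4)\<^sup>2) * ennreal ((cmod (f w))\<^sup>2) \<le> (\<integral>\<^sup>+z. ennreal ((cmod (f z))\<^sup>2) * indicator (ball w (d / 4)) z \<partial>lborel)"
        using d s sub by (intro holomorphic_submean_ball holomorphic_on_subset[OF f]) auto
      also have "\<dots> \<le> J" unfolding J_def
        using s by (intro nn_integral_mono mult_left_mono) (auto simp: indicator_def)
      finally have "pi * (d / 4)\<^sup>2 * (cmod (f w))\<^sup>2 \<le> j"
        using j by (simp add: ennreal_mult[symmetric])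
      then have "(cmod (f w))\<^sup>2 \<le> 16 * j / (pi * d\<^sup>2)"
        using d by (simp add: field_simps power_divide)
      then show ?thesis unfolding M_def by (rule real_le_rsqrt)
    qed
    have deriv: "cmod (deriv f w) \<le> 8 * M / d" if w: "w \<in> ball p (d / 8)" for w
    proof -
      have c: "cball w (d / 8) \<subseteq> cball p (d / 4)"
      proof
        fix x assume "x \<in> cball w (d / 8)"
        then have "dist p x \<le> d / 8 + d / 8"
          using w dist_triangle[of p x w] by (simp add: dist_commute)
        then show "x \<in> cball p (d / 4)" by simp
      qed
      have c': "cball w (d / 8) \<subseteq> unit_disc"
        using c sub d by (force simp: subset_iff)
      have "cmod ((deriv ^^ 1) f w) \<le> fact 1 * M / (d / 8) ^ 1"
      proof (rule Cauchy_inequality)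
        show "f holomorphic_on ball w (d / 8)"
          by (rule holomorphic_on_subset[OF f]) (use c' in auto)
        show "continuous_on (cball w (d / 8)) f"
          by (rule continuous_on_subset[OF holomorphic_on_imp_continuous_on[OF f] c'])
        fix x assume "cmod (w - x) = d / 8"
        then show "cmod (f x) \<le> M" using c by (intro M) (auto simp: dist_norm subset_iff)
      qed (use d in auto)
      then show ?thesis by (simp add: mult.commute)
    qed
    have "cmod (f p - f q) \<le> 8 * M / d * cmod (p - q)"
    proof (rule field_differentiable_bound[where S = "ball p (d / 8)" and f' = "deriv f"])
      fix w assume w: "w \<in> ball p (d / 8)"
      have "w \<in> unit_disc" using w sub d by (force simp: subset_iff)
      then show "(f has_field_derivative deriv f w) (at w within ball p (d / 8))"
        by (rule has_field_derivative_at_within[OF holomorphic_derivI[OF f open_ball]])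
      show "cmod (deriv f w) \<le> 8 * M / d" by (rule deriv[OF w])
    qed (use near d in \<open>auto simp: d_def dist_norm\<close>)
    then have "(cmod (f p - f q))\<^sup>2 \<le> (8 * M / d * cmod (p - q))\<^sup>2"
      by (intro power_mono) auto
    also have "\<dots> = 64 * M\<^sup>2 / d\<^sup>2 * (cmod (p - q))\<^sup>2"
      by (simp add: power_mult_distrib power_divide)
    also have "M\<^sup>2 = 16 * j / (pi * d\<^sup>2)"
      unfolding M_def by (rule real_sqrt_pow2) (use j(2) in simp)
    finally have "d\<^sup>2 * (pi / 1024 * (d\<^sup>2 * (cmod (f p - f q))\<^sup>2)) \<le> (cmod (p - q))\<^sup>2 * j"
      using d by (simp add: field_simps)
    then show ?thesis
      unfolding d_def[symmetric] J_def[symmetric] using j by (simp add: ennreal_mult[symmetric] ennreal_leI)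
  qed
qed

text \<open>All five arguments vary because continuity is needed in \<open>a\<close> alone, in
  \<open>z\<close> alone, and jointly in both for Tonelli's theorem.\<close>

lemma continuous_on_pair_kernel:
  assumes "continuous_on S \<alpha>" "continuous_on S \<beta>" "continuous_on S p" "continuous_on S q" "continuous_on S a"
    and D: "\<And>x. x \<in> S \<Longrightarrow> p x \<in> unit_disc" "\<And>x. x \<in> S \<Longrightarrow> q x \<in> unit_disc" "\<And>x. x \<in> S \<Longrightarrow> a x \<in> unit_disc"
  shows "continuous_on S (\<lambda>x. pair_kernel (\<alpha> x) (\<beta> x) (p x) (q x) (a x))"
proof -
  have "1 - cnj (a x) * p x \<noteq> 0" "1 - cnj (a x) * q x \<noteq> 0" if "x \<in> S" for x
    using D that one_minus_cnj_mult_neq_0 by blast+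
  then show ?thesis
    unfolding pair_kernel_def disc_aut_def szego_def
    by (intro continuous_intros assms) auto
qed

text \<open>Recombines the two halves of a split estimate while \<open>I\<close> may still be
  infinite; 4096 = 2 * 2 * 1024.\<close>

lemma ennreal_combine_bounds:
  assumes x: "x \<le> 2 * (A + B)" "0 \<le> A" "0 \<le> B" "0 \<le> c"
    and A: "ennreal (pi / 1024 * A) \<le> ennreal (c * pi) * I" and B: "ennreal (pi / 1024 * B) \<le> ennreal (c * pi) * I"
  shows "ennreal x \<le> ennreal (4096 * c) * I"
proof -
  have "ennreal (pi / 1024) * ennreal x = ennreal (pi / 1024 * x)" by (rule ennreal_mult'[symmetric]) simp
  also have "\<dots> \<le> ennreal (2 * (pi / 1024 * A + pi / 1024 * B))"
  proof (rule ennreal_leI)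
    have "pi / 1024 * x \<le> pi / 1024 * (2 * (A + B))" using x(1) by (rule mult_left_mono) simp
    then show "pi / 1024 * x \<le> 2 * (pi / 1024 * A + pi / 1024 * B)" by (simp add: distrib_left)
  qed
  also have "\<dots> = 2 * (ennreal (pi / 1024 * A) + ennreal (pi / 1024 * B))"
    using x by (subst ennreal_mult', simp, subst ennreal_plus) auto
  also have "\<dots> \<le> 2 * (ennreal (c * pi) * I + ennreal (c * pi) * I)"
    using A B by (intro mult_left_mono add_mono) auto
  also have "\<dots> = (4 * ennreal (c * pi)) * I"
    by (simp only: mult_2[symmetric] mult.assoc[symmetric]) simp
  also have "4 * ennreal (c * pi) = ennreal (4 * (c * pi))"
    by (subst ennreal_mult') auto
  also have "4 * (c * pi) = pi / 1024 * (4096 * c)" by simp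
  also have "ennreal \<dots> = ennreal (pi / 1024) * ennreal (4096 * c)" by (rule ennreal_mult') simp
  finally show ?thesis
    unfolding mult.assoc by (subst (asm) ennreal_mult_le_mult_iff) (simp_all add: ennreal_eq_0_iff not_le)
qed

text \<open>When \<open>p\<close> and \<open>q\<close> are far apart the two terms are estimated separately, and the factor
  \<open>disc_aut a p - disc_aut a q\<close> of the kernel is bounded below; when they are close, one splits
  \<open>\<alpha> f p - \<beta> f q = (\<alpha> - \<beta>) f p + \<beta> (f p - f q)\<close>.\<close>
lemma pair_estimate:
  assumes f: "f holomorphic_on unit_disc" and p: "p \<in> unit_disc" and q: "q \<in> unit_disc"
  shows "ennreal ((cmod (\<alpha> * f p - \<beta> * f q))\<^sup>2) \<le> ennreal (4096 * 84000000) *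
    (\<integral>\<^sup>+a. ennreal ((cmod (f a))\<^sup>2 * (2 * (1 - (cmod a)\<^sup>2)) / pi * pair_kernel \<alpha> \<beta> p q a) * indicator unit_disc a \<partial>lborel)"
    (is "_ \<le> _ * ?I")
proof -
  let ?G = "pair_kernel \<alpha> \<beta> p q"
  have Gc: "continuous_on unit_disc ?G"
    using p q by (intro continuous_on_pair_kernel continuous_intros) auto
  \<comment> \<open>Sub-mean-value averaging gives the better constant pi/4. It is weakened to
    pi/1024, the constant of \<open>holomorphic_diff_local\<close>, so that all terms enter
    \<open>ennreal_combine_bounds\<close> alike.\<close>
  have sub: "ennreal (pi / 1024 * (X * (cmod (f w))\<^sup>2)) \<le> ennreal (84000000 * pi) * ?I"
    if w: "w \<in> unit_disc" and X: "0 \<le> X" "\<And>a. a \<in> ball w ((1 - cmod w) / 2) \<Longrightarrow> X \<le> 84000000 * (1 - cmod w) ^ 3 * ?G a" for X w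
  proof -
    have "ball w ((1 - cmod w) / 2) \<subseteq> unit_disc" using unit_disc_weight_bounds(1)[OF w] by auto
    from holomorphic_submean_ball[OF holomorphic_on_subset[OF f this]] w
    have V: "ennreal ((1 - cmod w)\<^sup>2 * (pi / 4 * (cmod (f w))\<^sup>2)) \<le>
       (\<integral>\<^sup>+z. ennreal ((cmod (f z))\<^sup>2) * indicator (ball w ((1 - cmod w) / 2)) z \<partial>lborel)"
      by (simp add: ennreal_mult[symmetric] power_divide mult_ac)
    have "ennreal (pi / 1024 * (X * (cmod (f w))\<^sup>2)) \<le> ennreal (X * (pi / 4 * (cmod (f w))\<^sup>2))"
    proof (rule ennreal_leI)
      have "pi / 1024 * (X * (cmod (f w))\<^sup>2) \<le> pi / 4 * (X * (cmod (f w))\<^sup>2)"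
        using X(1) by (intro mult_right_mono) auto
      then show "pi / 1024 * (X * (cmod (f w))\<^sup>2) \<le> X * (pi / 4 * (cmod (f w))\<^sup>2)" by (simp add: mult_ac)
    qed
    also have "\<dots> \<le> ennreal (84000000 * pi) * ?I"
      by (rule submean_weighted[OF f w _ V X(1) _ X(2) pair_kernel_nonneg Gc]) auto
    finally show ?thesis .
  qed
  show ?thesis
  proof (cases "cmod (p - q) < (1 - cmod p) / 8")
    case False
    have Xp: "(cmod \<alpha>)\<^sup>2 \<le> 84000000 * (1 - cmod p) ^ 3 * ?G a" if a: "a \<in> ball p ((1 - cmod p) / 2)" for a
    proof -
      have ad: "a \<in> unit_disc" using unit_disc_weight_bounds(1)[OF p a] .
      let ?s = "(cmod (disc_aut a p - disc_aut a q))\<^sup>2 * (cmod (szego a p ^ 3))\<^sup>2"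
      have far: "1 - cmod p \<le> 9 * cmod (p - q)"
      proof -
        have "D \<le> 9 * Z" if "\<not> Z < D / 8" "0 \<le> Z" for Z D :: real using that by linarith
        from this[OF False norm_ge_zero] show ?thesis .
      qed
      have "(cmod \<alpha>)\<^sup>2 * 1 \<le> (cmod \<alpha>)\<^sup>2 * (84000000 * (1 - cmod p) ^ 3 * ?s)"
        by (rule mult_left_mono[OF pair_kernel_far[OF p q far a]]) simp
      also have "\<dots> = 84000000 * (1 - cmod p) ^ 3 * ((cmod (disc_aut a p - disc_aut a q))\<^sup>2 * (cmod (\<alpha> * szego a p ^ 3))\<^sup>2)"
        by (simp add: norm_mult power_mult_distrib)
      also have "\<dots> \<le> 84000000 * (1 - cmod p) ^ 3 * ?G a"
        using p ad unfolding pair_kernel_def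
        by (intro mult_left_mono) (auto simp: distrib_left abs_square_le_1)
      finally show ?thesis by simp
    qed
    have Xq: "(cmod \<beta>)\<^sup>2 \<le> 84000000 * (1 - cmod q) ^ 3 * ?G a" if a: "a \<in> ball q ((1 - cmod q) / 2)" for a
    proof -
      have ad: "a \<in> unit_disc" using unit_disc_weight_bounds(1)[OF q a] .
      let ?s = "(cmod (disc_aut a q - disc_aut a p))\<^sup>2 * (cmod (szego a q ^ 3))\<^sup>2"
      \<comment> \<open>The case assumption is asymmetric in \<open>p\<close> and \<open>q\<close>.
        From 1 - |p| \<le> 8 |p - q| and 1 - |q| \<le> 1 - |p| + |p - q| comes the factor 9 that
        \<open>pair_kernel_far\<close> allows.\<close>
      have far: "1 - cmod q \<le> 9 * cmod (q - p)"
      proof -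
        have "1 - Q \<le> 9 * Z" if "\<not> Z < (1 - P) / 8" "P \<le> Q + Z" for P Q Z :: real using that by (simp add: not_less field_simps)
        from this[OF False] norm_triangle_ineq[of q "p - q"] show ?thesis by (simp add: norm_minus_commute)
      qed
      have "(cmod \<beta>)\<^sup>2 * 1 \<le> (cmod \<beta>)\<^sup>2 * (84000000 * (1 - cmod q) ^ 3 * ?s)"
        by (rule mult_left_mono[OF pair_kernel_far[OF q p far a]]) simp
      also have "\<dots> = 84000000 * (1 - cmod q) ^ 3 * ((cmod (disc_aut a p - disc_aut a q))\<^sup>2 * (cmod (\<beta> * szego a q ^ 3))\<^sup>2)"
        by (simp add: norm_mult power_mult_distrib norm_minus_commute)
      also have "\<dots> \<le> 84000000 * (1 - cmod q) ^ 3 * ?G a"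
        using q ad unfolding pair_kernel_def
        by (intro mult_left_mono) (auto simp: distrib_left abs_square_le_1)
      finally show ?thesis by simp
    qed
    show ?thesis
    proof (rule ennreal_combine_bounds[OF _ _ _ _ sub[OF p _ Xp] sub[OF q _ Xq]])
      have "(cmod (\<alpha> * f p - \<beta> * f q))\<^sup>2 \<le> (cmod (\<alpha> * f p) + cmod (\<beta> * f q))\<^sup>2"
        by (intro power_mono norm_triangle_ineq4) auto
      also note sum_power2_le
      finally show "(cmod (\<alpha> * f p - \<beta> * f q))\<^sup>2 \<le> 2 * ((cmod \<alpha>)\<^sup>2 * (cmod (f p))\<^sup>2 + (cmod \<beta>)\<^sup>2 * (cmod (f q))\<^sup>2)"
        by (simp add: norm_mult power_mult_distrib)
    qed auto
  next
    case near: True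
    define d where "d = 1 - cmod p"
    have d: "0 < d" using p by (simp add: d_def)
    note G0 = pair_kernel_nonneg[OF unit_disc_weight_bounds(1)[OF p]]
    have X1: "(cmod (\<alpha> - \<beta>))\<^sup>2 \<le> 84000000 * (1 - cmod p) ^ 3 * ?G a" if a: "a \<in> ball p ((1 - cmod p) / 2)" for a
      by (rule order_trans[OF pair_kernel_near(2)[OF p q near a]])
         (use G0[OF a] p in \<open>intro mult_right_mono, auto\<close>)
    have X2: "(cmod \<beta>)\<^sup>2 * ((cmod (p - q))\<^sup>2 / d\<^sup>2) \<le> 84000000 * (1 - cmod p) ^ 3 * ?G a" if a: "a \<in> ball p ((1 - cmod p) / 2)" for a
      by (rule order_trans[OF pair_kernel_near(1)[where \<alpha> = \<alpha> and \<beta> = \<beta>, OF p q near a, folded d_def]])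
         (use G0[OF a] p in \<open>intro mult_right_mono, auto simp: d_def\<close>)
    have B: "ennreal (pi / 1024 * ((cmod \<beta>)\<^sup>2 * (cmod (f p - f q))\<^sup>2)) \<le> ennreal (84000000 * pi) * ?I"
    proof (cases "p = q")
      case False
      \<comment> \<open>The distance |p - q|^2 is moved from the local difference estimate to the
        coefficient, where it forms the quotient |p - q|^2/d^2 bounded by the kernel.\<close>
      define V where "V = pi / 1024 * (d\<^sup>2 * (cmod (f p - f q))\<^sup>2) / (cmod (p - q))\<^sup>2"
      have e: "(cmod (p - q))\<^sup>2 > 0" using False by simp
      have "ennreal ((cmod (p - q))\<^sup>2) * ennreal (d\<^sup>2 * V) = ennreal (d\<^sup>2 * (pi / 1024 * (d\<^sup>2 * (cmod (f p - f q))\<^sup>2)))"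
        using e by (simp add: ennreal_mult'[symmetric] V_def)
      also note holomorphic_diff_local[OF f p near, folded d_def]
      finally have V: "ennreal ((1 - cmod p)\<^sup>2 * V) \<le> (\<integral>\<^sup>+z. ennreal ((cmod (f z))\<^sup>2) * indicator (ball p ((1 - cmod p) / 2)) z \<partial>lborel)"
        using e by (subst (asm) ennreal_mult_le_mult_iff) (simp_all add: ennreal_eq_0_iff not_le d_def)
      have "ennreal ((cmod \<beta>)\<^sup>2 * ((cmod (p - q))\<^sup>2 / d\<^sup>2) * V) \<le> ennreal (84000000 * pi) * ?I"
        by (rule submean_weighted[OF f p _ V _ _ X2 pair_kernel_nonneg Gc]) (auto simp: V_def)
      moreover have "(cmod \<beta>)\<^sup>2 * ((cmod (p - q))\<^sup>2 / d\<^sup>2) * V = pi / 1024 * ((cmod \<beta>)\<^sup>2 * (cmod (f p - f q))\<^sup>2)"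
        using e d by (simp add: V_def)
      ultimately show ?thesis by (simp only:)
    qed simp
    show ?thesis
    proof (rule ennreal_combine_bounds[OF _ _ _ _ sub[OF p _ X1] B])
      have "\<alpha> * f p - \<beta> * f q = (\<alpha> - \<beta>) * f p + \<beta> * (f p - f q)" by (simp add: algebra_simps)
      then have "(cmod (\<alpha> * f p - \<beta> * f q))\<^sup>2 \<le> (cmod ((\<alpha> - \<beta>) * f p) + cmod (\<beta> * (f p - f q)))\<^sup>2"
        by (simp only:) (intro power_mono norm_triangle_ineq norm_ge_zero)
      also note sum_power2_le
      finally show "(cmod (\<alpha> * f p - \<beta> * f q))\<^sup>2 \<le> 2 * ((cmod (\<alpha> - \<beta>))\<^sup>2 * (cmod (f p))\<^sup>2 + (cmod \<beta>)\<^sup>2 * (cmod (f p - f q))\<^sup>2)"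
        by (simp add: norm_mult power_mult_distrib)
    qed auto
  qed
qed

section \<open>Compactness and null sequences\<close>

definition locally_null :: "(nat \<Rightarrow> complex \<Rightarrow> complex) \<Rightarrow> bool" where
  "locally_null f \<longleftrightarrow> (\<forall>r<1. uniform_limit (cball 0 r) f (\<lambda>_. 0) sequentially)"

text \<open>Abstracts from the squared norms of \<open>H^2\<close> and \<open>A_1^2\<close>, so that the compactness arguments treat both at once.\<close>
definition disc_normsq :: "((complex \<Rightarrow> complex) \<Rightarrow> ennreal) \<Rightarrow> bool" where
  "disc_normsq N \<longleftrightarrow>
     (\<forall>f g. (\<forall>z\<in>unit_disc. cmod (f z) \<le> cmod (g z)) \<longrightarrow> N f \<le> N g) \<and>
     (\<forall>f g h. f holomorphic_on unit_disc \<longrightarrow> g holomorphic_on unit_disc \<longrightarrow>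
        (\<forall>z\<in>unit_disc. cmod (h z) \<le> cmod (f z) + cmod (g z)) \<longrightarrow> N h \<le> 2 * (N f + N g)) \<and>
     (\<forall>f p. f holomorphic_on unit_disc \<longrightarrow> p \<in> unit_disc \<longrightarrow>
        ennreal ((1 - cmod p) ^ 3) * ennreal ((cmod (f p))\<^sup>2) \<le> 4 * N f) \<and>
     (\<forall>fs f B. (\<forall>n::nat. fs n holomorphic_on unit_disc \<and> N (fs n) \<le> B) \<longrightarrow> f holomorphic_on unit_disc \<longrightarrow>
        (\<forall>z\<in>unit_disc. (\<lambda>n. fs n z) \<longlonglongrightarrow> f z) \<longrightarrow> N f \<le> B)"

lemma nn_integral_limit_le:
  assumes "\<And>n::nat. u n \<in> borel_measurable M" "\<And>n. (\<integral>\<^sup>+x. u n x \<partial>M) \<le> B" "\<And>x. (\<lambda>n. u n x) \<longlonglongrightarrow> v x"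
  shows "(\<integral>\<^sup>+x. v x \<partial>M) \<le> B"
proof -
  have "(\<integral>\<^sup>+x. v x \<partial>M) = (\<integral>\<^sup>+x. liminf (\<lambda>n. u n x) \<partial>M)"
    by (intro nn_integral_cong) (metis assms(3) lim_imp_Liminf trivial_limit_sequentially)
  also have "\<dots> \<le> liminf (\<lambda>n. \<integral>\<^sup>+x. u n x \<partial>M)"
    by (rule nn_integral_liminf) (rule assms(1))
  also have "\<dots> \<le> limsup (\<lambda>n. \<integral>\<^sup>+x. u n x \<partial>M)"
    by (rule Liminf_le_Limsup) simp
  also have "\<dots> \<le> B"
    by (rule Limsup_bounded) (simp add: assms(2))
  finally show ?thesis .
qed

lemma disc_normsq_A12: "disc_normsq A12_normsq"
  unfolding disc_normsq_def
proof (intro conjI allI impI)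
  fix fs :: "nat \<Rightarrow> complex \<Rightarrow> complex" and f B
  assume fs: "\<forall>n. fs n holomorphic_on unit_disc \<and> A12_normsq (fs n) \<le> B" and "f holomorphic_on unit_disc"
    and lim: "\<forall>z\<in>unit_disc. (\<lambda>n. fs n z) \<longlonglongrightarrow> f z"
  show "A12_normsq f \<le> B"
    unfolding A12_normsq_def
  proof (rule nn_integral_limit_le)
    fix n
    show "(\<lambda>z. ennreal ((cmod (fs n z))\<^sup>2 * (2 * (1 - (cmod z)\<^sup>2)) / pi) * indicator unit_disc z) \<in> borel_measurable lborel"
      unfolding measurable_lborel2 by (intro borel_measurable_ennreal_indicator A12_weight_continuous open_ball) (use fs in auto)
    show "(\<integral>\<^sup>+z. ennreal ((cmod (fs n z))\<^sup>2 * (2 * (1 - (cmod z)\<^sup>2)) / pi) * indicator unit_disc z \<partial>lborel) \<le> B"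
      using fs unfolding A12_normsq_def by auto
  next
    fix z :: complex
    show "(\<lambda>n. ennreal ((cmod (fs n z))\<^sup>2 * (2 * (1 - (cmod z)\<^sup>2)) / pi) * indicator unit_disc z) \<longlonglongrightarrow>
       ennreal ((cmod (f z))\<^sup>2 * (2 * (1 - (cmod z)\<^sup>2)) / pi) * indicator unit_disc z"
    proof (cases "z \<in> unit_disc")
      case True
      then have "(\<lambda>n. fs n z) \<longlonglongrightarrow> f z" using lim by blast
      then have "(\<lambda>n. ennreal ((cmod (fs n z))\<^sup>2 * (2 * (1 - (cmod z)\<^sup>2)) / pi)) \<longlonglongrightarrow> ennreal ((cmod (f z))\<^sup>2 * (2 * (1 - (cmod z)\<^sup>2)) / pi)"
        by (intro tendsto_ennrealI tendsto_intros) auto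
      then show ?thesis using True by (simp only: indicator_simps mult_1_right)
    qed simp
  qed
qed (blast intro: A12_normsq_mono A12_normsq_add_le A12_growth)+

text \<open>The growth bound is inherited from A_1^2, whose norm is the smaller one; the cubic
  exponent is not sharp for H^2 but makes one condition fit both spaces. Closure under pointwise
  limits is Fatou's lemma on each circle, followed by the supremum over radii.\<close>

lemma disc_normsq_H2: "disc_normsq H2_normsq"
  unfolding disc_normsq_def
proof (intro conjI allI impI)
  fix f p assume "f holomorphic_on unit_disc" "p \<in> unit_disc"
  then show "ennreal ((1 - cmod p) ^ 3) * ennreal ((cmod (f p))\<^sup>2) \<le> 4 * H2_normsq f"
    by (meson A12_growth A12_normsq_le_H2_normsq mult_left_mono order_trans zero_le)
next
  fix fs :: "nat \<Rightarrow> complex \<Rightarrow> complex" and f B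
  assume fs: "\<forall>n. fs n holomorphic_on unit_disc \<and> H2_normsq (fs n) \<le> B" and "f holomorphic_on unit_disc"
    and lim: "\<forall>z\<in>unit_disc. (\<lambda>n. fs n z) \<longlonglongrightarrow> f z"
  show "H2_normsq f \<le> B"
    unfolding H2_normsq_def
  proof (rule SUP_least)
    fix r :: real assume r: "r \<in> {0..<1}"
    let ?w = "\<lambda>f t. ennreal (1 / (2 * pi)) * (ennreal ((cmod (f (complex_of_real r * cis t)))\<^sup>2) * indicator {0..2 * pi} t)"
    have meas: "(\<lambda>t. g (complex_of_real r * cis t)) \<in> borel_measurable borel" if "g holomorphic_on unit_disc" for g
      using r that by (auto intro!: holomorphic_on_unit_disc_circle_measurable)
    have m1: "(\<lambda>t. ennreal ((cmod (g (complex_of_real r * cis t)))\<^sup>2) * indicator {0..2 * pi} t) \<in> borel_measurable borel"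
      if "g holomorphic_on unit_disc" for g
      using meas[OF that] by measurable
    have eq: "(\<integral>\<^sup>+t. ?w g t \<partial>lborel) = ennreal (1 / (2 * pi)) * (\<integral>\<^sup>+ t. ennreal ((cmod (g (complex_of_real r * cis t)))\<^sup>2) * indicator {0..2 * pi} t \<partial>lborel)"
      if "g holomorphic_on unit_disc" for g
      by (rule nn_integral_cmult) (simp only: measurable_lborel2 m1[OF that])
    have "(\<integral>\<^sup>+t. ?w f t \<partial>lborel) \<le> B"
    proof (rule nn_integral_limit_le)
      fix n
      have h: "fs n holomorphic_on unit_disc" using fs by blast
      show "?w (fs n) \<in> borel_measurable lborel"
        unfolding measurable_lborel2 using m1[OF h] by measurable
      have "(\<integral>\<^sup>+t. ?w (fs n) t \<partial>lborel) \<le> H2_normsq (fs n)"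
        unfolding H2_normsq_def eq[OF h] using r by (rule SUP_upper)
      also have "H2_normsq (fs n) \<le> B" using fs by blast
      finally show "(\<integral>\<^sup>+t. ?w (fs n) t \<partial>lborel) \<le> B" .
    next
      fix t :: real
      have "complex_of_real r * cis t \<in> unit_disc" using r by (simp add: norm_mult)
      then have l: "(\<lambda>n. fs n (complex_of_real r * cis t)) \<longlonglongrightarrow> f (complex_of_real r * cis t)" using lim by blast
      have "(\<lambda>n. ennreal ((cmod (fs n (complex_of_real r * cis t)))\<^sup>2)) \<longlonglongrightarrow> ennreal ((cmod (f (complex_of_real r * cis t)))\<^sup>2)"
        by (intro tendsto_ennrealI tendsto_intros l)
      then show "(\<lambda>n. ?w (fs n) t) \<longlonglongrightarrow> ?w f t"
        by (cases "t \<in> {0..2*pi}") (simp_all add: ennreal_tendsto_cmult)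
    qed
    then show "ennreal (1 / (2 * pi)) * (\<integral>\<^sup>+ t. ennreal ((cmod (f (complex_of_real r * cis t)))\<^sup>2) * indicator {0..2 * pi} t \<partial>lborel) \<le> B"
      by (simp only: eq[OF \<open>f holomorphic_on unit_disc\<close>])
  qed
qed (blast intro: H2_normsq_mono H2_normsq_add_le)+

lemma disc_normsq_mono:
  assumes "disc_normsq N" "\<And>z. z \<in> unit_disc \<Longrightarrow> cmod (f z) \<le> cmod (g z)"
  shows "N f \<le> N g"
  by (rule assms(1)[unfolded disc_normsq_def, THEN conjunct1, rule_format]) (rule assms(2))

lemma disc_normsq_cong:
  assumes "disc_normsq N" "\<And>z. z \<in> unit_disc \<Longrightarrow> f z = g z"
  shows "N f = N g"
  by (intro antisym disc_normsq_mono[OF assms(1)]) (simp_all add: assms(2))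

lemma disc_normsq_add_le:
  assumes "disc_normsq N" "f holomorphic_on unit_disc" "g holomorphic_on unit_disc"
    "\<And>z. z \<in> unit_disc \<Longrightarrow> cmod (h z) \<le> cmod (f z) + cmod (g z)"
  shows "N h \<le> 2 * (N f + N g)"
  by (rule assms(1)[unfolded disc_normsq_def, THEN conjunct2, THEN conjunct1, rule_format]) (rule assms(2-4))+

lemma disc_normsq_growth:
  assumes "disc_normsq N" "f holomorphic_on unit_disc" "p \<in> unit_disc"
  shows "ennreal ((1 - cmod p) ^ 3) * ennreal ((cmod (f p))\<^sup>2) \<le> 4 * N f"
  by (rule assms(1)[unfolded disc_normsq_def, THEN conjunct2, THEN conjunct2, THEN conjunct1, rule_format])
     (rule assms(2-3))+

lemma disc_normsq_fatou:
  fixes fs :: "nat \<Rightarrow> complex \<Rightarrow> complex"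
  assumes "disc_normsq N" "\<And>n. fs n holomorphic_on unit_disc" "\<And>n. N (fs n) \<le> B"
    "f holomorphic_on unit_disc" "\<And>z. z \<in> unit_disc \<Longrightarrow> (\<lambda>n. fs n z) \<longlonglongrightarrow> f z"
  shows "N f \<le> B"
  by (rule assms(1)[unfolded disc_normsq_def, THEN conjunct2, THEN conjunct2, THEN conjunct2, rule_format, of fs])
     (rule conjI assms(2-5) | assumption)+

section \<open>Membership, norms and sequential compactness for an abstract squared norm\<close>

definition disc_mem :: "((complex \<Rightarrow> complex) \<Rightarrow> ennreal) \<Rightarrow> (complex \<Rightarrow> complex) \<Rightarrow> bool" where
  "disc_mem N f \<longleftrightarrow> f holomorphic_on unit_disc \<and> N f < \<infinity>"

definition disc_nrm :: "((complex \<Rightarrow> complex) \<Rightarrow> ennreal) \<Rightarrow> (complex \<Rightarrow> complex) \<Rightarrow> real" where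
  "disc_nrm N f = sqrt (enn2real (N f))"

lemma in_H2_eq: "in_H2 = disc_mem H2_normsq" and H2_norm_eq: "H2_norm = disc_nrm H2_normsq"
  and in_A12_eq: "in_A12 = disc_mem A12_normsq" and A12_norm_eq: "A12_norm = disc_nrm A12_normsq"
  by (auto simp: fun_eq_iff in_H2_def in_A12_def disc_mem_def H2_norm_def A12_norm_def disc_nrm_def)

lemma ennreal_tendsto_0I:
  fixes F :: "nat \<Rightarrow> ennreal"
  assumes "\<And>e::real. 0 < e \<Longrightarrow> eventually (\<lambda>n. F n \<le> ennreal e) sequentially"
  shows "F \<longlonglongrightarrow> 0"
proof (rule order_tendstoI)
  fix x :: ennreal assume "0 < x"
  then obtain y where y: "0 < y" "y < x" using dense by blast
  then obtain e where e: "y = ennreal e" "0 \<le> e" by (cases y) (auto simp: top_unique)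
  then have "0 < e" using y by auto
  show "eventually (\<lambda>n. F n < x) sequentially"
    using assms[OF \<open>0 < e\<close>] by eventually_elim (use y e in auto)
qed simp

lemma ennreal_tendsto_0D:
  fixes F :: "nat \<Rightarrow> ennreal"
  assumes "F \<longlonglongrightarrow> 0" "0 < e"
  shows "eventually (\<lambda>n. F n \<le> ennreal e) sequentially"
proof -
  have "0 < ennreal e" using assms(2) by simp
  from order_tendstoD(2)[OF assms(1) this] show ?thesis
    by (rule eventually_mono) (rule less_imp_le)
qed

text \<open>Finiteness is essential because \<open>enn2real\<close> sends infinity to 0. Hence every
  use first shows that the function in question belongs to the space.\<close>

lemma sqrt_enn2real_tendsto_0_iff:
  fixes F :: "nat \<Rightarrow> ennreal"
  assumes fin: "\<And>n. F n < \<infinity>"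
  shows "(\<lambda>n. sqrt (enn2real (F n))) \<longlonglongrightarrow> 0 \<longleftrightarrow> F \<longlonglongrightarrow> 0"
proof
  assume "(\<lambda>n. sqrt (enn2real (F n))) \<longlonglongrightarrow> 0"
  then have "(\<lambda>n. ennreal ((sqrt (enn2real (F n)))\<^sup>2)) \<longlonglongrightarrow> ennreal (0\<^sup>2)"
    by (intro tendsto_ennrealI tendsto_power)
  then show "F \<longlonglongrightarrow> 0" using fin by (simp add: less_top[symmetric])
next
  assume "F \<longlonglongrightarrow> 0"
  then have "(\<lambda>n. sqrt (enn2real (F n))) \<longlonglongrightarrow> sqrt (enn2real 0)"
    by (intro tendsto_intros) auto
  then show "(\<lambda>n. sqrt (enn2real (F n))) \<longlonglongrightarrow> 0" by simp
qed

lemma disc_mem_diff: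
  assumes "disc_normsq N" "disc_mem N f" "disc_mem N g"
  shows "disc_mem N (f - g)"
proof -
  have "N (f - g) \<le> 2 * (N f + N g)"
    using assms by (intro disc_normsq_add_le) (auto simp: disc_mem_def norm_triangle_ineq4)
  also have "\<dots> < \<infinity>" using assms by (simp add: disc_mem_def ennreal_mult_less_top)
  finally show ?thesis using assms by (auto simp: disc_mem_def fun_diff_def intro!: holomorphic_intros)
qed

lemma disc_normsq_tendsto_pointwise:
  assumes M: "disc_normsq M" and h: "\<And>n. h n holomorphic_on unit_disc" and lim: "(\<lambda>n. M (h n)) \<longlonglongrightarrow> 0"
    and z: "z \<in> unit_disc"
  shows "(\<lambda>n. h n z) \<longlonglongrightarrow> 0"
proof -
  have d: "0 < (1 - cmod z) ^ 3" using z by simp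
  have "(\<lambda>n. ennreal ((1 - cmod z) ^ 3) * ennreal ((cmod (h n z))\<^sup>2)) \<longlonglongrightarrow> 0"
  proof (rule tendsto_sandwich[OF _ _ tendsto_const])
    show "(\<lambda>n. 4 * M (h n)) \<longlonglongrightarrow> 0"
      using ennreal_tendsto_cmult[OF _ lim, of 4] by simp
  qed (use disc_normsq_growth[OF M h z] in auto)
  then have "(\<lambda>n. ennreal ((1 - cmod z) ^ 3 * (cmod (h n z))\<^sup>2)) \<longlonglongrightarrow> ennreal 0"
    using d by (simp add: ennreal_mult)
  then have "(\<lambda>n. (1 - cmod z) ^ 3 * (cmod (h n z))\<^sup>2) \<longlonglongrightarrow> 0"
    by (subst (asm) tendsto_ennreal_iff) (use d in \<open>auto intro!: mult_nonneg_nonneg\<close>)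
  then have "(\<lambda>n. (1 / (1 - cmod z) ^ 3) * ((1 - cmod z) ^ 3 * (cmod (h n z))\<^sup>2)) \<longlonglongrightarrow> (1 / (1 - cmod z) ^ 3) * 0"
    by (rule tendsto_mult_left)
  then have "(\<lambda>n. (cmod (h n z))\<^sup>2) \<longlonglongrightarrow> 0" using d by simp
  then have "(\<lambda>n. sqrt ((cmod (h n z))\<^sup>2)) \<longlonglongrightarrow> sqrt 0" by (rule tendsto_real_sqrt)
  then show ?thesis by (simp add: tendsto_norm_zero_iff)
qed

lemma compact_op_subseq:
  fixes fs :: "nat \<Rightarrow> complex \<Rightarrow> complex"
  assumes N: "disc_normsq N" and M: "disc_normsq M"
    and T: "compact_op (disc_mem N) (disc_nrm N) (disc_mem M) (disc_nrm M) T"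
    and f: "\<And>n. disc_mem N (fs n)" "\<And>n. N (fs n) \<le> ennreal B"
  obtains r g where "strict_mono r" "disc_mem M g" "(\<lambda>n. M (T (fs (r n)) - g)) \<longlonglongrightarrow> 0"
proof -
  \<comment> \<open>\<open>B\<close> may be negative, in which case \<open>ennreal B\<close> is 0;
    the maximum makes the square root a valid bound in both cases.\<close>
  have "disc_nrm N (fs n) \<le> sqrt (max B 0)" for n
  proof -
    have "enn2real (N (fs n)) \<le> max B 0"
      using order_trans[OF f(2)[of n] ennreal_leI[of B "max B 0"]] by (intro enn2real_leI) auto
    then show ?thesis unfolding disc_nrm_def by simp
  qed
  then have "(\<forall>n. disc_mem N (fs n)) \<and> (\<exists>B. \<forall>n. disc_nrm N (fs n) \<le> B)" using f(1) by blast
  with T[unfolded compact_op_def, THEN conjunct2, THEN spec, of fs, THEN mp]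
  have "\<exists>r g. strict_mono r \<and> disc_mem M g \<and> (\<lambda>n. disc_nrm M (T (fs (r n)) - g)) \<longlonglongrightarrow> 0" .
  then obtain r g where rg: "strict_mono r" "disc_mem M g" "(\<lambda>n. disc_nrm M (T (fs (r n)) - g)) \<longlonglongrightarrow> 0"
    by blast
  have "disc_mem M (T (fs n))" for n using T f(1) unfolding compact_op_def by blast
  then have "disc_mem M (T (fs (r n)) - g)" for n
    using disc_mem_diff[OF M _ rg(2)] by blast
  then have "(\<lambda>n. M (T (fs (r n)) - g)) \<longlonglongrightarrow> 0"
    using rg(3) unfolding disc_nrm_def by (subst (asm) sqrt_enn2real_tendsto_0_iff) (auto simp: disc_mem_def)
  then show ?thesis using that rg by blast
qed

text \<open>If the images stayed away from 0 along a subsequence, a further subsequence would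
  converge in norm to some g. Norm convergence implies pointwise convergence, so the pointwise limit
  0 forces g to vanish on the disc.\<close>

lemma compact_op_null:
  fixes fs :: "nat \<Rightarrow> complex \<Rightarrow> complex"
  assumes N: "disc_normsq N" and M: "disc_normsq M"
    and T: "compact_op (disc_mem N) (disc_nrm N) (disc_mem M) (disc_nrm M) T"
    and f: "\<And>n. disc_mem N (fs n)" "\<And>n. N (fs n) \<le> ennreal B"
    and lim: "\<And>z. z \<in> unit_disc \<Longrightarrow> (\<lambda>n. T (fs n) z) \<longlonglongrightarrow> 0"
  shows "(\<lambda>n. M (T (fs n))) \<longlonglongrightarrow> 0"
proof (rule ennreal_tendsto_0I, rule ccontr)
  fix e :: real assume e: "0 < e" and "\<not> eventually (\<lambda>n. M (T (fs n)) \<le> ennreal e) sequentially"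
  then have "\<exists>\<^sub>F n in sequentially. ennreal e < M (T (fs n))"
    by (simp add: not_eventually not_le)
  then have "infinite {n. ennreal e < M (T (fs n))}"
    by (simp add: cofinite_eq_sequentially[symmetric] frequently_cofinite)
  then obtain s :: "nat \<Rightarrow> nat" where s: "strict_mono s" "\<And>n. ennreal e < M (T (fs (s n)))"
    using infinite_enumerate by blast
  obtain r g where rg: "strict_mono r" "disc_mem M g" "(\<lambda>n. M (T (fs (s (r n))) - g)) \<longlonglongrightarrow> 0"
    using compact_op_subseq[OF N M T, of "fs \<circ> s" B] f by auto
  have mem: "disc_mem M (T (fs n))" for n using T f(1) unfolding compact_op_def by blast
  have g0: "g z = 0" if z: "z \<in> unit_disc" for z
  proof -
    have "(T (fs (s (r n))) - g) holomorphic_on unit_disc" for n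
      using disc_mem_diff[OF M mem rg(2)] by (simp add: disc_mem_def)
    from disc_normsq_tendsto_pointwise[OF M this rg(3) z]
    have 1: "(\<lambda>n. T (fs (s (r n))) z - g z) \<longlonglongrightarrow> 0" by simp
    have "(\<lambda>n. T (fs ((s \<circ> r) n)) z) \<longlonglongrightarrow> 0"
      using LIMSEQ_subseq_LIMSEQ[OF lim[OF z] strict_mono_o[OF s(1) rg(1)]] by (simp add: o_def)
    from tendsto_diff[OF this 1] have "(\<lambda>n. g z) \<longlonglongrightarrow> 0" by simp
    then show ?thesis by (simp add: LIMSEQ_const_iff)
  qed
  \<comment> \<open>\<open>g\<close> is known to vanish on the disc only, so the two functions are
    compared through \<open>M\<close> rather than shown to be equal.\<close>
  have "M (T (fs (s (r n))) - g) = M (T (fs (s (r n))))" for n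
    by (rule disc_normsq_cong[OF M]) (simp add: g0)
  then have "eventually (\<lambda>n. M (T (fs (s (r n)))) \<le> ennreal e) sequentially"
    using ennreal_tendsto_0D[OF rg(3) e] by simp
  then obtain n where "M (T (fs (s (r n)))) \<le> ennreal e" by (auto simp: eventually_sequentially)
  then show False using s(2)[of "r n"] by simp
qed

text \<open>Otherwise some bounded sequence has images of squared norm above n, yet a subsequence of
  these images converges to an element of the space and is therefore bounded.\<close>

lemma compact_op_bounded:
  assumes N: "disc_normsq N" and M: "disc_normsq M"
    and T: "compact_op (disc_mem N) (disc_nrm N) (disc_mem M) (disc_nrm M) T"
  shows "\<exists>C\<ge>0. \<forall>f. disc_mem N f \<and> N f \<le> ennreal B \<longrightarrow> M (T f) \<le> ennreal C"
proof (rule ccontr)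
  assume *: "\<not> ?thesis"
  have "\<exists>f. disc_mem N f \<and> N f \<le> ennreal B \<and> \<not> M (T f) \<le> ennreal (real n)" for n
  proof (rule ccontr)
    assume "\<nexists>f. disc_mem N f \<and> N f \<le> ennreal B \<and> \<not> M (T f) \<le> ennreal (real n)"
    then have "0 \<le> real n \<and> (\<forall>f. disc_mem N f \<and> N f \<le> ennreal B \<longrightarrow> M (T f) \<le> ennreal (real n))"
      by auto
    then show False using * by blast
  qed
  then have "\<exists>fs. \<forall>n. disc_mem N (fs n) \<and> N (fs n) \<le> ennreal B \<and> \<not> M (T (fs n)) \<le> ennreal (real n)"
    by (intro choice allI)
  then obtain fs where fs: "\<And>n. disc_mem N (fs n)" "\<And>n. N (fs n) \<le> ennreal B" "\<And>n. \<not> M (T (fs n)) \<le> ennreal (real n)"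
    by blast
  obtain r g where rg: "strict_mono r" "disc_mem M g" "(\<lambda>n. M (T (fs (r n)) - g)) \<longlonglongrightarrow> 0"
    by (rule compact_op_subseq[OF N M T fs(1,2)])
  have mem: "disc_mem M (T (fs n))" for n using T fs(1) unfolding compact_op_def by blast
  obtain G where G: "M g = ennreal G" "0 \<le> G" using rg(2) by (cases "M g") (auto simp: disc_mem_def)
  obtain n0 where n0: "\<And>n. n \<ge> n0 \<Longrightarrow> M (T (fs (r n)) - g) \<le> ennreal 1"
    using ennreal_tendsto_0D[OF rg(3), of 1] by (auto simp: eventually_sequentially)
  \<comment> \<open>Large enough both for distance at most 1 to the limit and for 2 (1 + G) \<le> n;
    then n \<le> r n contradicts the lower bound for the image with index
    \<open>r n\<close>.\<close>
  define n where "n = max n0 (nat \<lceil>2 * (1 + G)\<rceil>)"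
  have "M (T (fs (r n))) \<le> 2 * (M (T (fs (r n)) - g) + M g)"
  proof (rule disc_normsq_add_le[OF M])
    show "(T (fs (r n)) - g) holomorphic_on unit_disc"
      using disc_mem_diff[OF M mem rg(2)] by (simp add: disc_mem_def)
    show "cmod (T (fs (r n)) z) \<le> cmod ((T (fs (r n)) - g) z) + cmod (g z)" for z
      using norm_triangle_ineq[of "T (fs (r n)) z - g z" "g z"] by simp
  qed (use rg(2) in \<open>simp add: disc_mem_def\<close>)
  also have "\<dots> \<le> 2 * (ennreal 1 + ennreal G)"
    unfolding G(1) by (intro mult_left_mono add_right_mono n0) (auto simp: n_def)
  also have "\<dots> = ennreal (2 * (1 + G))"
    using G(2) by (subst ennreal_mult', simp, subst ennreal_plus) auto
  also have "\<dots> \<le> ennreal (real (r n))"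
  proof (rule ennreal_leI)
    have "2 * (1 + G) \<le> real n" unfolding n_def by linarith
    also have "n \<le> r n" using rg(1) by (rule seq_suble)
    finally show "2 * (1 + G) \<le> real (r n)" by simp
  qed
  finally show False using fs(3) by blast
qed

text \<open>The converse of \<open>compact_op_null\<close>. Montel's theorem extracts a locally
  uniform limit g of a bounded sequence, and \<open>null\<close> is applied to the differences with
  g; \<open>diff\<close> is the form of linearity that makes their images the differences of the
  images.\<close>

lemma compact_opI:
  assumes N: "disc_normsq N" and M: "disc_normsq M"
    and T: "\<And>f. disc_mem N f \<Longrightarrow> disc_mem M (T f)"
    and diff: "\<And>f g. T (f - g) = T f - T g"
    and null: "\<And>fs B. \<lbrakk>\<And>n. disc_mem N (fs n); \<And>n. N (fs n) \<le> ennreal B; locally_null fs\<rbrakk> \<Longrightarrow> (\<lambda>n. M (T (fs n))) \<longlonglongrightarrow> 0"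
  shows "compact_op (disc_mem N) (disc_nrm N) (disc_mem M) (disc_nrm M) T"
  unfolding compact_op_def
proof (intro conjI allI impI)
  fix f assume "disc_mem N f" then show "disc_mem M (T f)" by (rule T)
next
  fix fs :: "nat \<Rightarrow> complex \<Rightarrow> complex"
  assume "(\<forall>n. disc_mem N (fs n)) \<and> (\<exists>B. \<forall>n. disc_nrm N (fs n) \<le> B)"
  then obtain b where mem: "\<And>n. disc_mem N (fs n)" and b: "\<And>n. disc_nrm N (fs n) \<le> b" by blast
  define B where "B = b\<^sup>2"
  have B: "N (fs n) \<le> ennreal B" for n
  proof -
    have "(sqrt (enn2real (N (fs n))))\<^sup>2 \<le> b\<^sup>2"
      using b[of n] unfolding disc_nrm_def by (intro power_mono) auto
    then have "enn2real (N (fs n)) \<le> B" by (simp add: B_def)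
    then have "ennreal (enn2real (N (fs n))) \<le> ennreal B" by (rule ennreal_leI)
    then show ?thesis using mem[of n] by (simp add: disc_mem_def less_top[symmetric])
  qed
  have B0: "0 \<le> B" by (simp add: B_def)
  have hol: "fs n holomorphic_on unit_disc" for n using mem by (simp add: disc_mem_def)
  obtain g r where gr: "g holomorphic_on unit_disc" "strict_mono (r :: nat \<Rightarrow> nat)"
     "\<And>x. x \<in> unit_disc \<Longrightarrow> ((\<lambda>n. fs (r n) x) \<longlongrightarrow> g x) sequentially"
     "\<And>K. \<lbrakk>compact K; K \<subseteq> unit_disc\<rbrakk> \<Longrightarrow> uniform_limit K (fs \<circ> r) g sequentially"
  proof (rule Montel[of unit_disc "range fs" fs])
    fix K :: "complex set" assume K: "compact K" "K \<subseteq> unit_disc"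
    show "\<exists>B. \<forall>h\<in>range fs. \<forall>z\<in>K. cmod (h z) \<le> B"
    proof (cases "K = {}")
      case False
      \<comment> \<open>The growth bound depends on \<open>z\<close>; its maximum over the compact
        set \<open>K\<close> supplies the uniform bound that Montel's theorem asks for.\<close>
      have "continuous_on K (\<lambda>z. 4 * B / (1 - cmod z) ^ 3)"
        using K(2) by (intro continuous_intros) (auto simp: subset_iff)
      then obtain x where x: "\<And>z. z \<in> K \<Longrightarrow> 4 * B / (1 - cmod z) ^ 3 \<le> 4 * B / (1 - cmod x) ^ 3"
        using continuous_attains_sup[OF K(1) False] by blast
      have "cmod (fs n z) \<le> sqrt (4 * B / (1 - cmod x) ^ 3)" if z: "z \<in> K" for n z
      proof -
        have zd: "z \<in> unit_disc" using z K by blast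
        then have d: "0 < (1 - cmod z) ^ 3" by simp
        have "ennreal ((1 - cmod z) ^ 3) * ennreal ((cmod (fs n z))\<^sup>2) \<le> 4 * N (fs n)"
          by (rule disc_normsq_growth[OF N hol zd])
        also have "\<dots> \<le> 4 * ennreal B" using B by (rule mult_left_mono) simp
        also have "\<dots> = ennreal (4 * B)" by (simp add: ennreal_mult')
        finally have "(1 - cmod z) ^ 3 * (cmod (fs n z))\<^sup>2 \<le> 4 * B"
          using d B0 by (simp add: ennreal_mult[symmetric])
        then have "(cmod (fs n z))\<^sup>2 \<le> 4 * B / (1 - cmod z) ^ 3"
          using d by (simp add: pos_le_divide_eq mult.commute)
        also have "\<dots> \<le> 4 * B / (1 - cmod x) ^ 3" using x[OF z] .
        finally show ?thesis by (rule real_le_rsqrt)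
      qed
      then show ?thesis by blast
    qed simp
  qed (use hol in auto)
  \<comment> \<open>Locally uniform convergence is not convergence in norm. Fatou's lemma is what
    places the limit in the space.\<close>
  have Ng: "N g \<le> ennreal B"
    by (rule disc_normsq_fatou[OF N, of "\<lambda>n. fs (r n)"]) (use hol B gr in auto)
  have gm: "disc_mem N g" using gr(1) Ng by (auto simp: disc_mem_def intro: le_less_trans)
  have lim: "(\<lambda>n. M (T (fs (r n) - g))) \<longlonglongrightarrow> 0"
  proof (rule null)
    show "disc_mem N (fs (r n) - g)" for n by (rule disc_mem_diff[OF N mem gm])
    show "N (fs (r n) - g) \<le> ennreal (4 * B)" for n
    proof -
      have "N (fs (r n) - g) \<le> 2 * (N (fs (r n)) + N g)"
        using hol gr(1) by (intro disc_normsq_add_le[OF N]) (auto simp: norm_triangle_ineq4)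
      also have "\<dots> \<le> 2 * (ennreal B + ennreal B)" using B Ng by (intro mult_left_mono add_mono) auto
      also have "\<dots> = ennreal (2 * (B + B))"
        using B0 by (subst ennreal_mult', simp, subst ennreal_plus) auto
      also have "2 * (B + B) = 4 * B" by simp
      finally show ?thesis .
    qed
    show "locally_null (\<lambda>n. fs (r n) - g)"
      unfolding locally_null_def
    proof (intro allI impI)
      fix \<rho> :: real assume "\<rho> < 1"
      then have "uniform_limit (cball 0 \<rho>) (fs \<circ> r) g sequentially"
        by (intro gr(4)) auto
      then show "uniform_limit (cball 0 \<rho>) (\<lambda>n. fs (r n) - g) (\<lambda>_. 0) sequentially"
        unfolding uniform_limit_iff by (simp add: dist_norm)
    qed
  qed
  have mm: "disc_mem M (T (fs (r n)) - T g)" for n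
    by (rule disc_mem_diff[OF M T[OF mem] T[OF gm]])
  have "(\<lambda>n. disc_nrm M (T (fs (r n)) - T g)) \<longlonglongrightarrow> 0"
    unfolding disc_nrm_def using lim mm
    by (subst sqrt_enn2real_tendsto_0_iff) (auto simp: disc_mem_def diff)
  then show "\<exists>r g. strict_mono r \<and> disc_mem M g \<and> (\<lambda>n. disc_nrm M (T (fs (r n)) - g)) \<longlonglongrightarrow> 0"
    using gr(2) T[OF gm] by blast
qed

section \<open>Test functions\<close>

text \<open>The infinitesimal form of \<open>disc_aut_diff\<close>. Differentiating a factor s or t
  thus produces two kernel powers and the derivative of the symbol.\<close>

lemma DERIV_disc_aut:
  assumes "a \<in> unit_disc" "x \<in> unit_disc"
  shows "(disc_aut a has_field_derivative (szego a x)\<^sup>2) (at x)"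
proof -
  have n: "1 - cnj a * x \<noteq> 0" using assms one_minus_cnj_mult_neq_0 by blast
  have "((\<lambda>z. (z - a) / (1 - cnj a * z)) has_field_derivative
      (1 * (1 - cnj a * x) - (x - a) * (- cnj a)) / ((1 - cnj a * x) * (1 - cnj a * x))) (at x)"
    using n by (auto intro!: derivative_eq_intros)
  moreover have "(1 * (1 - cnj a * x) - (x - a) * (- cnj a)) / ((1 - cnj a * x) * (1 - cnj a * x)) = (szego a x)\<^sup>2"
  proof -
    have "1 * (1 - cnj a * x) - (x - a) * (- cnj a) = 1 - a * cnj a" by (simp add: algebra_simps)
    moreover have "(szego a x)\<^sup>2 = (1 - a * cnj a) / ((1 - cnj a * x) * (1 - cnj a * x))"
      unfolding power2_eq_square[of "szego a x"]
      unfolding szego_def times_divide_times_eq of_real_sqrt_weight[OF assms(1)] ..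
    ultimately show ?thesis by (simp only:)
  qed
  ultimately show ?thesis unfolding disc_aut_def[abs_def] by simp
qed

text \<open>On the disc the function is c^3 / (1 - cnj a * z)^2 with c = sqrt(1 - |a|^2), so its
  derivative is a bounded multiple of k_a^3 without a negative power of c, unlike that of k_a
  itself.\<close>

lemma DERIV_szego_combination:
  assumes a: "a \<in> unit_disc" and x: "x \<in> unit_disc"
  shows "((\<lambda>z. szego a z * (1 + cnj a * disc_aut a z)) has_field_derivative 2 * cnj a * szego a x ^ 3) (at x)"
proof (rule has_field_derivative_transform_within_open[OF _ open_ball x])
  let ?c = "complex_of_real (sqrt (1 - (cmod a)\<^sup>2))"
  have n: "1 - cnj a * x \<noteq> 0" using assms one_minus_cnj_mult_neq_0 by blast
  have "((\<lambda>z. ?c ^ 3 / (1 - cnj a * z)\<^sup>2) has_field_derivative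
     (?c ^ 3 * (2 * cnj a * (1 - cnj a * x))) / ((1 - cnj a * x)\<^sup>2 * (1 - cnj a * x)\<^sup>2)) (at x)"
    using n by (auto intro!: derivative_eq_intros simp: power2_eq_square)
  moreover have "(?c ^ 3 * (2 * cnj a * (1 - cnj a * x))) / ((1 - cnj a * x)\<^sup>2 * (1 - cnj a * x)\<^sup>2) = 2 * cnj a * szego a x ^ 3"
  proof -
    have "(c ^ 3 * (2 * A * m)) / (m\<^sup>2 * m\<^sup>2) = 2 * A * (c / m) ^ 3" if "m \<noteq> 0" for c A m :: complex
      using that by (simp add: field_simps power2_eq_square power3_eq_cube)
    from this[OF n] show ?thesis unfolding szego_def .
  qed
  ultimately show "((\<lambda>z. ?c ^ 3 / (1 - cnj a * z)\<^sup>2) has_field_derivative 2 * cnj a * szego a x ^ 3) (at x)" by simp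
  fix z assume "z \<in> unit_disc"
  from one_plus_disc_aut[OF a this] show "?c ^ 3 / (1 - cnj a * z)\<^sup>2 = szego a z * (1 + cnj a * disc_aut a z)"
    by (simp add: szego_def power2_eq_square power3_eq_cube)
qed

lemma holomorphic_disc_aut: "a \<in> unit_disc \<Longrightarrow> disc_aut a holomorphic_on unit_disc"
  unfolding disc_aut_def[abs_def] by (intro holomorphic_intros) (use one_minus_cnj_mult_neq_0 in auto)

lemma holomorphic_szego: "a \<in> unit_disc \<Longrightarrow> szego a holomorphic_on unit_disc"
  unfolding szego_def[abs_def] by (intro holomorphic_intros) (use one_minus_cnj_mult_neq_0 in auto)

lemma H2_normsq_szego:
  assumes "a \<in> unit_disc"
  shows "H2_normsq (szego a) = 1"
proof -
  let ?c = "sqrt (1 - (cmod a)\<^sup>2)"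
  have a: "cmod a < 1" and a2: "(cmod a)\<^sup>2 < 1" using assms by (simp_all add: abs_square_less_1)
  have "taylor_coeff (szego a) n = complex_of_real ?c * cnj a ^ n" for n
  proof (rule taylor_coeff_eqI)
    fix z :: complex assume z: "cmod z < 1"
    have "cmod (cnj a * z) < 1 * 1"
      unfolding norm_mult using a z by (intro mult_strict_mono') auto
    then have "(\<lambda>n. complex_of_real ?c * (cnj a * z) ^ n) sums (complex_of_real ?c * (1 / (1 - cnj a * z)))"
      by (intro sums_mult geometric_sums) simp
    then show "(\<lambda>n. complex_of_real ?c * cnj a ^ n * z ^ n) sums szego a z"
      by (simp add: szego_def power_mult_distrib mult.assoc)
  qed
  then have "(cmod (taylor_coeff (szego a) n))\<^sup>2 = (1 - (cmod a)\<^sup>2) * ((cmod a)\<^sup>2) ^ n" for n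
    using a2 by (simp add: norm_mult norm_power power_mult_distrib power_mult[symmetric] mult.commute)
  moreover have "(\<Sum>n. ennreal ((1 - (cmod a)\<^sup>2) * ((cmod a)\<^sup>2) ^ n)) = ennreal ((1 - (cmod a)\<^sup>2) * (1 / (1 - (cmod a)\<^sup>2)))"
    using a2 by (intro suminf_ennreal_eq sums_mult geometric_sums) auto
  ultimately show ?thesis
    using a2 by (simp add: H2_normsq_eq_suminf[OF holomorphic_szego[OF assms]])
qed

definition test_fun :: "nat \<Rightarrow> complex \<Rightarrow> complex \<Rightarrow> complex" where
  "test_fun j a z = disc_aut a z ^ j * szego a z"

lemma holomorphic_test_fun: "a \<in> unit_disc \<Longrightarrow> test_fun j a holomorphic_on unit_disc"
  unfolding test_fun_def[abs_def] by (intro holomorphic_intros holomorphic_disc_aut holomorphic_szego)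

lemma test_fun_le_szego: "a \<in> unit_disc \<Longrightarrow> z \<in> unit_disc \<Longrightarrow> cmod (test_fun j a z) \<le> cmod (szego a z)"
  unfolding test_fun_def norm_mult norm_power
  by (intro mult_left_le_one_le power_le_one disc_aut_bound) auto

lemma H2_normsq_test_fun: "a \<in> unit_disc \<Longrightarrow> H2_normsq (test_fun j a) \<le> 1"
  by (rule order_trans[OF H2_normsq_mono[of _ "szego a"]]) (auto simp: test_fun_le_szego H2_normsq_szego)

lemma disc_mem_test_fun: "a \<in> unit_disc \<Longrightarrow> disc_mem H2_normsq (test_fun j a)"
  using H2_normsq_test_fun[of a j] holomorphic_test_fun[of a j]
  by (auto simp: disc_mem_def intro: le_less_trans)

lemma test_fun_tendsto_0:
  assumes a: "\<And>n. a n \<in> unit_disc" and lim: "(\<lambda>n. cmod (a n)) \<longlonglongrightarrow> 1" and z: "z \<in> unit_disc"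
  shows "(\<lambda>n. test_fun j (a n) z) \<longlonglongrightarrow> 0"
proof (rule Lim_null_comparison)
  show "\<forall>\<^sub>F n in sequentially. cmod (test_fun j (a n) z) \<le> sqrt (1 - (cmod (a n))\<^sup>2) / (1 - cmod z)"
  proof (rule always_eventually, rule allI)
    fix n
    have c: "0 \<le> 1 - (cmod (a n))\<^sup>2" using a[of n] by (simp add: abs_square_le_1)
    have "cmod (cnj (a n) * z) \<le> 1 * cmod z" unfolding norm_mult using a[of n] by (intro mult_right_mono) auto
    then have d: "1 - cmod z \<le> cmod (1 - cnj (a n) * z)"
      using norm_triangle_ineq2[of 1 "cnj (a n) * z"] by simp
    have "cmod (test_fun j (a n) z) \<le> cmod (szego (a n) z)" by (rule test_fun_le_szego[OF a z])
    also have "\<dots> = sqrt (1 - (cmod (a n))\<^sup>2) / cmod (1 - cnj (a n) * z)"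
      using c by (simp add: szego_def norm_divide)
    also have "\<dots> \<le> sqrt (1 - (cmod (a n))\<^sup>2) / (1 - cmod z)"
      using c d z by (intro divide_left_mono mult_pos_pos) auto
    finally show "cmod (test_fun j (a n) z) \<le> sqrt (1 - (cmod (a n))\<^sup>2) / (1 - cmod z)" .
  qed
  have "(\<lambda>n. sqrt (1 - (cmod (a n))\<^sup>2) / (1 - cmod z)) \<longlonglongrightarrow> sqrt (1 - 1\<^sup>2) / (1 - cmod z)"
    using z by (intro tendsto_intros lim) auto
  then show "(\<lambda>n. sqrt (1 - (cmod (a n))\<^sup>2) / (1 - cmod z)) \<longlonglongrightarrow> 0" by simp
qed

lemma A12_normsq_add_le_bound:
  assumes "f holomorphic_on unit_disc" "g holomorphic_on unit_disc"
    "\<And>z. z \<in> unit_disc \<Longrightarrow> cmod (h z) \<le> cmod (f z) + cmod (g z)"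
    "A12_normsq f \<le> x * W" "A12_normsq g \<le> y * W"
  shows "A12_normsq h \<le> (2 * (x + y)) * W"
proof -
  have "A12_normsq h \<le> 2 * (A12_normsq f + A12_normsq g)"
    by (rule A12_normsq_add_le[OF assms(1-3)])
  also have "\<dots> \<le> 2 * (x * W + y * W)" by (rule mult_left_mono[OF add_mono[OF assms(4,5)]]) simp
  also have "\<dots> = (2 * (x + y)) * W" by (simp only: distrib_right mult.assoc)
  finally show ?thesis .
qed

text \<open>The combination is formed at the level of H^2, where bounded multipliers cost nothing,
  and only then differentiated. One factor 2 comes from the sum, the other from the norm of
  differentiation.\<close>

lemma A12_normsq_deriv_le_bound:
  assumes "f holomorphic_on unit_disc" "g holomorphic_on unit_disc" "h holomorphic_on unit_disc"
    "\<And>z. z \<in> unit_disc \<Longrightarrow> cmod (h z) \<le> cmod (f z) + cmod (g z)"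
    "H2_normsq f + H2_normsq g \<le> W"
  shows "A12_normsq (deriv h) \<le> 4 * W"
proof -
  have "A12_normsq (deriv h) \<le> 2 * H2_normsq h" by (rule A12_normsq_deriv_le[OF assms(3)])
  also have "\<dots> \<le> 2 * (2 * (H2_normsq f + H2_normsq g))"
    by (rule mult_left_mono[OF H2_normsq_add_le[OF assms(1,2,4)]]) auto
  also have "\<dots> \<le> 2 * (2 * W)" by (intro mult_left_mono assms) auto
  also have "\<dots> = 4 * W" by (simp only: mult.assoc[symmetric]) simp
  finally show ?thesis .
qed

text \<open>The three terms of \<^const>\<open>pair_kernel\<close> are recovered from the images \<open>w\<^sub>j\<close> of the test functions
  under \<open>u C\<^sub>\<phi> - C\<^sub>\<psi>\<close> by two kinds of operations: multiplication by \<open>s = disc_aut a \<circ> \<phi>\<close> or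
  \<open>t = disc_aut a \<circ> \<psi>\<close>, which does not increase either norm, and differentiation.\<close>
lemma pair_kernel_integral_le:
  fixes u \<phi> \<psi> :: "complex \<Rightarrow> complex" and a :: complex
  assumes u: "u holomorphic_on unit_disc" and \<phi>: "self_map \<phi>" and \<psi>: "self_map \<psi>" and a: "a \<in> unit_disc"
  defines "w \<equiv> (\<lambda>j. wcomp u \<phi> (test_fun j a) - comp_op \<psi> (test_fun j a))"
  shows "(\<integral>\<^sup>+z. ennreal (pair_kernel (u z * deriv \<phi> z) (deriv \<psi> z) (\<phi> z) (\<psi> z) a * (2 * (1 - (cmod z)\<^sup>2)) / pi) * indicator unit_disc z \<partial>lborel)
     \<le> 192 * (H2_normsq (w 0) + H2_normsq (w 1) + H2_normsq (w 2))" (is "_ \<le> 192 * ?W")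
proof -
  define s where "s = (\<lambda>z. disc_aut a (\<phi> z))"
  define t where "t = (\<lambda>z. disc_aut a (\<psi> z))"
  define p where "p = (\<lambda>z. szego a (\<phi> z))"
  define q where "q = (\<lambda>z. szego a (\<psi> z))"
  let ?c = "complex_of_real (sqrt (1 - (cmod a)\<^sup>2))"
  have \<phi>h: "\<phi> holomorphic_on unit_disc" and \<phi>D: "\<And>z. z \<in> unit_disc \<Longrightarrow> \<phi> z \<in> unit_disc"
    and \<psi>h: "\<psi> holomorphic_on unit_disc" and \<psi>D: "\<And>z. z \<in> unit_disc \<Longrightarrow> \<psi> z \<in> unit_disc"
    using \<phi> \<psi> unfolding self_map_def by blast+
  have comp: "(\<lambda>z. g (\<phi> z)) holomorphic_on unit_disc" "(\<lambda>z. g (\<psi> z)) holomorphic_on unit_disc"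
    if "g holomorphic_on unit_disc" for g
    using \<phi>D \<psi>D holomorphic_on_compose_gen[OF \<phi>h that] holomorphic_on_compose_gen[OF \<psi>h that]
    by (auto simp: o_def image_subset_iff)
  have hol: "s holomorphic_on unit_disc" "t holomorphic_on unit_disc" "p holomorphic_on unit_disc" "q holomorphic_on unit_disc"
    unfolding s_def t_def p_def q_def by (intro comp holomorphic_disc_aut holomorphic_szego a)+
  have d\<phi>: "deriv \<phi> holomorphic_on unit_disc" and d\<psi>: "deriv \<psi> holomorphic_on unit_disc"
    using \<phi>h \<psi>h by (auto intro!: holomorphic_deriv)
  have D: "(f has_field_derivative deriv f z) (at z)" if "f holomorphic_on unit_disc" "z \<in> unit_disc" for f z
    using that holomorphic_derivI[OF that(1) open_ball that(2)] by simp
  have ds: "(s has_field_derivative (p z)\<^sup>2 * deriv \<phi> z) (at z)" and dt: "(t has_field_derivative (q z)\<^sup>2 * deriv \<psi> z) (at z)"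
    if z: "z \<in> unit_disc" for z
    unfolding s_def t_def p_def q_def
    by (rule DERIV_chain2[OF DERIV_disc_aut[OF a \<phi>D[OF z]] D[OF \<phi>h z]] DERIV_chain2[OF DERIV_disc_aut[OF a \<psi>D[OF z]] D[OF \<psi>h z]])+
  have s1: "cmod (s z) \<le> 1" and t1: "cmod (t z) \<le> 1" if "z \<in> unit_disc" for z
    unfolding s_def t_def using that by (auto intro!: disc_aut_bound a \<phi>D \<psi>D)
  have w_eq: "w j z = u z * (s z ^ j * p z) - t z ^ j * q z" for j z
    by (simp add: w_def wcomp_def comp_op_def test_fun_def s_def t_def p_def q_def)
  have wh: "w j holomorphic_on unit_disc" for j
    unfolding w_eq[abs_def] by (intro holomorphic_intros hol u)
  have W: "H2_normsq (w 0) + H2_normsq (w 1) \<le> ?W" "H2_normsq (w 1) + H2_normsq (w 2) \<le> ?W"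
    by (simp_all add: add.assoc add_increasing)
  have sub: "cmod (b * x - y) \<le> cmod x + cmod y" "cmod (x + b * y) \<le> cmod x + cmod y" if "cmod b \<le> 1" for b x y
  proof -
    have "cmod (b * x) \<le> cmod x" "cmod (b * y) \<le> cmod y"
      using that by (simp_all add: norm_mult mult_left_le_one_le)
    then show "cmod (b * x - y) \<le> cmod x + cmod y" "cmod (x + b * y) \<le> cmod x + cmod y"
      using norm_triangle_ineq4[of "b * x" y] norm_triangle_ineq[of x "b * y"] by linarith+
  qed
  \<comment> \<open>In s w_0 - w_1 and s w_1 - w_2 the terms with \<open>\<phi>\<close> cancel,
    which leaves \<open>y0\<close> and \<open>y1\<close>. Multiplying by t instead cancels the terms
    with \<open>\<psi>\<close> and gives \<open>x0\<close> and \<open>x1\<close> up to sign.\<close>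
  define y0 where "y0 = (\<lambda>z. (t z - s z) * q z)"
  define y1 where "y1 = (\<lambda>z. t z * y0 z)"
  define x0 where "x0 = (\<lambda>z. (s z - t z) * (u z * p z))"
  define x1 where "x1 = (\<lambda>z. s z * x0 z)"
  \<comment> \<open>\<open>Q\<close> is sqrt(1 - |a|^2) q^2 in disguise; \<open>v0\<close> and
    \<open>v1\<close> are w_0 + cnj a * w_1 and w_1 + cnj a * w_2.\<close>
  define Q where "Q = (\<lambda>z. q z * (1 + cnj a * t z))"
  define v0 where "v0 = (\<lambda>z. u z * p z * (1 + cnj a * s z) - Q z)"
  define v1 where "v1 = (\<lambda>z. s z * v0 z + (s z - t z) * Q z)"
  have h: "y0 holomorphic_on unit_disc" "y1 holomorphic_on unit_disc" "x0 holomorphic_on unit_disc" "x1 holomorphic_on unit_disc"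
    "Q holomorphic_on unit_disc" "v0 holomorphic_on unit_disc" "v1 holomorphic_on unit_disc"
    unfolding y1_def y0_def x1_def x0_def v1_def v0_def Q_def by (intro holomorphic_intros hol u)+
  have y0w: "y0 z = s z * w 0 z - w 1 z" for z by (simp add: y0_def w_eq algebra_simps)
  have y1w: "y1 z = s z * w 1 z - w 2 z" for z by (simp add: y1_def y0_def w_eq algebra_simps power2_eq_square)
  have x0w: "x0 z = - (t z * w 0 z - w 1 z)" for z by (simp add: x0_def w_eq algebra_simps)
  have x1w: "x1 z = - (t z * w 1 z - w 2 z)" for z by (simp add: x1_def x0_def w_eq algebra_simps power2_eq_square)
  have v0w: "v0 z = w 0 z + cnj a * w 1 z" for z by (simp add: v0_def Q_def w_eq algebra_simps)
  have v1w: "v1 z = w 1 z + cnj a * w 2 z" for z by (simp add: v1_def v0_def Q_def w_eq algebra_simps power2_eq_square)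
  have a1: "cmod (cnj a) \<le> 1" using a by simp
  have A: "A12_normsq (deriv y0) \<le> 4 * ?W" "A12_normsq (deriv y1) \<le> 4 * ?W"
      "A12_normsq (deriv x0) \<le> 4 * ?W" "A12_normsq (deriv x1) \<le> 4 * ?W"
      "A12_normsq (deriv v0) \<le> 4 * ?W" "A12_normsq (deriv v1) \<le> 4 * ?W"
    by (rule A12_normsq_deriv_le_bound[OF wh wh _ _ W(1)] A12_normsq_deriv_le_bound[OF wh wh _ _ W(2)];
        simp only: h y0w y1w x0w x1w v0w v1w norm_minus_cancel; intro sub s1 t1 a1; assumption)+
  define g2 where "g2 = (\<lambda>z. (s z - t z) * (u z * deriv \<phi> z * p z ^ 3))"
  define g3 where "g3 = (\<lambda>z. (s z - t z) * (deriv \<psi> z * q z ^ 3))"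
  define g1 where "g1 = (\<lambda>z. ?c * (u z * deriv \<phi> z * p z ^ 4 - deriv \<psi> z * q z ^ 4))"
  define h1 where "h1 = (\<lambda>z. deriv v1 z - s z * deriv v0 z)"
  define h2 where "h2 = (\<lambda>z. 2 * cnj a * g3 z)"
  have gh: "g1 holomorphic_on unit_disc" "g2 holomorphic_on unit_disc" "g3 holomorphic_on unit_disc"
    "h1 holomorphic_on unit_disc" "h2 holomorphic_on unit_disc"
    unfolding g1_def h2_def g2_def g3_def h1_def by (intro holomorphic_intros hol u d\<phi> d\<psi> h open_ball)+
  have g3: "A12_normsq g3 \<le> (2 * (4 + 4)) * ?W"
  proof (rule A12_normsq_add_le_bound[OF _ _ _ A(1) A(2)])
    fix z assume z: "z \<in> unit_disc"
    \<comment> \<open>As y1 = t y0, subtracting t y0' from y1' leaves t' y0 alone, so the derivative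
      of the weight in y0 disappears. The estimate of \<open>g2\<close> removes u' in the same
      way.\<close>
    have "(y1 has_field_derivative (q z)\<^sup>2 * deriv \<psi> z * y0 z + deriv y0 z * t z) (at z)"
      unfolding y1_def by (rule DERIV_mult[OF dt[OF z] D[OF h(1) z]])
    then have "deriv y1 z = (q z)\<^sup>2 * deriv \<psi> z * y0 z + deriv y0 z * t z" by (rule DERIV_imp_deriv)
    then have "g3 z = t z * deriv y0 z - deriv y1 z"
      by (simp add: g3_def y0_def power2_eq_square power3_eq_cube algebra_simps)
    then show "cmod (g3 z) \<le> cmod (deriv y0 z) + cmod (deriv y1 z)" using sub(1)[OF t1[OF z]] by simp
  qed (auto intro!: holomorphic_deriv h)
  have g2: "A12_normsq g2 \<le> (2 * (4 + 4)) * ?W"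
  proof (rule A12_normsq_add_le_bound[OF _ _ _ A(3) A(4)])
    fix z assume z: "z \<in> unit_disc"
    have "(x1 has_field_derivative (p z)\<^sup>2 * deriv \<phi> z * x0 z + deriv x0 z * s z) (at z)"
      unfolding x1_def by (rule DERIV_mult[OF ds[OF z] D[OF h(3) z]])
    then have "deriv x1 z = (p z)\<^sup>2 * deriv \<phi> z * x0 z + deriv x0 z * s z" by (rule DERIV_imp_deriv)
    then have "g2 z = - (s z * deriv x0 z - deriv x1 z)"
      by (simp add: g2_def x0_def power2_eq_square power3_eq_cube algebra_simps)
    then show "cmod (g2 z) \<le> cmod (deriv x0 z) + cmod (deriv x1 z)" using sub(1)[OF s1[OF z]] by (simp only: norm_minus_cancel)
  qed (auto intro!: holomorphic_deriv h)
  have h1b: "A12_normsq h1 \<le> (2 * (4 + 4)) * ?W"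
  proof (rule A12_normsq_add_le_bound[OF _ _ _ A(5) A(6)])
    fix z assume z: "z \<in> unit_disc"
    have "h1 z = - (s z * deriv v0 z - deriv v1 z)" by (simp add: h1_def)
    then show "cmod (h1 z) \<le> cmod (deriv v0 z) + cmod (deriv v1 z)" using sub(1)[OF s1[OF z]] by (simp only: norm_minus_cancel)
  qed (auto intro!: holomorphic_deriv h)
  have h2b: "A12_normsq h2 \<le> (2 * (2 * (4 + 4) + 2 * (4 + 4))) * ?W"
  proof (rule A12_normsq_add_le_bound[OF gh(3) gh(3) _ g3 g3])
    fix z assume z: "z \<in> unit_disc"
    have "cmod (h2 z) = cmod a * (2 * cmod (g3 z))" by (simp add: h2_def norm_mult)
    also have "\<dots> \<le> 1 * (2 * cmod (g3 z))" using a by (intro mult_right_mono) auto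
    finally show "cmod (h2 z) \<le> cmod (g3 z) + cmod (g3 z)" by simp
  qed
  have g1: "A12_normsq g1 \<le> (2 * (2 * (4 + 4) + 2 * (2 * (4 + 4) + 2 * (4 + 4)))) * ?W"
  proof (rule A12_normsq_add_le_bound[OF gh(4) gh(5) _ h1b h2b])
    fix z assume z: "z \<in> unit_disc"
    have dQ: "(Q has_field_derivative 2 * cnj a * q z ^ 3 * deriv \<psi> z) (at z)"
      unfolding Q_def q_def t_def
      by (rule DERIV_chain2[OF DERIV_szego_combination[OF a \<psi>D[OF z]] D[OF \<psi>h z]])
    have "(v1 has_field_derivative ((p z)\<^sup>2 * deriv \<phi> z * v0 z + deriv v0 z * s z) +
        (((p z)\<^sup>2 * deriv \<phi> z - (q z)\<^sup>2 * deriv \<psi> z) * Q z + 2 * cnj a * q z ^ 3 * deriv \<psi> z * (s z - t z))) (at z)"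
      unfolding v1_def
      by (intro DERIV_add DERIV_mult DERIV_diff ds[OF z] dt[OF z] D[OF h(6) z] dQ)
    then have dv1: "deriv v1 z = ((p z)\<^sup>2 * deriv \<phi> z * v0 z + deriv v0 z * s z) +
        (((p z)\<^sup>2 * deriv \<phi> z - (q z)\<^sup>2 * deriv \<psi> z) * Q z + 2 * cnj a * q z ^ 3 * deriv \<psi> z * (s z - t z))"
      by (rule DERIV_imp_deriv)
    have c: "1 + cnj a * s z = ?c * p z" "1 + cnj a * t z = ?c * q z"
      unfolding s_def t_def p_def q_def by (intro one_plus_disc_aut a \<phi>D \<psi>D z)+
    have v0': "v0 z = u z * p z * (?c * p z) - Q z" and Q': "Q z = q z * (?c * q z)"
      unfolding v0_def Q_def c by (rule refl)+
    \<comment> \<open>v1' - s v0' equals s' (v0 + Q) - t' Q + (s - t) Q'. Since v0 + Q is sqrt(1 -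
      |a|^2) u p^2, the first two terms form \<open>g1\<close>; the last one is 2 cnj a times
      \<open>g3\<close>, hence already under control.\<close>
    have "g1 z = h1 z - h2 z"
      unfolding h1_def h2_def g3_def g1_def dv1 v0' unfolding Q'
      by (simp add: power2_eq_square power3_eq_cube power4_eq_xxxx algebra_simps)
    then show "cmod (g1 z) \<le> cmod (h1 z) + cmod (h2 z)" by (simp add: norm_triangle_ineq4)
  qed
  let ?v = "\<lambda>f z. ennreal ((cmod (f z))\<^sup>2 * (2 * (1 - (cmod z)\<^sup>2)) / pi) * indicator unit_disc z"
  have [measurable]: "?v g1 \<in> borel_measurable borel" "?v g2 \<in> borel_measurable borel" "?v g3 \<in> borel_measurable borel"
    by (intro borel_measurable_ennreal_indicator A12_weight_continuous gh open_ball)+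
  have "(\<integral>\<^sup>+z. ennreal (pair_kernel (u z * deriv \<phi> z) (deriv \<psi> z) (\<phi> z) (\<psi> z) a * (2 * (1 - (cmod z)\<^sup>2)) / pi) * indicator unit_disc z \<partial>lborel)
     = (\<integral>\<^sup>+z. ?v g1 z + (?v g2 z + ?v g3 z) \<partial>lborel)"
  proof (rule nn_integral_cong)
    fix z :: complex
    show "ennreal (pair_kernel (u z * deriv \<phi> z) (deriv \<psi> z) (\<phi> z) (\<psi> z) a * (2 * (1 - (cmod z)\<^sup>2)) / pi) * indicator unit_disc z
       = ?v g1 z + (?v g2 z + ?v g3 z)"
    proof (cases "z \<in> unit_disc")
      case True
      then have k: "0 \<le> 2 * (1 - (cmod z)\<^sup>2)" by (simp add: abs_square_le_1)
      have "0 \<le> 1 - (cmod a)\<^sup>2" using a by (simp add: abs_square_le_1)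
      then have "pair_kernel (u z * deriv \<phi> z) (deriv \<psi> z) (\<phi> z) (\<psi> z) a = (cmod (g1 z))\<^sup>2 + ((cmod (g2 z))\<^sup>2 + (cmod (g3 z))\<^sup>2)"
        unfolding pair_kernel_def g1_def g2_def g3_def s_def t_def p_def q_def
        by (simp add: norm_mult power_mult_distrib distrib_left)
      then have "pair_kernel (u z * deriv \<phi> z) (deriv \<psi> z) (\<phi> z) (\<psi> z) a * (2 * (1 - (cmod z)\<^sup>2)) / pi
         = (cmod (g1 z))\<^sup>2 * (2 * (1 - (cmod z)\<^sup>2)) / pi + ((cmod (g2 z))\<^sup>2 * (2 * (1 - (cmod z)\<^sup>2)) / pi + (cmod (g3 z))\<^sup>2 * (2 * (1 - (cmod z)\<^sup>2)) / pi)"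
        by (simp only: distrib_right add_divide_distrib)
      then show ?thesis using True k by (simp add: ennreal_plus[symmetric] del: ennreal_plus)
    qed simp
  qed
  also have "\<dots> = A12_normsq g1 + (A12_normsq g2 + A12_normsq g3)"
    unfolding A12_normsq_def by (subst nn_integral_add, measurable, subst nn_integral_add, measurable)
  \<comment> \<open>The coefficients are 16 for \<open>g2\<close>, \<open>g3\<close> and
    \<open>h1\<close>, 64 for \<open>h2\<close>, hence 2 (16 + 64) = 160 for \<open>g1\<close> and
    192 in total.\<close>
  also have "\<dots> \<le> (2 * (2 * (4 + 4) + 2 * (2 * (4 + 4) + 2 * (4 + 4)))) * ?W + ((2 * (4 + 4)) * ?W + (2 * (4 + 4)) * ?W)"
    by (intro add_mono g1 g2 g3)
  also have "\<dots> = 192 * ?W" by (simp only: distrib_right[symmetric]) simp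
  finally show ?thesis .
qed

text \<open>Turns the sequential \<open>compact_op_null\<close> into a bound uniform on a ring near
  the unit circle: failure for every ring would give test functions with |a n| tending to 1, which
  converge pointwise to 0.\<close>

lemma compact_op_test_fun_small:
  assumes T: "compact_op (disc_mem H2_normsq) (disc_nrm H2_normsq) (disc_mem H2_normsq) (disc_nrm H2_normsq) T"
    and pt: "\<And>fs z. \<lbrakk>\<And>x. x \<in> unit_disc \<Longrightarrow> (\<lambda>n. fs n x) \<longlonglongrightarrow> 0; z \<in> unit_disc\<rbrakk> \<Longrightarrow> (\<lambda>n. T (fs n) z) \<longlonglongrightarrow> 0"
    and e: "0 < e"
  shows "\<exists>r<1. \<forall>a\<in>unit_disc. r < cmod a \<longrightarrow> H2_normsq (T (test_fun j a)) \<le> ennreal e"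
proof (rule ccontr)
  assume *: "\<not> ?thesis"
  have "\<exists>a. a \<in> unit_disc \<and> 1 - 1 / real (Suc n) < cmod a \<and> \<not> H2_normsq (T (test_fun j a)) \<le> ennreal e" for n
  proof (rule ccontr)
    assume "\<nexists>a. a \<in> unit_disc \<and> 1 - 1 / real (Suc n) < cmod a \<and> \<not> H2_normsq (T (test_fun j a)) \<le> ennreal e"
    then have "1 - 1 / real (Suc n) < 1 \<and> (\<forall>a\<in>unit_disc. 1 - 1 / real (Suc n) < cmod a \<longrightarrow> H2_normsq (T (test_fun j a)) \<le> ennreal e)"
      by auto
    then show False using * by blast
  qed
  then have "\<exists>a. \<forall>n. a n \<in> unit_disc \<and> 1 - 1 / real (Suc n) < cmod (a n) \<and> \<not> H2_normsq (T (test_fun j (a n))) \<le> ennreal e"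
    by (intro choice allI)
  then obtain a where a: "\<And>n. a n \<in> unit_disc" "\<And>n. 1 - 1 / real (Suc n) < cmod (a n)"
      "\<And>n. \<not> H2_normsq (T (test_fun j (a n))) \<le> ennreal e"
    by blast
  have lim: "(\<lambda>n. cmod (a n)) \<longlonglongrightarrow> 1"
  proof (rule tendsto_sandwich)
    show "(\<lambda>n. 1 - 1 / real (Suc n)) \<longlonglongrightarrow> 1"
      using tendsto_diff[OF tendsto_const[of 1] LIMSEQ_inverse_real_of_nat] by (simp add: inverse_eq_divide)
    show "\<forall>\<^sub>F n in sequentially. 1 - 1 / real (Suc n) \<le> cmod (a n)"
      using a(2) by (intro always_eventually allI less_imp_le)
    show "\<forall>\<^sub>F n in sequentially. cmod (a n) \<le> 1"
      using a(1) by (intro always_eventually allI) (simp add: less_imp_le)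
  qed (rule tendsto_const)
  have "(\<lambda>n. H2_normsq (T (test_fun j (a n)))) \<longlonglongrightarrow> 0"
  proof (rule compact_op_null[OF disc_normsq_H2 disc_normsq_H2 T])
    show "disc_mem H2_normsq (test_fun j (a n))" for n by (rule disc_mem_test_fun[OF a(1)])
    show "H2_normsq (test_fun j (a n)) \<le> ennreal 1" for n using H2_normsq_test_fun[OF a(1)] by simp
    show "(\<lambda>n. T (test_fun j (a n)) z) \<longlonglongrightarrow> 0" if "z \<in> unit_disc" for z
      by (rule pt[OF test_fun_tendsto_0[OF a(1) lim] that])
  qed
  from ennreal_tendsto_0D[OF this e] obtain n where "H2_normsq (T (test_fun j (a n))) \<le> ennreal e"
    by (auto simp: eventually_sequentially)
  then show False using a(3) by blast
qed

section \<open>From vanishing kernel mass at the boundary to null sequences\<close>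

lemma ennreal_tendsto_0_le:
  fixes F G :: "nat \<Rightarrow> ennreal"
  assumes "G \<longlonglongrightarrow> 0" "\<And>n. F n \<le> G n"
  shows "F \<longlonglongrightarrow> 0"
  by (rule tendsto_sandwich[OF _ _ tendsto_const assms(1)]) (simp_all add: assms(2))

lemma A12_normsq_one: "A12_normsq (\<lambda>_. 1) < \<infinity>"
proof -
  have "A12_normsq (\<lambda>_. 1) = ennreal 1 * (\<integral>\<^sup>+z. ennreal (2 * (1 - (cmod z)\<^sup>2) / pi) * indicator unit_disc z \<partial>lborel)"
    by (simp add: A12_normsq_def)
  then show ?thesis using disc_moment[of 0] by simp
qed

text \<open>Near the unit circle \<open>K\<close> is small and the mass of the functions is bounded;
  on the remaining compact disc \<open>K\<close> is bounded and the functions tend to 0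
  uniformly.\<close>

lemma vanishing_mass_null:
  fixes K :: "complex \<Rightarrow> ennreal" and S :: "(complex \<Rightarrow> complex) \<Rightarrow> complex \<Rightarrow> complex"
  assumes S: "\<And>h. h holomorphic_on unit_disc \<Longrightarrow> A12_normsq (S h) \<le> ennreal C *
      (\<integral>\<^sup>+a. ennreal ((cmod (h a))\<^sup>2 * (2 * (1 - (cmod a)\<^sup>2)) / pi) * indicator unit_disc a * K a \<partial>lborel)"
    and C: "0 \<le> C" and D: "0 \<le> D" and KD: "\<And>a. a \<in> unit_disc \<Longrightarrow> K a \<le> ennreal D"
    and Ke: "\<And>e. 0 < e \<Longrightarrow> \<exists>r<1. \<forall>a\<in>unit_disc. r < cmod a \<longrightarrow> K a \<le> ennreal e"
    and fs: "\<And>n. fs n holomorphic_on unit_disc" "\<And>n. A12_normsq (fs n) \<le> ennreal B" "locally_null fs"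
  shows "(\<lambda>n. A12_normsq (S (fs n))) \<longlonglongrightarrow> 0"
proof (rule ennreal_tendsto_0I)
  fix e :: real assume e: "0 < e"
  obtain b where b: "A12_normsq (\<lambda>_. 1) = ennreal b" "0 \<le> b"
    using A12_normsq_one by (cases "A12_normsq (\<lambda>_. 1)") auto
  let ?B = "max B 0"
  have fsB: "A12_normsq (fs n) \<le> ennreal ?B" for n
    by (rule order_trans[OF fs(2) ennreal_leI]) simp
  \<comment> \<open>\<open>\<epsilon>\<close> serves the outer ring and \<open>\<delta>\<close> the
    inner disc, each contributing at most e/2; the summand 1 keeps the denominators positive when
    the products vanish.\<close>
  define \<epsilon> where "\<epsilon> = e / (2 * (C * ?B + 1))"
  define \<delta> where "\<delta> = e / (2 * (C * D * b + 1))"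
  have den: "0 < C * ?B + 1" "0 < C * D * b + 1" using C D b(2) by (auto intro!: add_nonneg_pos)
  have \<epsilon>: "0 < \<epsilon>" and \<delta>: "0 < \<delta>" unfolding \<epsilon>_def \<delta>_def using e den by auto
  obtain r where r: "r < 1" "\<And>a. a \<in> unit_disc \<Longrightarrow> r < cmod a \<Longrightarrow> K a \<le> ennreal \<epsilon>"
    using Ke[OF \<epsilon>] by blast
  have "uniform_limit (cball 0 r) fs (\<lambda>_. 0) sequentially" using fs(3) r(1) unfolding locally_null_def by blast
  then have "\<forall>\<^sub>F n in sequentially. \<forall>x\<in>cball 0 r. dist (fs n x) 0 < sqrt \<delta>"
    by (rule uniform_limitD) (use \<delta> in simp)
  then show "\<forall>\<^sub>F n in sequentially. A12_normsq (S (fs n)) \<le> ennreal e"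
  proof (rule eventually_mono)
    fix n assume small: "\<forall>x\<in>cball 0 r. dist (fs n x) 0 < sqrt \<delta>"
    let ?w = "\<lambda>h a. ennreal ((cmod (h a))\<^sup>2 * (2 * (1 - (cmod a)\<^sup>2)) / pi) * indicator unit_disc a"
    have [measurable]: "?w (fs n) \<in> borel_measurable borel" "?w (\<lambda>_. 1) \<in> borel_measurable borel"
      by (intro borel_measurable_ennreal_indicator A12_weight_continuous fs(1) open_ball holomorphic_on_const)+
    have pt: "?w (fs n) a * K a \<le> ennreal \<epsilon> * ?w (fs n) a + ennreal (D * \<delta>) * ?w (\<lambda>_. 1) a" for a
    proof (cases "a \<in> unit_disc")
      case True
      then have k: "0 \<le> 2 * (1 - (cmod a)\<^sup>2)" by (simp add: abs_square_le_1)
      show ?thesis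
      proof (cases "r < cmod a")
        case far: True
        have "?w (fs n) a * K a \<le> ?w (fs n) a * ennreal \<epsilon>" by (intro mult_left_mono r(2)[OF True far]) simp
        then show ?thesis by (simp add: mult.commute add_increasing2)
      next
        case False
        then have "cmod (fs n a) < sqrt \<delta>" using small by auto
        then have "(cmod (fs n a))\<^sup>2 \<le> (sqrt \<delta>)\<^sup>2" by (intro power_mono) auto
        then have f: "(cmod (fs n a))\<^sup>2 \<le> \<delta>" using \<delta> by simp
        have "?w (fs n) a * K a \<le> ennreal (\<delta> * (2 * (1 - (cmod a)\<^sup>2)) / pi) * ennreal D"
          using True k f
          by (intro mult_mono KD) (auto intro!: ennreal_leI divide_right_mono mult_right_mono)
        also have "\<dots> = ennreal (D * \<delta>) * ?w (\<lambda>_. 1) a"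
          using True k D \<delta> by (simp add: ennreal_mult'[symmetric] ennreal_mult''[symmetric] mult_ac)
        finally show ?thesis by (simp add: add_increasing)
      qed
    qed simp
    have "A12_normsq (S (fs n)) \<le> ennreal C * (\<integral>\<^sup>+a. ?w (fs n) a * K a \<partial>lborel)" by (rule S[OF fs(1)])
    also have "\<dots> \<le> ennreal C * (\<integral>\<^sup>+a. ennreal \<epsilon> * ?w (fs n) a + ennreal (D * \<delta>) * ?w (\<lambda>_. 1) a \<partial>lborel)"
      by (intro mult_left_mono nn_integral_mono pt) simp
    also have "(\<integral>\<^sup>+a. ennreal \<epsilon> * ?w (fs n) a + ennreal (D * \<delta>) * ?w (\<lambda>_. 1) a \<partial>lborel)
       = (\<integral>\<^sup>+a. ennreal \<epsilon> * ?w (fs n) a \<partial>lborel) + (\<integral>\<^sup>+a. ennreal (D * \<delta>) * ?w (\<lambda>_. 1) a \<partial>lborel)"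
      by (rule nn_integral_add) measurable
    also have "(\<integral>\<^sup>+a. ennreal \<epsilon> * ?w (fs n) a \<partial>lborel) = ennreal \<epsilon> * A12_normsq (fs n)"
      unfolding A12_normsq_def by (rule nn_integral_cmult) measurable
    also have "(\<integral>\<^sup>+a. ennreal (D * \<delta>) * ?w (\<lambda>_. 1) a \<partial>lborel) = ennreal (D * \<delta>) * A12_normsq (\<lambda>_. 1)"
      unfolding A12_normsq_def by (rule nn_integral_cmult) measurable
    also have "ennreal C * (ennreal \<epsilon> * A12_normsq (fs n) + ennreal (D * \<delta>) * A12_normsq (\<lambda>_. 1))
       \<le> ennreal C * (ennreal \<epsilon> * ennreal ?B + ennreal (D * \<delta>) * ennreal b)"
      unfolding b(1) by (intro mult_left_mono add_mono fsB) auto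
    also have "\<dots> = ennreal (C * (\<epsilon> * ?B + D * \<delta> * b))"
    proof -
      have "0 \<le> \<epsilon> * ?B" "0 \<le> D * \<delta> * b" using \<epsilon> \<delta> D b(2) by auto
      moreover have "0 \<le> \<epsilon> * ?B + D * \<delta> * b" using calculation by simp
      ultimately show ?thesis
        using \<epsilon> \<delta> D b(2) C by (simp only: ennreal_mult'[symmetric] ennreal_plus[symmetric] ennreal_mult[symmetric] less_imp_le mult_nonneg_nonneg)
    qed
    also have "\<dots> \<le> ennreal e"
    proof (rule ennreal_leI)
      have half: "e / (2 * x) * x = e / 2" if "0 < x" for x using that by simp
      have "\<epsilon> * (C * ?B) \<le> \<epsilon> * (C * ?B + 1)" using \<epsilon> by (intro mult_left_mono) auto
      also have "\<dots> = e / 2" unfolding \<epsilon>_def by (rule half[OF den(1)])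
      finally have 1: "\<epsilon> * (C * ?B) \<le> e / 2" .
      have "\<delta> * (C * D * b) \<le> \<delta> * (C * D * b + 1)" using \<delta> by (intro mult_left_mono) auto
      also have "\<dots> = e / 2" unfolding \<delta>_def by (rule half[OF den(2)])
      finally have 2: "\<delta> * (C * D * b) \<le> e / 2" .
      have "C * (\<epsilon> * ?B + D * \<delta> * b) = \<epsilon> * (C * ?B) + \<delta> * (C * D * b)" by (simp only: distrib_left mult_ac)
      then show "C * (\<epsilon> * ?B + D * \<delta> * b) \<le> e" using 1 2 by linarith
    qed
    finally show "A12_normsq (S (fs n)) \<le> ennreal e" .
  qed
qed

text \<open>\<open>pair_estimate\<close> is applied at each z to the points \<phi> z and \<psi> z
  and integrated against dA_1. Exchanging the integrals turns the average in \<open>a\<close> into a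
  weight on |h a|^2, namely the mass estimated in \<open>pair_kernel_integral_le\<close>.\<close>

lemma A12_normsq_weighted_difference_le:
  fixes u \<phi> \<psi> h :: "complex \<Rightarrow> complex"
  assumes u: "u holomorphic_on unit_disc" and \<phi>: "self_map \<phi>" and \<psi>: "self_map \<psi>" and h: "h holomorphic_on unit_disc"
  shows "A12_normsq (wcomp (\<lambda>z. u z * deriv \<phi> z) \<phi> h - wcomp (deriv \<psi>) \<psi> h) \<le> ennreal (4096 * 84000000) *
     (\<integral>\<^sup>+a. ennreal ((cmod (h a))\<^sup>2 * (2 * (1 - (cmod a)\<^sup>2)) / pi) * indicator unit_disc a *
       (\<integral>\<^sup>+z. ennreal (pair_kernel (u z * deriv \<phi> z) (deriv \<psi> z) (\<phi> z) (\<psi> z) a * (2 * (1 - (cmod z)\<^sup>2)) / pi) * indicator unit_disc z \<partial>lborel) \<partial>lborel)"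
proof -
  let ?C = "ennreal (4096 * 84000000)"
  let ?Sh = "wcomp (\<lambda>z. u z * deriv \<phi> z) \<phi> h - wcomp (deriv \<psi>) \<psi> h"
  define G where "G = (\<lambda>z a. pair_kernel (u z * deriv \<phi> z) (deriv \<psi> z) (\<phi> z) (\<psi> z) a)"
  define w where "w = (\<lambda>z::complex. 2 * (1 - (cmod z)\<^sup>2) / pi)"
  have w0: "0 \<le> w z" if "z \<in> unit_disc" for z using that by (simp add: w_def abs_square_le_1)
  have \<phi>h: "\<phi> holomorphic_on unit_disc" and \<phi>D: "\<And>z. z \<in> unit_disc \<Longrightarrow> \<phi> z \<in> unit_disc"
    and \<psi>h: "\<psi> holomorphic_on unit_disc" and \<psi>D: "\<And>z. z \<in> unit_disc \<Longrightarrow> \<psi> z \<in> unit_disc"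
    using \<phi> \<psi> unfolding self_map_def by blast+
  have cont: "continuous_on unit_disc u" "continuous_on unit_disc h" "continuous_on unit_disc \<phi>" "continuous_on unit_disc \<psi>"
    "continuous_on unit_disc (deriv \<phi>)" "continuous_on unit_disc (deriv \<psi>)"
    using u h \<phi>h \<psi>h by (auto intro!: holomorphic_on_imp_continuous_on holomorphic_deriv)
  \<comment> \<open>The integrand in both variables: its continuity on the product of the discs
    yields the joint measurability needed to exchange the integrals.\<close>
  define F where "F = (\<lambda>x. (cmod (h (snd x)))\<^sup>2 * w (snd x) * (G (fst x) (snd x) * w (fst x)))"
  have c2: "continuous_on (unit_disc \<times> unit_disc) (\<lambda>x. k (fst x))" "continuous_on (unit_disc \<times> unit_disc) (\<lambda>x. k (snd x))"
    if "continuous_on unit_disc k" for k :: "complex \<Rightarrow> complex"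
    by (rule continuous_on_compose2[OF that]; auto intro!: continuous_intros)+
  have Fc: "continuous_on (unit_disc \<times> unit_disc) F"
    unfolding F_def G_def w_def
    by (intro continuous_intros continuous_on_pair_kernel c2 cont)
       (use \<phi>D \<psi>D in auto)
  define P where "P = (\<lambda>x. ennreal (F x) * indicator (unit_disc \<times> unit_disc) x)"
  have Pm: "P \<in> borel_measurable borel"
    unfolding P_def by (intro borel_measurable_ennreal_indicator Fc open_Times open_ball)
  have [measurable]: "(\<lambda>(z, a). P (z, a)) \<in> borel_measurable (lborel \<Otimes>\<^sub>M lborel)"
    using Pm by (simp add: lborel_prod)
  have Gc: "continuous_on unit_disc (G z)" if "z \<in> unit_disc" for z
    unfolding G_def using that \<phi>D \<psi>D by (intro continuous_on_pair_kernel continuous_intros) auto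
  have Gc': "continuous_on unit_disc (\<lambda>z. G z a)" if "a \<in> unit_disc" for a
    unfolding G_def using that \<phi>D \<psi>D by (intro continuous_on_pair_kernel continuous_intros cont) auto
  have wc: "continuous_on unit_disc w" unfolding w_def by (intro continuous_intros) auto
  have G0: "0 \<le> G z a" if "a \<in> unit_disc" for z a unfolding G_def by (rule pair_kernel_nonneg[OF that])
  have pt: "ennreal ((cmod (?Sh z))\<^sup>2 * (2 * (1 - (cmod z)\<^sup>2)) / pi) * indicator unit_disc z
     \<le> ?C * (\<integral>\<^sup>+a. P (z, a) \<partial>lborel)" for z
  proof (cases "z \<in> unit_disc")
    case True
    let ?I = "\<integral>\<^sup>+a. ennreal ((cmod (h a))\<^sup>2 * w a * G z a) * indicator unit_disc a \<partial>lborel"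
    have "ennreal ((cmod (?Sh z))\<^sup>2) \<le> ?C * ?I"
      using pair_estimate[OF h \<phi>D[OF True] \<psi>D[OF True], of "u z * deriv \<phi> z" "deriv \<psi> z"]
      by (simp add: G_def w_def wcomp_def)
    then have "ennreal ((cmod (?Sh z))\<^sup>2) * ennreal (w z) \<le> ?C * ?I * ennreal (w z)"
      by (rule mult_right_mono) simp
    also have "\<dots> = ?C * (?I * ennreal (w z))" by (rule mult.assoc)
    also have "?I * ennreal (w z) = (\<integral>\<^sup>+a. (ennreal ((cmod (h a))\<^sup>2 * w a * G z a) * indicator unit_disc a) * ennreal (w z) \<partial>lborel)"
      by (rule nn_integral_multc[symmetric], simp only: measurable_lborel2, rule borel_measurable_ennreal_indicator)
         (intro continuous_intros cont wc Gc[OF True] open_ball)+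
    also have "(\<integral>\<^sup>+a. (ennreal ((cmod (h a))\<^sup>2 * w a * G z a) * indicator unit_disc a) * ennreal (w z) \<partial>lborel)
       = (\<integral>\<^sup>+a. P (z, a) \<partial>lborel)"
    proof (rule nn_integral_cong)
      fix a :: complex
      show "(ennreal ((cmod (h a))\<^sup>2 * w a * G z a) * indicator unit_disc a) * ennreal (w z) = P (z, a)"
      proof (cases "a \<in> unit_disc")
        case a: True
        have "P (z, a) = ennreal (((cmod (h a))\<^sup>2 * w a * G z a) * w z)"
          using True a by (simp add: P_def F_def mult.assoc)
        also have "\<dots> = ennreal ((cmod (h a))\<^sup>2 * w a * G z a) * ennreal (w z)"
          by (rule ennreal_mult''[OF w0[OF True]])
        finally show ?thesis using a by simp
      qed (simp add: P_def)
    qed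
    finally have "ennreal ((cmod (?Sh z))\<^sup>2 * w z) \<le> ?C * (\<integral>\<^sup>+a. P (z, a) \<partial>lborel)"
      using w0[OF True] by (simp only: ennreal_mult'')
    then show ?thesis using True by (simp add: w_def)
  qed simp
  have "A12_normsq ?Sh \<le> (\<integral>\<^sup>+z. ?C * (\<integral>\<^sup>+a. P (z, a) \<partial>lborel) \<partial>lborel)"
    unfolding A12_normsq_def by (rule nn_integral_mono) (rule pt)
  also have "\<dots> = ?C * (\<integral>\<^sup>+z. (\<integral>\<^sup>+a. P (z, a) \<partial>lborel) \<partial>lborel)"
    by (rule nn_integral_cmult) measurable
  also have "(\<integral>\<^sup>+z. (\<integral>\<^sup>+a. P (z, a) \<partial>lborel) \<partial>lborel) = (\<integral>\<^sup>+a. (\<integral>\<^sup>+z. P (z, a) \<partial>lborel) \<partial>lborel)"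
    by (rule lborel_pair.Fubini') measurable
  also have "\<dots> = (\<integral>\<^sup>+a. ennreal ((cmod (h a))\<^sup>2 * (2 * (1 - (cmod a)\<^sup>2)) / pi) * indicator unit_disc a *
       (\<integral>\<^sup>+z. ennreal (pair_kernel (u z * deriv \<phi> z) (deriv \<psi> z) (\<phi> z) (\<psi> z) a * (2 * (1 - (cmod z)\<^sup>2)) / pi) * indicator unit_disc z \<partial>lborel) \<partial>lborel)"
  proof (rule nn_integral_cong)
    fix a :: complex
    have eq: "pair_kernel (u z * deriv \<phi> z) (deriv \<psi> z) (\<phi> z) (\<psi> z) a * (2 * (1 - (cmod z)\<^sup>2)) / pi = G z a * w z"
        "(cmod (h a))\<^sup>2 * (2 * (1 - (cmod a)\<^sup>2)) / pi = (cmod (h a))\<^sup>2 * w a" for z a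
      by (simp_all add: G_def w_def)
    show "(\<integral>\<^sup>+z. P (z, a) \<partial>lborel) = ennreal ((cmod (h a))\<^sup>2 * (2 * (1 - (cmod a)\<^sup>2)) / pi) * indicator unit_disc a *
       (\<integral>\<^sup>+z. ennreal (pair_kernel (u z * deriv \<phi> z) (deriv \<psi> z) (\<phi> z) (\<psi> z) a * (2 * (1 - (cmod z)\<^sup>2)) / pi) * indicator unit_disc z \<partial>lborel)"
      unfolding eq
    proof (cases "a \<in> unit_disc")
      case True
      have "(\<integral>\<^sup>+z. P (z, a) \<partial>lborel) = (\<integral>\<^sup>+z. ennreal ((cmod (h a))\<^sup>2 * w a) * (ennreal (G z a * w z) * indicator unit_disc z) \<partial>lborel)"
      proof (rule nn_integral_cong)
        fix z :: complex
        show "P (z, a) = ennreal ((cmod (h a))\<^sup>2 * w a) * (ennreal (G z a * w z) * indicator unit_disc z)"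
          using True w0[OF True] by (auto simp: P_def F_def ennreal_mult' split: split_indicator)
      qed
      also have "\<dots> = ennreal ((cmod (h a))\<^sup>2 * w a) * (\<integral>\<^sup>+z. ennreal (G z a * w z) * indicator unit_disc z \<partial>lborel)"
        by (rule nn_integral_cmult, simp only: measurable_lborel2, rule borel_measurable_ennreal_indicator)
           (intro continuous_intros wc Gc'[OF True] open_ball)+
      finally show "(\<integral>\<^sup>+z. P (z, a) \<partial>lborel) = ennreal ((cmod (h a))\<^sup>2 * w a) * indicator unit_disc a *
         (\<integral>\<^sup>+z. ennreal (G z a * w z) * indicator unit_disc z \<partial>lborel)"
        using True by simp
    qed (simp add: P_def)
  qed
  finally show ?thesis .
qed

text \<open>Cauchy's inequality on discs of radius d = (1 - r)/2, which stay within radius r + d <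
  1. The bound e d/2 on the functions leaves a strict inequality for the derivative.\<close>

lemma locally_null_deriv:
  assumes fs: "\<And>n. fs n holomorphic_on unit_disc" and null: "locally_null fs"
  shows "locally_null (\<lambda>n. deriv (fs n))"
  unfolding locally_null_def
proof (intro allI impI uniform_limitI)
  fix r e :: real assume r: "r < 1" and e: "0 < e"
  define d where "d = (1 - r) / 2"
  have d: "0 < d" "r + d < 1" using r by (simp_all add: d_def field_simps)
  have "uniform_limit (cball 0 (r + d)) fs (\<lambda>_. 0) sequentially"
    using null d(2) unfolding locally_null_def by blast
  then have "\<forall>\<^sub>F n in sequentially. \<forall>x\<in>cball 0 (r + d). dist (fs n x) 0 < e * d / 2"
    by (rule uniform_limitD) (use e d in simp)
  then show "\<forall>\<^sub>F n in sequentially. \<forall>x\<in>cball 0 r. dist (deriv (fs n) x) 0 < e"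
  proof (rule eventually_mono, intro ballI)
    fix n and x :: complex assume small: "\<forall>x\<in>cball 0 (r + d). dist (fs n x) 0 < e * d / 2" and x: "x \<in> cball 0 r"
    have sub: "cball x d \<subseteq> cball 0 (r + d)"
    proof
      fix y assume "y \<in> cball x d"
      then have "cmod (y - x) \<le> d" by (simp add: dist_norm norm_minus_commute)
      then show "y \<in> cball 0 (r + d)" using x norm_triangle_ineq[of x "y - x"] by simp
    qed
    have sub': "cball x d \<subseteq> unit_disc"
      using sub d(2) by (auto simp: subset_iff)
    have "cmod ((deriv ^^ 1) (fs n) x) \<le> fact 1 * (e * d / 2) / d ^ 1"
    proof (rule Cauchy_inequality)
      show "fs n holomorphic_on ball x d"
        by (rule holomorphic_on_subset[OF fs]) (use sub' in auto)
      show "continuous_on (cball x d) (fs n)"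
        by (rule continuous_on_subset[OF holomorphic_on_imp_continuous_on[OF fs] sub'])
      fix y assume "cmod (x - y) = d"
      then have "y \<in> cball 0 (r + d)" using sub by (auto simp: dist_norm)
      with small have "dist (fs n y) 0 < e * d / 2" by blast
      then show "cmod (fs n y) \<le> e * d / 2" by simp
    qed (use d in auto)
    also have "fact 1 * (e * d / 2) / d ^ 1 < e" using d e by simp
    finally show "dist (deriv (fs n) x) 0 < e" by simp
  qed
qed

lemma locally_null_pointwise:
  assumes "locally_null fs" "z \<in> unit_disc"
  shows "(\<lambda>n. fs n z) \<longlonglongrightarrow> 0"
proof -
  have "uniform_limit (cball 0 (cmod z)) fs (\<lambda>_. 0) sequentially"
    using assms unfolding locally_null_def by simp
  then show ?thesis by (rule tendsto_uniform_limitI) simp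
qed

theorem theorem1p4:
  fixes u \<phi> \<psi> :: "complex \<Rightarrow> complex"
  assumes "u holomorphic_on unit_disc" and "self_map \<phi>" and "self_map \<psi>"
  shows "compact_op in_H2 H2_norm in_H2 H2_norm (\<lambda>f. wcomp u \<phi> f - comp_op \<psi> f)
     \<longleftrightarrow> compact_op in_H2 H2_norm in_A12 A12_norm (wcomp (deriv u) \<phi>)
       \<and> compact_op in_A12 A12_norm in_A12 A12_norm
           (\<lambda>f. wcomp (\<lambda>z. u z * deriv \<phi> z) \<phi> f - wcomp (deriv \<psi>) \<psi> f)"
  unfolding in_H2_eq H2_norm_eq in_A12_eq A12_norm_eq
proof -
  note u = assms(1) and \<phi> = assms(2) and \<psi> = assms(3)
  note N2 = disc_normsq_H2 and NA = disc_normsq_A12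
  define T where "T = (\<lambda>f. wcomp u \<phi> f - comp_op \<psi> f)"
  define R where "R = wcomp (deriv u) \<phi>"
  define S where "S = (\<lambda>f. wcomp (\<lambda>z. u z * deriv \<phi> z) \<phi> f - wcomp (deriv \<psi>) \<psi> f)"
  have \<phi>h: "\<phi> holomorphic_on unit_disc" and \<phi>D: "\<And>z. z \<in> unit_disc \<Longrightarrow> \<phi> z \<in> unit_disc"
    and \<psi>h: "\<psi> holomorphic_on unit_disc" and \<psi>D: "\<And>z. z \<in> unit_disc \<Longrightarrow> \<psi> z \<in> unit_disc"
    using \<phi> \<psi> unfolding self_map_def by blast+
  have comp: "(\<lambda>z. g (\<phi> z)) holomorphic_on unit_disc" "(\<lambda>z. g (\<psi> z)) holomorphic_on unit_disc"
    if "g holomorphic_on unit_disc" for g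
    using \<phi>D \<psi>D holomorphic_on_compose_gen[OF \<phi>h that] holomorphic_on_compose_gen[OF \<psi>h that]
    by (auto simp: o_def image_subset_iff)
  have Th: "T f holomorphic_on unit_disc" and Rh: "R f holomorphic_on unit_disc" and Sh: "S f holomorphic_on unit_disc"
    if "f holomorphic_on unit_disc" for f
    unfolding T_def R_def S_def wcomp_def comp_op_def fun_diff_def
    using that u \<phi>h \<psi>h by (auto intro!: holomorphic_intros comp)
  have Td: "T (f - g) = T f - T g" and Rd: "R (f - g) = R f - R g" and Sd: "S (f - g) = S f - S g" for f g
    by (auto simp: T_def R_def S_def wcomp_def comp_op_def fun_eq_iff algebra_simps)
  have chain: "deriv (T f) z = R f z + S (deriv f) z" if f: "f holomorphic_on unit_disc" and z: "z \<in> unit_disc" for f z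
  proof -
    have D: "(g has_field_derivative deriv g x) (at x)" if "g holomorphic_on unit_disc" "x \<in> unit_disc" for g x
      using holomorphic_derivI[OF that(1) open_ball that(2)] by simp
    have "((\<lambda>z. u z * f (\<phi> z) - f (\<psi> z)) has_field_derivative
        (deriv u z * f (\<phi> z) + (deriv f (\<phi> z) * deriv \<phi> z) * u z) - deriv f (\<psi> z) * deriv \<psi> z) (at z)"
      by (intro DERIV_diff DERIV_mult D[OF u z] DERIV_chain2[OF D[OF f \<phi>D[OF z]] D[OF \<phi>h z]]
            DERIV_chain2[OF D[OF f \<psi>D[OF z]] D[OF \<psi>h z]])
    from DERIV_imp_deriv[OF this] show ?thesis
      by (simp add: T_def R_def S_def wcomp_def comp_op_def fun_diff_def mult_ac)
  qed
  have dm: "disc_mem A12_normsq (deriv f)" if "disc_mem H2_normsq f" for f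
  proof -
    have f: "f holomorphic_on unit_disc" "H2_normsq f < \<infinity>" using that by (simp_all add: disc_mem_def)
    have "A12_normsq (deriv f) \<le> 2 * H2_normsq f" by (rule A12_normsq_deriv_le[OF f(1)])
    also have "\<dots> < \<infinity>" using f(2) by (simp add: ennreal_mult_less_top)
    finally show ?thesis using holomorphic_deriv[OF f(1) open_ball] by (simp add: disc_mem_def)
  qed
  have lim_sum: "(\<lambda>n. 2 * (F n + G n)) \<longlonglongrightarrow> 0" if "F \<longlonglongrightarrow> 0" "G \<longlonglongrightarrow> 0" for F G :: "nat \<Rightarrow> ennreal"
    using ennreal_tendsto_cmult[OF _ tendsto_add[OF that], of 2] by simp
  have dB: "A12_normsq (deriv f) \<le> ennreal (2 * B)" if "disc_mem H2_normsq f" "H2_normsq f \<le> ennreal B" for f B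
  proof -
    have "A12_normsq (deriv f) \<le> 2 * H2_normsq f"
      using that by (intro A12_normsq_deriv_le) (simp add: disc_mem_def)
    also have "\<dots> \<le> 2 * ennreal B" using that(2) by (rule mult_left_mono) simp
    also have "\<dots> = ennreal (2 * B)" by (simp add: ennreal_mult')
    finally show ?thesis .
  qed
  have Tpt: "(\<lambda>n. T (fs n) z) \<longlonglongrightarrow> 0" and Rpt: "(\<lambda>n. R (fs n) z) \<longlonglongrightarrow> 0" and Spt: "(\<lambda>n. S (fs n) z) \<longlonglongrightarrow> 0"
    if "\<And>x. x \<in> unit_disc \<Longrightarrow> (\<lambda>n. fs n x) \<longlonglongrightarrow> 0" "z \<in> unit_disc" for fs :: "nat \<Rightarrow> complex \<Rightarrow> complex" and z
  proof -
    note pq = that(1)[OF \<phi>D[OF that(2)]] that(1)[OF \<psi>D[OF that(2)]]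
    have "(\<lambda>n. u z * fs n (\<phi> z) - fs n (\<psi> z)) \<longlonglongrightarrow> u z * 0 - 0"
      "(\<lambda>n. deriv u z * fs n (\<phi> z)) \<longlonglongrightarrow> deriv u z * 0"
      "(\<lambda>n. u z * deriv \<phi> z * fs n (\<phi> z) - deriv \<psi> z * fs n (\<psi> z)) \<longlonglongrightarrow> u z * deriv \<phi> z * 0 - deriv \<psi> z * 0"
      by (intro tendsto_diff tendsto_mult tendsto_const pq)+
    then show "(\<lambda>n. T (fs n) z) \<longlonglongrightarrow> 0" "(\<lambda>n. R (fs n) z) \<longlonglongrightarrow> 0" "(\<lambda>n. S (fs n) z) \<longlonglongrightarrow> 0"
      by (simp_all add: T_def R_def S_def wcomp_def comp_op_def)
  qed
  show "compact_op (disc_mem H2_normsq) (disc_nrm H2_normsq) (disc_mem H2_normsq) (disc_nrm H2_normsq) (\<lambda>f. wcomp u \<phi> f - comp_op \<psi> f)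
     \<longleftrightarrow> compact_op (disc_mem H2_normsq) (disc_nrm H2_normsq) (disc_mem A12_normsq) (disc_nrm A12_normsq) (wcomp (deriv u) \<phi>)
       \<and> compact_op (disc_mem A12_normsq) (disc_nrm A12_normsq) (disc_mem A12_normsq) (disc_nrm A12_normsq)
           (\<lambda>f. wcomp (\<lambda>z. u z * deriv \<phi> z) \<phi> f - wcomp (deriv \<psi>) \<psi> f)"
    unfolding T_def[symmetric] R_def[symmetric] S_def[symmetric]
  proof (intro iffI conjI)
    assume RS: "compact_op (disc_mem H2_normsq) (disc_nrm H2_normsq) (disc_mem A12_normsq) (disc_nrm A12_normsq) R
       \<and> compact_op (disc_mem A12_normsq) (disc_nrm A12_normsq) (disc_mem A12_normsq) (disc_nrm A12_normsq) S"
    note R = RS[THEN conjunct1] and S = RS[THEN conjunct2]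
    have Rm: "disc_mem A12_normsq (R f)" if "disc_mem H2_normsq f" for f
      using R that unfolding compact_op_def by blast
    have Sm: "disc_mem A12_normsq (S f)" if "disc_mem A12_normsq f" for f
      using S that unfolding compact_op_def by blast
    \<comment> \<open>Differentiation forgets the constant \<open>T f 0\<close>, so it is carried
      separately; along a locally null sequence it tends to 0 pointwise.\<close>
    have bound: "H2_normsq (T f) \<le> ennreal ((cmod (T f 0))\<^sup>2) + 2 * (A12_normsq (R f) + A12_normsq (S (deriv f)))"
      if f: "f holomorphic_on unit_disc" for f
    proof -
      have "A12_normsq (deriv (T f)) \<le> 2 * (A12_normsq (R f) + A12_normsq (S (deriv f)))"
        by (rule A12_normsq_add_le[OF Rh[OF f] Sh[OF holomorphic_deriv[OF f open_ball]]])
           (simp add: chain[OF f] norm_triangle_ineq)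
      then show ?thesis using H2_normsq_le_deriv[OF Th[OF f]] by (meson add_left_mono order_trans)
    qed
    show "compact_op (disc_mem H2_normsq) (disc_nrm H2_normsq) (disc_mem H2_normsq) (disc_nrm H2_normsq) T"
    proof (rule compact_opI[OF N2 N2 _ Td])
      fix f assume f: "disc_mem H2_normsq f"
      then have fh: "f holomorphic_on unit_disc" by (simp add: disc_mem_def)
      show "disc_mem H2_normsq (T f)"
      proof -
        have "H2_normsq (T f) < \<infinity>"
          by (rule le_less_trans[OF bound[OF fh]])
            (use Rm[OF f] Sm[OF dm[OF f]] in \<open>simp add: disc_mem_def ennreal_mult_less_top\<close>)
        then show ?thesis using Th[OF fh] by (simp add: disc_mem_def)
      qed
    next
      fix fs :: "nat \<Rightarrow> complex \<Rightarrow> complex" and B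
      assume fs: "\<And>n. disc_mem H2_normsq (fs n)" "\<And>n. H2_normsq (fs n) \<le> ennreal B" "locally_null fs"
      have fh: "fs n holomorphic_on unit_disc" for n using fs(1) by (simp add: disc_mem_def)
      have 1: "(\<lambda>n. A12_normsq (R (fs n))) \<longlonglongrightarrow> 0"
        by (rule compact_op_null[OF N2 NA R fs(1,2)]) (auto intro: Rpt locally_null_pointwise[OF fs(3)])
      have 2: "(\<lambda>n. A12_normsq (S (deriv (fs n)))) \<longlonglongrightarrow> 0"
      proof (rule compact_op_null[OF NA NA S, where B = "2 * B"])
        show "disc_mem A12_normsq (deriv (fs n))" for n by (rule dm[OF fs(1)])
        show "A12_normsq (deriv (fs n)) \<le> ennreal (2 * B)" for n by (rule dB[OF fs(1,2)])
        show "(\<lambda>n. S (deriv (fs n)) z) \<longlonglongrightarrow> 0" if "z \<in> unit_disc" for z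
          by (rule Spt[OF _ that]) (rule locally_null_pointwise[OF locally_null_deriv[OF fh fs(3)]])
      qed
      have "(\<lambda>n. T (fs n) 0) \<longlonglongrightarrow> 0" by (rule Tpt) (auto intro: locally_null_pointwise[OF fs(3)])
      then have "(\<lambda>n. ennreal ((cmod (T (fs n) 0))\<^sup>2)) \<longlonglongrightarrow> ennreal ((cmod 0)\<^sup>2)"
        by (intro tendsto_ennrealI tendsto_intros)
      then have 0: "(\<lambda>n. ennreal ((cmod (T (fs n) 0))\<^sup>2)) \<longlonglongrightarrow> 0" by simp
      show "(\<lambda>n. H2_normsq (T (fs n))) \<longlonglongrightarrow> 0"
      proof (rule ennreal_tendsto_0_le)
        show "(\<lambda>n. ennreal ((cmod (T (fs n) 0))\<^sup>2) + 2 * (A12_normsq (R (fs n)) + A12_normsq (S (deriv (fs n))))) \<longlonglongrightarrow> 0"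
          using tendsto_add[OF 0 lim_sum[OF 1 2]] by simp
      qed (rule bound[OF fh])
    qed
  next
    assume TC: "compact_op (disc_mem H2_normsq) (disc_nrm H2_normsq) (disc_mem H2_normsq) (disc_nrm H2_normsq) T"
    have Tm: "disc_mem H2_normsq (T f)" if "disc_mem H2_normsq f" for f
      using TC that unfolding compact_op_def by blast
    define K where "K = (\<lambda>a. \<integral>\<^sup>+z. ennreal (pair_kernel (u z * deriv \<phi> z) (deriv \<psi> z) (\<phi> z) (\<psi> z) a * (2 * (1 - (cmod z)\<^sup>2)) / pi) * indicator unit_disc z \<partial>lborel)"
    have KW: "K a \<le> 192 * (H2_normsq (T (test_fun 0 a)) + H2_normsq (T (test_fun 1 a)) + H2_normsq (T (test_fun 2 a)))"
      if "a \<in> unit_disc" for a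
      unfolding K_def T_def by (rule pair_kernel_integral_le[OF u \<phi> \<psi> that])
    have K3: "K a \<le> ennreal (576 * c)" if "a \<in> unit_disc" "0 \<le> c" "\<And>j. H2_normsq (T (test_fun j a)) \<le> ennreal c" for a c
    proof -
      have "K a \<le> 192 * (ennreal c + ennreal c + ennreal c)"
        by (rule order_trans[OF KW[OF that(1)]]) (intro mult_left_mono add_mono that(3), simp)
      also have "\<dots> = ennreal (192 * (c + c + c))"
        using that(2) by (subst ennreal_mult', simp, subst ennreal_plus, simp, simp, subst ennreal_plus) auto
      finally show ?thesis by simp
    qed
    obtain C where C: "0 \<le> C" "\<And>f. disc_mem H2_normsq f \<Longrightarrow> H2_normsq f \<le> ennreal 1 \<Longrightarrow> H2_normsq (T f) \<le> ennreal C"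
      using compact_op_bounded[OF N2 N2 TC, of 1] by blast
    \<comment> \<open>The test functions lie in the unit ball of H^2, so one bound for
      \<open>T\<close> on that ball gives a bound on \<open>K\<close> uniform in \<open>a\<close>;
      576 = 3 * 192.\<close>
    have KD: "K a \<le> ennreal (576 * C)" if "a \<in> unit_disc" for a
      by (rule K3[OF that C(1) C(2)[OF disc_mem_test_fun[OF that]]]) (use H2_normsq_test_fun[OF that] in simp)
    have Ke: "\<exists>r<1. \<forall>a\<in>unit_disc. r < cmod a \<longrightarrow> K a \<le> ennreal e" if "0 < e" for e
    proof -
      have "\<exists>r<1. \<forall>a\<in>unit_disc. r < cmod a \<longrightarrow> H2_normsq (T (test_fun j a)) \<le> ennreal (e / 576)" for j
        by (rule compact_op_test_fun_small[OF TC Tpt]) (use that in auto)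
      then obtain r where r: "\<And>j. r j < 1" "\<And>j a. a \<in> unit_disc \<Longrightarrow> r j < cmod a \<Longrightarrow> H2_normsq (T (test_fun j a)) \<le> ennreal (e / 576)"
        by metis
      define \<rho> where "\<rho> = max (r 0) (max (r 1) (r 2))"
      have "K a \<le> ennreal e" if a: "a \<in> unit_disc" "\<rho> < cmod a" for a
      proof -
        have "K a \<le> 192 * (ennreal (e / 576) + ennreal (e / 576) + ennreal (e / 576))"
          by (rule order_trans[OF KW[OF a(1)]]) (intro mult_left_mono add_mono r(2) a(1); use a(2) in \<open>simp add: \<rho>_def\<close>)
        also have "\<dots> = ennreal (192 * (e / 576 + e / 576 + e / 576))"
          using \<open>0 < e\<close> by (subst ennreal_mult', simp, subst ennreal_plus, simp, simp, subst ennreal_plus) auto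
        finally show ?thesis by simp
      qed
      then show ?thesis using r(1) by (intro exI[of _ \<rho>]) (auto simp: \<rho>_def)
    qed
    have SK: "A12_normsq (S h) \<le> ennreal (4096 * 84000000) *
        (\<integral>\<^sup>+a. ennreal ((cmod (h a))\<^sup>2 * (2 * (1 - (cmod a)\<^sup>2)) / pi) * indicator unit_disc a * K a \<partial>lborel)"
      if "h holomorphic_on unit_disc" for h
      unfolding S_def K_def by (rule A12_normsq_weighted_difference_le[OF u \<phi> \<psi> that])
    \<comment> \<open>Used twice: for the compactness of \<open>S\<close> itself, and below for the
      derivatives of an H^2 sequence when treating \<open>R\<close>.\<close>
    have Snull: "(\<lambda>n. A12_normsq (S (fs n))) \<longlonglongrightarrow> 0"
      if "\<And>n. disc_mem A12_normsq (fs n)" "\<And>n. A12_normsq (fs n) \<le> ennreal B" "locally_null fs" for fs B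
      by (rule vanishing_mass_null[OF SK _ _ KD Ke _ that(2,3)]) (use that(1) C(1) in \<open>auto simp: disc_mem_def\<close>)
    have Sm: "disc_mem A12_normsq (S h)" if h: "disc_mem A12_normsq h" for h
    proof -
      have hh: "h holomorphic_on unit_disc" using h by (simp add: disc_mem_def)
      let ?w = "\<lambda>a. ennreal ((cmod (h a))\<^sup>2 * (2 * (1 - (cmod a)\<^sup>2)) / pi) * indicator unit_disc a"
      have "(\<integral>\<^sup>+a. ?w a * K a \<partial>lborel) \<le> (\<integral>\<^sup>+a. ?w a * ennreal (576 * C) \<partial>lborel)"
      proof (rule nn_integral_mono)
        fix a show "?w a * K a \<le> ?w a * ennreal (576 * C)"
          by (cases "a \<in> unit_disc") (simp_all add: mult_left_mono KD)
      qed
      also have "\<dots> = A12_normsq h * ennreal (576 * C)"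
        unfolding A12_normsq_def by (rule nn_integral_multc, simp only: measurable_lborel2)
          (intro borel_measurable_ennreal_indicator A12_weight_continuous hh open_ball)
      also have "\<dots> < \<infinity>" using h by (simp add: disc_mem_def ennreal_mult_less_top)
      finally have "ennreal (4096 * 84000000) * (\<integral>\<^sup>+a. ?w a * K a \<partial>lborel) < \<infinity>"
        by (simp add: ennreal_mult_less_top)
      with SK[OF hh] have "A12_normsq (S h) < \<infinity>" by (rule le_less_trans)
      then show ?thesis using Sh[OF hh] by (simp add: disc_mem_def)
    qed
    show "compact_op (disc_mem A12_normsq) (disc_nrm A12_normsq) (disc_mem A12_normsq) (disc_nrm A12_normsq) S"
      by (rule compact_opI[OF NA NA Sm Sd Snull])
    \<comment> \<open>With \<open>S\<close> settled, the chain rule is read backwards: R f is the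
      difference of (T f)' and S f', and both are null along locally null sequences.\<close>
    have Rb: "A12_normsq (R f) \<le> 2 * (A12_normsq (deriv (T f)) + A12_normsq (S (deriv f)))"
      if f: "f holomorphic_on unit_disc" for f
    proof (rule A12_normsq_add_le)
      fix z assume "z \<in> unit_disc"
      then have "R f z = deriv (T f) z - S (deriv f) z" by (simp add: chain[OF f])
      then show "cmod (R f z) \<le> cmod (deriv (T f) z) + cmod (S (deriv f) z)" by (simp add: norm_triangle_ineq4)
    qed (auto intro!: Th Sh holomorphic_deriv f)
    show "compact_op (disc_mem H2_normsq) (disc_nrm H2_normsq) (disc_mem A12_normsq) (disc_nrm A12_normsq) R"
    proof (rule compact_opI[OF N2 NA _ Rd])
      fix f assume f: "disc_mem H2_normsq f"
      then have fh: "f holomorphic_on unit_disc" by (simp add: disc_mem_def)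
      show "disc_mem A12_normsq (R f)"
      proof -
        have "A12_normsq (R f) < \<infinity>"
          by (rule le_less_trans[OF Rb[OF fh]])
            (use dm[OF Tm[OF f]] Sm[OF dm[OF f]] in \<open>simp add: disc_mem_def ennreal_mult_less_top\<close>)
        then show ?thesis using Rh[OF fh] by (simp add: disc_mem_def)
      qed
    next
      fix fs :: "nat \<Rightarrow> complex \<Rightarrow> complex" and B
      assume fs: "\<And>n. disc_mem H2_normsq (fs n)" "\<And>n. H2_normsq (fs n) \<le> ennreal B" "locally_null fs"
      have fh: "fs n holomorphic_on unit_disc" for n using fs(1) by (simp add: disc_mem_def)
      have T0: "(\<lambda>n. H2_normsq (T (fs n))) \<longlonglongrightarrow> 0"
        by (rule compact_op_null[OF N2 N2 TC fs(1,2)]) (auto intro: Tpt locally_null_pointwise[OF fs(3)])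
      have 1: "(\<lambda>n. A12_normsq (deriv (T (fs n)))) \<longlonglongrightarrow> 0"
      proof (rule ennreal_tendsto_0_le)
        show "(\<lambda>n. 2 * H2_normsq (T (fs n))) \<longlonglongrightarrow> 0"
          using ennreal_tendsto_cmult[OF _ T0, of 2] by simp
      qed (rule A12_normsq_deriv_le[OF Th[OF fh]])
      have 2: "(\<lambda>n. A12_normsq (S (deriv (fs n)))) \<longlonglongrightarrow> 0"
      proof (rule Snull[where B = "2 * B"])
        show "disc_mem A12_normsq (deriv (fs n))" for n by (rule dm[OF fs(1)])
        show "A12_normsq (deriv (fs n)) \<le> ennreal (2 * B)" for n by (rule dB[OF fs(1,2)])
        show "locally_null (\<lambda>n. deriv (fs n))" by (rule locally_null_deriv[OF fh fs(3)])
      qed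
      show "(\<lambda>n. A12_normsq (R (fs n))) \<longlonglongrightarrow> 0"
        by (rule ennreal_tendsto_0_le[OF lim_sum[OF 1 2]]) (rule Rb[OF fh])
    qed
  qed
qed

end
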